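(* Let $0\le k\le n$ be integers, $\sigma\in S_n$, $r\in\{00,10,01,11\}$ and $I\in\mathcal I_k$. The class $[W^{(r)}_{\sigma,I}]\in H^*_{\mathbb T}(\mathrm{Gr}_k\mathbb C^n)$ satisfies the axioms defining the super stable envelope class $\kappa^{(r)}_{\sigma,I}$; that is: (A0) $[W^{(r)}_{\sigma,I}]$ is homogeneous of degree $d^{(r)}$; (A1) $[W^{(r)}_{\sigma,I}]|_I=e_I^{(r),ver,\sigma-}\,e_I^{(r),hor,\sigma-}$; (A2) $[W^{(r)}_{\sigma,I}]|_J$ is divisible by $\hbar$ in $\mathbb C[z_1,\dots,z_n,\hbar]$ for every $J\in\mathcal I_k$ with $J\neq I$; (A3) $[W^{(r)}_{\sigma,I}]|_J$ is divisible by $e_J^{(r),ver,\sigma-}$ in $\mathbb C[z_1,\dots,z_n,\hbar]$ for every $J\in\mathcal I_k$.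
   Context: Sets. $\mathcal I_k$ is the set of $k$-element subsets of $\{1,\dots,n\}$; $\bar I$ is the complement of $I$. For $I\in\mathcal I_k$ write $I=\{i_1<\dots<i_k\}$. Cohomology. All cohomology has complex coefficients. The torus $A=(\mathbb C^\times)^n$ acts on $\mathbb C^n$ and hence on $\mathrm{Gr}_k\mathbb C^n$; its fixed points are the coordinate $k$-planes $p_I$, $I\in\mathcal I_k$. Let $\mathbb T=A\times\mathbb C^\times_\hbar$, with $\mathbb C^\times_\hbar$ acting trivially on $\mathrm{Gr}_k\mathbb C^n$ (and by scaling in the fibers of the vector bundles below). $H^*_{\mathbb T}(pt)=\mathbb C[z_1,\dots,z_n,\hbar]$, with $\deg z_i=\deg\hbar=1$ (so degree $d$ classes live in $H^{2d}$). Restriction to fixed points gives the injective map $\mathrm{Loc}:H^*_{\mathbb T}(\mathrm{Gr}_k\mathbb C^n)\to\bigoplus_{I\in\mathcal I_k}\mathbb C[z_1,\dots,z_n,\hbar]$; the $I$-component of $\kappa$ is written $\kappa|_I$. (The Chern roots $t_1,\dots,t_k$ of the tautological subbundle $S$ restrict to $\{z_i\}_{i\in I}$ at $p_I$.) Spaces. With $0\to S\to\mathbb C^n\to Q\to0$ the tautological sequence over $\mathrm{Gr}_k\mathbb C^n$, $X^{(r)}_{k,n}$ is the total space of the bundle $\mathrm{Hom}(Q,S)$ for $r=00$, $\mathrm{Hom}(\mathbb C^n,S)$ for $r=10$, $\mathrm{Hom}(Q,\mathbb C^n)$ for $r=01$, $\mathrm{Hom}(S,S)\oplus\mathrm{Hom}(Q,\mathbb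 C^n)$ for $r=11$. One has $H^*_{\mathbb T}(X^{(r)}_{k,n})=H^*_{\mathbb T}(\mathrm{Gr}_k\mathbb C^n)$. Weights at $p_I$. Horizontal weights: $z_j-z_i$ for $i\in I,\ j\in\bar I$. Vertical weights (fiber weights): for $r=00$: $z_i-z_j+\hbar$ ($i\in I,j\in\bar I$); for $r=10$: $z_i-z_s+\hbar$ ($i\in I$, $s\in\{1,\dots,n\}$); for $r=01$: $z_s-z_j+\hbar$ ($j\in\bar I$, $s\in\{1,\dots,n\}$); for $r=11$: $z_i-z_j+\hbar$ for all $(i,j)\in (I\times I)\cup(\bar I\times\bar I)\cup(I\times\bar I)$. A weight $z_i-z_j+\epsilon\hbar$ ($\epsilon\in\{0,1\}$) is $\sigma$-repelling if $\sigma^{-1}(i)>\sigma^{-1}(j)$. $e_I^{(r),hor,\sigma-}$ (resp. $e_I^{(r),ver,\sigma-}$) is the product of all $\sigma$-repelling horizontal (resp. vertical) weights at $p_I$. The integer $d^{(r)}$ is: $d^{(00)}=k(n-k)$, $d^{(10)}=k(n-k)+\binom k2$, $d^{(01)}=k(n-k)+\binom{n-k}2$, $d^{(11)}=\binom n2$. Super weight functions. For $f$ a rational function of $t_1,\dots,t_k$ (and other variables), $\mathrm{Sym}_k f=\sum_{\tau\in S_k}f(t_{\tau(1)},\dots,t_{\tau(k)})$. Put $W^{(r)}_I=\mathrm{Sym}_k(U^{(r)}_I)$ where $$U^{(00)}_I=\prod_{a=1}^k\Big(\prod_{b=1}^{i_a-1}(t_a-z_b+\hbar)\prod_{b=i_a+1}^n(z_b-t_a)\Big)\prod_{1\le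 a<b\le k}\frac1{(t_b-t_a+\hbar)(t_b-t_a)},$$ $$U^{(10)}_I=\prod_{a=1}^k\Big(\prod_{b=1}^{i_a-1}(t_a-z_b+\hbar)\prod_{b=i_a+1}^n(z_b-t_a)\Big)\prod_{1\le a<b\le k}\frac1{t_b-t_a},$$ $$U^{(01)}_I=\prod_{a=1}^k\Big(\prod_{b=1}^{i_a-1}(z_b-t_a+\hbar)\prod_{b=i_a+1}^n(z_b-t_a)\Big)\prod_{1\le a<b\le k}\frac1{t_b-t_a}\cdot\hbar^k\prod_{1\le a<b\le n}(z_b-z_a+\hbar)\prod_{a=1}^k\prod_{b=1}^n\frac1{z_b-t_a+\hbar},$$ $$U^{(11)}_I=\prod_{a=1}^k\Big(\prod_{b=1}^{i_a-1}(z_b-t_a+\hbar)\prod_{b=i_a+1}^n(z_b-t_a)\Big)\prod_{1\le a<b\le k}\frac{t_b-t_a+\hbar}{t_b-t_a}\cdot\hbar^k\prod_{1\le a<b\le n}(z_b-z_a+\hbar)\prod_{a=1}^k\prod_{b=1}^n\frac1{z_b-t_a+\hbar}.$$ For $\sigma\in S_n$ set $W^{(r)}_{\sigma,I}=W^{(r)}_{\sigma^{-1}(I)}(t_1,\dots,t_k,z_{\sigma(1)},\dots,z_{\sigma(n)})$, i.e. take $W^{(r)}_{\sigma^{-1}(I)}$ and replace each $z_b$ by $z_{\sigma(b)}$. For $J=\{j_1<\dots<j_k\}$, $W^{(r)}_{\sigma,I}(z_J,z,\hbar)$ denotes the result of substituting $t_s=z_{j_s}$, $s=1,\dots,k$.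 The class $[W^{(r)}_{\sigma,I}]$. The tuple $(W^{(r)}_{\sigma,I}(z_J,z,\hbar))_{J\in\mathcal I_k}$ consists of polynomials and lies in the image of $\mathrm{Loc}$; $[W^{(r)}_{\sigma,I}]\in H^*_{\mathbb T}(\mathrm{Gr}_k\mathbb C^n)$ is the unique class with $[W^{(r)}_{\sigma,I}]|_J=W^{(r)}_{\sigma,I}(z_J,z,\hbar)$ for all $J\in\mathcal I_k$. *)

theory Defs
  imports
    Complex_Main
    "HOL-Library.Poly_Mapping"
    "HOL-Computational_Algebra.Fraction_Field"
    "HOL-Combinatorics.Permutations"
    "HOL-Algebra.Divisibility"
    "HOL-Algebra.QuotRing"
begin

section \<open>Polynomials in Chern roots and equivariant parameters\<close>

text \<open>
  \<open>Z i\<close> and \<open>Hbar\<close> are the equivariant parameters of the torus.  \<open>T a\<close> are the Chern roots of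
  the tautological bundles over the Grassmannian of \<open>k\<close>-planes: \<open>T 1, \<dots>, T k\<close> those of the
  subbundle \<open>S\<close>, and \<open>T (k + 1), \<dots>, T n\<close> those of the quotient bundle \<open>Q\<close>.
\<close>

datatype var = Hbar | Z nat | T nat

text \<open>
  The order on variables carries no meaning; the library requires one to establish that
  \<open>(var \<Rightarrow>\<^sub>0 nat) \<Rightarrow>\<^sub>0 complex\<close> is an integral domain, hence has a field of fractions.
\<close>

fun var_code :: "var \<Rightarrow> nat" where
  "var_code Hbar = 0"
| "var_code (Z i) = 2 * i + 1"
| "var_code (T a) = 2 * a + 2"

lemma var_code_inject: "var_code u = var_code v \<Longrightarrow> u = v"
  by (cases u; cases v) (auto, presburger+)

instantiation var :: linorder
begin

definition less_eq_var :: "var \<Rightarrow> var \<Rightarrow> bool" where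
  "u \<le> v \<longleftrightarrow> var_code u \<le> var_code v"

definition less_var :: "var \<Rightarrow> var \<Rightarrow> bool" where
  "u < v \<longleftrightarrow> var_code u < var_code v"

instance
  by standard (auto simp: less_eq_var_def less_var_def intro: var_code_inject)

end

type_synonym mpoly = "(var \<Rightarrow>\<^sub>0 nat) \<Rightarrow>\<^sub>0 complex"

definition Var :: "var \<Rightarrow> mpoly" where
  "Var v = Poly_Mapping.single (Poly_Mapping.single v 1) 1"

definition poly_subst :: "(var \<Rightarrow> mpoly) \<Rightarrow> mpoly \<Rightarrow> mpoly" where
  "poly_subst f p =
     (\<Sum>m\<in>Poly_Mapping.keys p. Poly_Mapping.single 0 (Poly_Mapping.lookup p m)
        * (\<Prod>v\<in>Poly_Mapping.keys m. f v ^ Poly_Mapping.lookup m v))"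

text \<open>Every variable, including \<open>Hbar\<close>, has degree 1.\<close>

definition homogeneous :: "nat \<Rightarrow> mpoly \<Rightarrow> bool" where
  "homogeneous d p \<longleftrightarrow>
     (\<forall>m\<in>Poly_Mapping.keys p. (\<Sum>v\<in>Poly_Mapping.keys m. Poly_Mapping.lookup m v) = d)"

definition mpoly_ring :: "var set \<Rightarrow> mpoly ring" where
  "mpoly_ring V =
     \<lparr>carrier = {p. \<forall>m\<in>Poly_Mapping.keys p. Poly_Mapping.keys m \<subseteq> V},
      monoid.mult = (*), one = 1, zero = 0, add = (+)\<rparr>"

definition esym :: "nat \<Rightarrow> nat \<Rightarrow> (nat \<Rightarrow> mpoly) \<Rightarrow> mpoly" where
  "esym n m x = (\<Sum>A | A \<subseteq> {1..n} \<and> card A = m. \<Prod>a\<in>A. x a)"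

section \<open>Equivariant cohomology of the Grassmannian\<close>

text \<open>\<open>nth_smallest I a\<close> is \<open>i\<^sub>a\<close> for \<open>I = {i\<^sub>1 < i\<^sub>2 < \<dots>}\<close>; positions start at 1.\<close>

definition nth_smallest :: "nat set \<Rightarrow> nat \<Rightarrow> nat" where
  "nth_smallest I a = sorted_list_of_set I ! (a - 1)"

definition ksubsets :: "nat \<Rightarrow> nat \<Rightarrow> nat set set" where
  "ksubsets k n = {I. I \<subseteq> {1..n} \<and> card I = k}"

definition HT_pt :: "nat \<Rightarrow> mpoly ring" where
  "HT_pt n = mpoly_ring (insert Hbar (Z ` {1..n}))"

definition chern_ring :: "nat \<Rightarrow> nat \<Rightarrow> mpoly ring" where
  "chern_ring k n =
     mpoly_ring (insert Hbar (Z ` {1..n} \<union> T ` {1..n}))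
       \<lparr>carrier :=
         {p \<in> carrier (mpoly_ring (insert Hbar (Z ` {1..n} \<union> T ` {1..n}))).
            \<forall>\<tau>. \<tau> permutes {1..n} \<and> \<tau> ` {1..k} = {1..k} \<longrightarrow>
              poly_subst (\<lambda>v. case v of T a \<Rightarrow> Var (T (\<tau> a)) | _ \<Rightarrow> Var v) p = p}\<rparr>"

text \<open>
  Borel's presentation of \<open>H\<^sub>\<bbbT>\<^sup>*(Gr\<^sub>k \<complex>\<^sup>n)\<close>: polynomials over \<open>H\<^sub>\<bbbT>\<^sup>*(pt)\<close> in the Chern roots of \<open>S\<close> and
  \<open>Q\<close>, symmetric in each of the two groups, modulo \<open>c(S) c(Q) = c(\<complex>\<^sup>n)\<close>.
\<close>

definition HT_Gr :: "nat \<Rightarrow> nat \<Rightarrow> mpoly set ring" where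
  "HT_Gr k n =
     chern_ring k n Quot
       genideal (chern_ring k n)
         {esym n m (\<lambda>a. Var (T a)) - esym n m (\<lambda>b. Var (Z b)) |m. m \<in> {1..n}}"

text \<open>
  At the fixed point \<open>p\<^sub>J\<close> the roots of \<open>S\<close> become the \<open>z\<^sub>j\<close> with \<open>j \<in> J\<close>, those of \<open>Q\<close> the remaining
  \<open>z\<^sub>j\<close>.  The classes in \<open>HT_Gr k n\<close> are cosets, on which this substitution is constant.
\<close>

definition fixed_point_subst :: "nat \<Rightarrow> nat set \<Rightarrow> mpoly \<Rightarrow> mpoly" where
  "fixed_point_subst n J =
     poly_subst (\<lambda>v. case v of
        T a \<Rightarrow> if a \<le> card J then Var (Z (nth_smallest J a))
               else Var (Z (nth_smallest ({1..n} - J) (a - card J)))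
      | _ \<Rightarrow> Var v)"

definition restrict_class :: "nat \<Rightarrow> mpoly set \<Rightarrow> nat set \<Rightarrow> mpoly" where
  "restrict_class n \<kappa> J = the_elem (fixed_point_subst n J ` \<kappa>)"

text \<open>The grading of a quotient by a homogeneous ideal.\<close>

definition homogeneous_class :: "nat \<Rightarrow> mpoly set \<Rightarrow> bool" where
  "homogeneous_class d \<kappa> \<longleftrightarrow> (\<exists>p\<in>\<kappa>. homogeneous d p)"

section \<open>Weights at the fixed points\<close>

datatype flavour = R00 | R10 | R01 | R11

text \<open>\<open>inv_into UNIV \<sigma>\<close> is the inverse permutation; HOL-Algebra claims the syntax \<open>inv\<close>.\<close>

definition repelling :: "(nat \<Rightarrow> nat) \<Rightarrow> nat \<Rightarrow> nat \<Rightarrow> bool" where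
  "repelling \<sigma> i j \<longleftrightarrow> inv_into UNIV \<sigma> i > inv_into UNIV \<sigma> j"

text \<open>
  A pair \<open>(i, j)\<close> stands for the weight \<open>z\<^sub>i - z\<^sub>j\<close> in the horizontal and for \<open>z\<^sub>i - z\<^sub>j + \<hbar>\<close> in the
  vertical case.
\<close>

definition hor_weights :: "nat \<Rightarrow> nat set \<Rightarrow> (nat \<times> nat) set" where
  "hor_weights n I = ({1..n} - I) \<times> I"

fun ver_weights :: "flavour \<Rightarrow> nat \<Rightarrow> nat set \<Rightarrow> (nat \<times> nat) set" where
  "ver_weights R00 n I = I \<times> ({1..n} - I)"
| "ver_weights R10 n I = I \<times> {1..n}"
| "ver_weights R01 n I = {1..n} \<times> ({1..n} - I)"
| "ver_weights R11 n I = I \<times> I \<union> ({1..n} - I) \<times> ({1..n} - I) \<union> I \<times> ({1..n} - I)"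

definition e_hor :: "nat \<Rightarrow> (nat \<Rightarrow> nat) \<Rightarrow> nat set \<Rightarrow> mpoly" where
  "e_hor n \<sigma> I =
     (\<Prod>(i, j) \<in> {(i, j) \<in> hor_weights n I. repelling \<sigma> i j}. Var (Z i) - Var (Z j))"

definition e_ver :: "flavour \<Rightarrow> nat \<Rightarrow> (nat \<Rightarrow> nat) \<Rightarrow> nat set \<Rightarrow> mpoly" where
  "e_ver r n \<sigma> I =
     (\<Prod>(i, j) \<in> {(i, j) \<in> ver_weights r n I. repelling \<sigma> i j}.
        Var (Z i) - Var (Z j) + Var Hbar)"

fun env_degree :: "flavour \<Rightarrow> nat \<Rightarrow> nat \<Rightarrow> nat" where
  "env_degree R00 k n = k * (n - k)"
| "env_degree R10 k n = k * (n - k) + (k choose 2)"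
| "env_degree R01 k n = k * (n - k) + ((n - k) choose 2)"
| "env_degree R11 k n = n choose 2"

section \<open>Super weight functions\<close>

text \<open>
  A rational function of \<open>t\<^sub>1, \<dots>, t\<^sub>k, z\<^sub>1, \<dots>, z\<^sub>n, \<hbar>\<close> is rendered as the function it induces on the
  points \<open>(t, z, \<hbar>)\<close> of an arbitrary field.  Below it is evaluated in the field of fractions of
  \<open>\<complex>[z, \<hbar>]\<close>, with pairwise distinct variables among \<open>z\<^sub>1, \<dots>, z\<^sub>n\<close> substituted for
  \<open>t\<^sub>1, \<dots>, t\<^sub>k\<close>.  There every denominator occurring in any summand is nonzero, so that the
  convention \<open>x / 0 = 0\<close> plays no role.
\<close>

definition Sym :: "nat \<Rightarrow> ((nat \<Rightarrow> 'a) \<Rightarrow> 'a) \<Rightarrow> (nat \<Rightarrow> 'a) \<Rightarrow> 'a :: comm_monoid_add" where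
  "Sym k f t = (\<Sum>\<tau> | \<tau> permutes {1..k}. f (\<lambda>a. t (\<tau> a)))"

fun U_fun :: "flavour \<Rightarrow> nat \<Rightarrow> nat \<Rightarrow> nat set \<Rightarrow> (nat \<Rightarrow> 'a) \<Rightarrow> (nat \<Rightarrow> 'a) \<Rightarrow> 'a \<Rightarrow> 'a :: field" where
  "U_fun R00 k n I z t h =
     (\<Prod>a\<in>{1..k}. (\<Prod>b\<in>{1..<nth_smallest I a}. t a - z b + h)
                 * (\<Prod>b\<in>{nth_smallest I a<..n}. z b - t a))
   * (\<Prod>a\<in>{1..k}. \<Prod>b\<in>{a<..k}. 1 / ((t b - t a + h) * (t b - t a)))"
| "U_fun R10 k n I z t h =
     (\<Prod>a\<in>{1..k}. (\<Prod>b\<in>{1..<nth_smallest I a}. t a - z b + h)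
                 * (\<Prod>b\<in>{nth_smallest I a<..n}. z b - t a))
   * (\<Prod>a\<in>{1..k}. \<Prod>b\<in>{a<..k}. 1 / (t b - t a))"
| "U_fun R01 k n I z t h =
     (\<Prod>a\<in>{1..k}. (\<Prod>b\<in>{1..<nth_smallest I a}. z b - t a + h)
                 * (\<Prod>b\<in>{nth_smallest I a<..n}. z b - t a))
   * (\<Prod>a\<in>{1..k}. \<Prod>b\<in>{a<..k}. 1 / (t b - t a))
   * h ^ k * (\<Prod>a\<in>{1..n}. \<Prod>b\<in>{a<..n}. z b - z a + h)
   * (\<Prod>a\<in>{1..k}. \<Prod>b\<in>{1..n}. 1 / (z b - t a + h))"
| "U_fun R11 k n I z t h =
     (\<Prod>a\<in>{1..k}. (\<Prod>b\<in>{1..<nth_smallest I a}. z b - t a + h)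
                 * (\<Prod>b\<in>{nth_smallest I a<..n}. z b - t a))
   * (\<Prod>a\<in>{1..k}. \<Prod>b\<in>{a<..k}. (t b - t a + h) / (t b - t a))
   * h ^ k * (\<Prod>a\<in>{1..n}. \<Prod>b\<in>{a<..n}. z b - z a + h)
   * (\<Prod>a\<in>{1..k}. \<Prod>b\<in>{1..n}. 1 / (z b - t a + h))"

definition W_fun ::
    "flavour \<Rightarrow> nat \<Rightarrow> nat \<Rightarrow> nat set \<Rightarrow> (nat \<Rightarrow> 'a) \<Rightarrow> (nat \<Rightarrow> 'a) \<Rightarrow> 'a \<Rightarrow> 'a :: field" where
  "W_fun r k n I z t h = Sym k (\<lambda>t. U_fun r k n I z t h) t"

definition W_perm ::
    "flavour \<Rightarrow> nat \<Rightarrow> nat \<Rightarrow> (nat \<Rightarrow> nat) \<Rightarrow> nat set \<Rightarrow>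
       (nat \<Rightarrow> 'a) \<Rightarrow> (nat \<Rightarrow> 'a) \<Rightarrow> 'a \<Rightarrow> 'a :: field" where
  "W_perm r k n \<sigma> I z t h = W_fun r k n (inv_into UNIV \<sigma> ` I) (\<lambda>b. z (\<sigma> b)) t h"

definition W_restr ::
    "flavour \<Rightarrow> nat \<Rightarrow> nat \<Rightarrow> (nat \<Rightarrow> nat) \<Rightarrow> nat set \<Rightarrow> nat set \<Rightarrow> mpoly fract" where
  "W_restr r k n \<sigma> I J =
     W_perm r k n \<sigma> I
       (\<lambda>b. Fract (Var (Z b)) 1)
       (\<lambda>s. Fract (Var (Z (nth_smallest J s))) 1)
       (Fract (Var Hbar) 1)"

definition W_class ::
    "flavour \<Rightarrow> nat \<Rightarrow> nat \<Rightarrow> (nat \<Rightarrow> nat) \<Rightarrow> nat set \<Rightarrow> mpoly set" where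
  "W_class r k n \<sigma> I =
     (THE \<kappa>. \<kappa> \<in> carrier (HT_Gr k n) \<and>
        (\<forall>J\<in>ksubsets k n. Fract (restrict_class n \<kappa> J) 1 = W_restr r k n \<sigma> I J))"

end

theory Submission
  imports Defs
begin

text \<open>
  The restriction of \<open>W\<^sub>\<sigma>\<^sub>,\<^sub>I\<close> to \<open>p\<^sub>J\<close> is an alternating sum over the enumerations \<open>\<mu>\<close> of \<open>J\<close>, divided by a
  Vandermonde product.  A summand vanishes unless \<open>\<mu> a \<le> i\<^sub>a\<close> for all \<open>a\<close> in the order given by \<open>\<sigma>\<close>.
  If it does not vanish, every factor of its denominator that involves \<open>\<hbar>\<close> cancels, and the
  quotient is still divisible by all \<open>\<sigma>\<close>-repelling vertical weights at \<open>p\<^sub>J\<close>; a strict inequality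
  \<open>\<mu> a < i\<^sub>a\<close> leaves one more factor \<open>\<hbar>\<close>.  Setting \<open>z\<^sub>i = z\<^sub>j\<close> makes the summands of \<open>\<mu>\<close> and of
  its composition with the transposition of \<open>i\<close> and \<open>j\<close> agree: for \<open>i, j \<in> J\<close> this shows that
  the Vandermonde product divides the alternating sum, otherwise it gives the congruences
  between the restrictions to \<open>p\<^sub>J\<close> and \<open>p\<^sub>J\<^sub>'\<close> that characterize the image of localization.

  Both halves of localization are proved on the full flag variety, where a fixed point is a
  permutation \<open>w\<close> and restriction is the substitution \<open>T\<^sub>a \<mapsto> z\<^sub>w\<^sub>(\<^sub>a\<^sub>)\<close>, by induction on the number
  of Chern roots: one root \<open>T\<^sub>s\<close> is divided by the linear factors \<open>T\<^sub>s - z\<^sub>b\<close> one after the other.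
  Averaging over \<open>S\<^sub>k \<times> S\<^sub>n\<^sub>-\<^sub>k\<close> then yields the Grassmannian.
\<close>

section \<open>Substitution into polynomials\<close>

text \<open>The class is given by a definite description in a quotient ring, so nothing can be said
  about it before both halves of localization are available for this presentation: restrictions
  determine a class, and every family with the congruences comes from one. On the Grassmannian only
  symmetric functions of the roots are at hand, and they offer no linear factor to divide by; on the
  flag variety a single root \<open>T s\<close> takes the value \<open>Z (w s)\<close>. This is the
  reason for the detour, and complex coefficients allow the division by the order of the group on
  the way back.

  Divisibility by \<open>Z i - Z j\<close> or \<open>T s - Z b\<close> is vanishing under a
  substitution. Such a linear form is prime because the ring is a domain, which is what allows
  factors to be split off one by one.

  The vertical weights are taken out of the summands before the division by the Vandermonde product.
  Each of them contains \<hbar> and stays nonzero for \<open>Z i = Z j\<close>, so the cofactors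
  keep the symmetry on which that division rests, and the divisibility demanded by (A2) and (A3)
  survives it.\<close>

abbreviation Const :: "complex \<Rightarrow> mpoly" where
  "Const c \<equiv> Poly_Mapping.single 0 c"

lemma poly_mapping_sum_single:
  "p = (\<Sum>m\<in>Poly_Mapping.keys p. Poly_Mapping.single m (Poly_Mapping.lookup p m))"
proof (rule poly_mapping_eqI)
  fix k
  have "(\<Sum>m\<in>Poly_Mapping.keys p. Poly_Mapping.lookup p m when m = k)
      = (\<Sum>m\<in>Poly_Mapping.keys p. if m = k then Poly_Mapping.lookup p k else 0)"
    by (intro sum.cong) (auto simp: when_def)
  then show "Poly_Mapping.lookup p k = Poly_Mapping.lookup
      (\<Sum>m\<in>Poly_Mapping.keys p. Poly_Mapping.single m (Poly_Mapping.lookup p m)) k"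
    by (auto simp: lookup_sum lookup_single in_keys_iff sum.delta')
qed

lemma poly_mapping_add_induct [case_names single add]:
  fixes p :: "'a \<Rightarrow>\<^sub>0 'b::comm_monoid_add"
  assumes single: "\<And>m c. P (Poly_Mapping.single m c)"
    and add: "\<And>p q. P p \<Longrightarrow> P q \<Longrightarrow> P (p + q)"
  shows "P p"
proof -
  have P0: "P 0"
    using single[of undefined 0] by simp
  have "P (\<Sum>m\<in>A. Poly_Mapping.single m (Poly_Mapping.lookup p m))" if "finite A" for A
    using that by induction (simp_all add: P0 single add)
  from this[OF finite_keys] show ?thesis
    using poly_mapping_sum_single[of p] by metis
qed

definition monom_eval :: "(var \<Rightarrow> 'a::comm_monoid_mult) \<Rightarrow> (var \<Rightarrow>\<^sub>0 nat) \<Rightarrow> 'a" where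
  "monom_eval f m = (\<Prod>v\<in>Poly_Mapping.keys m. f v ^ Poly_Mapping.lookup m v)"

lemma monom_eval_superset:
  "finite A \<Longrightarrow> Poly_Mapping.keys m \<subseteq> A \<Longrightarrow>
    monom_eval f m = (\<Prod>v\<in>A. f v ^ Poly_Mapping.lookup m v)"
  unfolding monom_eval_def
  by (rule prod.mono_neutral_left) (auto simp: in_keys_iff)

lemma monom_eval_add: "monom_eval f (m + m') = monom_eval f m * monom_eval f m'"
proof -
  let ?A = "Poly_Mapping.keys m \<union> Poly_Mapping.keys m'"
  have "monom_eval f (m + m') = (\<Prod>v\<in>?A. f v ^ Poly_Mapping.lookup (m + m') v)"
    by (rule monom_eval_superset) (auto simp: keys_add)
  then show ?thesis
    by (simp add: monom_eval_superset[of ?A m] monom_eval_superset[of ?A m']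
        lookup_add power_add prod.distrib)
qed

lemma monom_eval_0 [simp]: "monom_eval f 0 = 1"
  by (simp add: monom_eval_def)

lemma monom_eval_single [simp]: "monom_eval f (Poly_Mapping.single v e) = f v ^ e"
  by (simp add: monom_eval_def)

lemma monom_eval_Var: "monom_eval Var m = Poly_Mapping.single m 1"
proof (induction m rule: poly_mapping_add_induct)
  case (single v e)
  have "Var v ^ e = Poly_Mapping.single (Poly_Mapping.single v e) 1" for e
  proof (induction e)
    case (Suc e)
    then show ?case
      by (simp add: Var_def mult_single flip: single_add)
  qed (simp add: Var_def)
  then show ?case
    by simp
qed (simp add: monom_eval_add mult_single)

lemma poly_subst_alt:
  "poly_subst f p = (\<Sum>m\<in>Poly_Mapping.keys p. Const (Poly_Mapping.lookup p m) * monom_eval f m)"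
  unfolding poly_subst_def monom_eval_def ..

lemma poly_subst_single: "poly_subst f (Poly_Mapping.single m c) = Const c * monom_eval f m"
  by (simp add: poly_subst_alt)

lemma poly_subst_add [simp]: "poly_subst f (p + q) = poly_subst f p + poly_subst f q"
  unfolding poly_subst_alt
  by (rule setsum_keys_plus_distrib[where f="\<lambda>m c. Const c * monom_eval f m"])
    (simp_all add: single_add ring_distribs)

lemma poly_subst_mult [simp]: "poly_subst f (p * q) = poly_subst f p * poly_subst f q"
proof (induction p rule: poly_mapping_add_induct)
  case (single m c)
  show ?case
  proof (induction q rule: poly_mapping_add_induct)
    case (single m' c')
    have "Const (c * c') = Const c * Const c'"
      by (simp add: mult_single)
    then show ?case
      by (simp add: mult_single poly_subst_single monom_eval_add mult_ac)
  qed (simp add: ring_distribs)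
qed (simp add: ring_distribs)

lemma poly_subst_Const [simp]: "poly_subst f (Const c) = Const c"
  by (simp add: poly_subst_single)

lemma poly_subst_Var [simp]: "poly_subst f (Var v) = f v"
  by (simp add: Var_def poly_subst_single)

lemma poly_subst_0 [simp]: "poly_subst f 0 = 0"
  using poly_subst_Const[of f 0] by simp

lemma poly_subst_1 [simp]: "poly_subst f 1 = 1"
  using poly_subst_Const[of f 1] by simp

lemma poly_subst_uminus [simp]: "poly_subst f (- p) = - poly_subst f p"
  by (metis add.inverse_unique add.right_inverse poly_subst_0 poly_subst_add)

lemma poly_subst_diff [simp]: "poly_subst f (p - q) = poly_subst f p - poly_subst f q"
  using poly_subst_add[of f p "- q"] by simp

lemma poly_subst_sum [simp]: "poly_subst f (sum g A) = (\<Sum>x\<in>A. poly_subst f (g x))"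
  by (induction A rule: infinite_finite_induct) simp_all

lemma poly_subst_prod [simp]: "poly_subst f (prod g A) = (\<Prod>x\<in>A. poly_subst f (g x))"
  by (induction A rule: infinite_finite_induct) simp_all

lemma poly_subst_power [simp]: "poly_subst f (p ^ e) = poly_subst f p ^ e"
  by (induction e) simp_all

lemma poly_subst_of_nat [simp]: "poly_subst f (of_nat c) = of_nat c"
  by (induction c) simp_all

lemma poly_subst_of_int [simp]: "poly_subst f (of_int c) = of_int c"
  by (cases c rule: int_cases2) simp_all

lemma mpoly_induct [case_names Const Var add mult]:
  assumes Const: "\<And>c. P (Const c)"
    and Var: "\<And>v. P (Var v)"
    and add: "\<And>p q. P p \<Longrightarrow> P q \<Longrightarrow> P (p + q)"
    and mult: "\<And>p q. P p \<Longrightarrow> P q \<Longrightarrow> P (p * q)"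
  shows "P p"
proof (induction p rule: poly_mapping_add_induct)
  case (single m c)
  have "P 1"
    using Const[of 1] by simp
  then have pow: "P (Var v ^ e)" for v e
    by (induction e) (simp_all add: mult Var)
  have "P (Poly_Mapping.single m 1)"
  proof (induction m rule: poly_mapping_add_induct)
    case (single v e)
    show ?case
      using pow[of v e] by (simp flip: monom_eval_Var)
  next
    case (add m m')
    then show ?case
      using mult by (metis mult.right_neutral mult_single)
  qed
  from mult[OF Const[of c] this] show ?case
    by (simp add: mult_single)
qed (rule add)

lemma poly_subst_poly_subst:
  "poly_subst f (poly_subst g p) = poly_subst (\<lambda>v. poly_subst f (g v)) p"
  by (induction p rule: mpoly_induct) simp_all

lemma poly_subst_Var_id [simp]: "poly_subst Var p = p"
  by (induction p rule: mpoly_induct) simp_all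

section \<open>Variables occurring in a polynomial\<close>

definition vars :: "mpoly \<Rightarrow> var set" where
  "vars p = (\<Union>m\<in>Poly_Mapping.keys p. Poly_Mapping.keys m)"

lemma poly_subst_cong_vars:
  assumes "\<And>v. v \<in> vars p \<Longrightarrow> f v = g v"
  shows "poly_subst f p = poly_subst g p"
  unfolding poly_subst_alt monom_eval_def
  using assms by (intro sum.cong arg_cong2[of _ _ _ _ "(*)"] prod.cong refl) (force simp: vars_def)

lemma vars_Const [simp]: "vars (Const c) = {}"
  by (simp add: vars_def)

lemma vars_1 [simp]: "vars 1 = {}"
  by (simp add: vars_def)

lemma vars_0 [simp]: "vars 0 = {}"
  by (simp add: vars_def)

lemma vars_Var [simp]: "vars (Var v) = {v}"
  by (simp add: vars_def Var_def)

lemma vars_add: "vars (p + q) \<subseteq> vars p \<union> vars q"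
  using keys_add[of p q] unfolding vars_def by blast

lemma vars_uminus [simp]: "vars (- p) = vars p"
  by (simp add: vars_def in_keys_iff Poly_Mapping.keys.rep_eq)

lemma vars_diff: "vars (p - q) \<subseteq> vars p \<union> vars q"
  using vars_add[of p "- q"] by simp

lemma vars_mult: "vars (p * q) \<subseteq> vars p \<union> vars q"
proof
  fix v assume "v \<in> vars (p * q)"
  then obtain m where "m \<in> Poly_Mapping.keys (p * q)" "v \<in> Poly_Mapping.keys m"
    by (auto simp: vars_def)
  then obtain a b where "a \<in> Poly_Mapping.keys p" "b \<in> Poly_Mapping.keys q"
    "v \<in> Poly_Mapping.keys (a + b)"
    using keys_mult[of p q] by blast
  then show "v \<in> vars p \<union> vars q"
    using keys_add[of a b] unfolding vars_def by blast
qed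

lemma vars_sum: "(\<And>x. x \<in> A \<Longrightarrow> vars (f x) \<subseteq> V) \<Longrightarrow> vars (sum f A) \<subseteq> V"
proof (induction A rule: infinite_finite_induct)
  case (insert x A)
  then show ?case
    using vars_add[of "f x" "sum f A"] by auto
qed simp_all

lemma vars_prod: "(\<And>x. x \<in> A \<Longrightarrow> vars (f x) \<subseteq> V) \<Longrightarrow> vars (prod f A) \<subseteq> V"
proof (induction A rule: infinite_finite_induct)
  case (insert x A)
  then show ?case
    using vars_mult[of "f x" "prod f A"] by auto
qed simp_all

lemma vars_power: "vars (p ^ e) \<subseteq> vars p"
proof (induction e)
  case (Suc e)
  then show ?case
    using vars_mult[of p "p ^ e"] by auto
qed simp

lemma vars_poly_subst:
  assumes "\<And>v. v \<in> vars p \<Longrightarrow> vars (f v) \<subseteq> V"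
  shows "vars (poly_subst f p) \<subseteq> V"
  unfolding poly_subst_alt monom_eval_def
proof (rule vars_sum)
  fix m assume m: "m \<in> Poly_Mapping.keys p"
  have "vars (\<Prod>v\<in>Poly_Mapping.keys m. f v ^ Poly_Mapping.lookup m v) \<subseteq> V"
    using assms m vars_power by (intro vars_prod) (fastforce simp: vars_def)
  then show "vars (Const (Poly_Mapping.lookup p m)
      * (\<Prod>v\<in>Poly_Mapping.keys m. f v ^ Poly_Mapping.lookup m v)) \<subseteq> V"
    using vars_mult by fastforce
qed

lemma mem_mpoly_ring_iff: "p \<in> carrier (mpoly_ring V) \<longleftrightarrow> vars p \<subseteq> V"
  by (auto simp: mpoly_ring_def vars_def)

lemma Var_eq_iff [simp]: "Var u = Var v \<longleftrightarrow> u = v"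
  by (metis vars_Var singleton_inject)

lemma Var_neq_0 [simp]: "Var v \<noteq> 0"
  by (metis vars_0 vars_Var insert_not_empty)

section \<open>Divisibility by linear factors\<close>

abbreviation subst_var :: "var \<Rightarrow> mpoly \<Rightarrow> mpoly \<Rightarrow> mpoly" where
  "subst_var v u \<equiv> poly_subst (\<lambda>x. if x = v then u else Var x)"

text \<open>Remainder theorem, by induction on the way \<open>p\<close> is built. For products it is
  the identity \<open>p q - p' q' = (p - p') q + p' (q - q')\<close>, with primes for the
  substituted polynomials.\<close>

lemma Var_minus_dvd: "(Var v - u) dvd (p - subst_var v u p)"
proof (induction p rule: mpoly_induct)
  case (add p q)
  then have "(Var v - u) dvd (p - subst_var v u p) + (q - subst_var v u q)"
    by (rule dvd_add)
  then show ?case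
    by (simp add: algebra_simps)
next
  case (mult p q)
  then have "(Var v - u) dvd (p - subst_var v u p) * q + subst_var v u p * (q - subst_var v u q)"
    by (intro dvd_add dvd_mult2 dvd_mult)
  then show ?case
    by (simp add: algebra_simps)
qed simp_all

lemma subst_var_fresh: "v \<notin> vars u \<Longrightarrow> subst_var v w u = u"
  by (subst poly_subst_cong_vars[where g = Var]) auto

lemma Var_minus_dvd_iff:
  assumes "v \<notin> vars u"
  shows "(Var v - u) dvd p \<longleftrightarrow> subst_var v u p = 0"
proof
  assume "(Var v - u) dvd p"
  then show "subst_var v u p = 0"
    by (auto simp: subst_var_fresh[OF assms] elim!: dvdE)
next
  assume "subst_var v u p = 0"
  then show "(Var v - u) dvd p"
    using Var_minus_dvd[of v u p] by simp
qed

text \<open>The kernel of a substitution into a domain is prime: if \<open>p\<close> survives,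
  \<open>q\<close> must be killed.\<close>

lemma Var_minus_dvd_mult_cancel:
  assumes "(Var v - u) dvd p * q" "v \<notin> vars u" "subst_var v u p \<noteq> 0"
  shows "(Var v - u) dvd q"
  using assms by (simp add: Var_minus_dvd_iff)

text \<open>The third hypothesis makes the linear forms pairwise non-associated primes: the
  substitution belonging to one of them kills none of the others. Once the product over
  \<open>A\<close> is split off, the next form therefore divides the cofactor.\<close>

lemma prod_Var_minus_dvd:
  assumes "finite A"
    and "\<And>x. x \<in> A \<Longrightarrow> v x \<notin> vars (u x)"
    and "\<And>x y. x \<in> A \<Longrightarrow> y \<in> A \<Longrightarrow> x \<noteq> y \<Longrightarrow> subst_var (v x) (u x) (Var (v y) - u y) \<noteq> 0"
    and "\<And>x. x \<in> A \<Longrightarrow> (Var (v x) - u x) dvd p"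
  shows "(\<Prod>x\<in>A. Var (v x) - u x) dvd p"
  using assms
proof (induction A)
  case (insert x A)
  then obtain q where q: "p = (\<Prod>y\<in>A. Var (v y) - u y) * q"
    by (auto elim!: dvdE)
  have "subst_var (v x) (u x) (\<Prod>y\<in>A. Var (v y) - u y) \<noteq> 0"
    using insert.hyps insert.prems(2) by (auto simp del: poly_subst_diff simp: prod_zero_iff)
  moreover have "(Var (v x) - u x) dvd (\<Prod>y\<in>A. Var (v y) - u y) * q"
    using insert.prems(3) q by auto
  ultimately have "(Var (v x) - u x) dvd q"
    using insert.prems(1) by (auto intro: Var_minus_dvd_mult_cancel)
  then show ?case
    using insert.hyps q by (auto intro: mult_dvd_mono simp: mult.commute)
qed simp

lemma Z_minus_Z_dvd_iff:
  "i \<noteq> j \<Longrightarrow> (Var (Z i) - Var (Z j)) dvd p \<longleftrightarrow> subst_var (Z i) (Var (Z j)) p = 0"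
  by (rule Var_minus_dvd_iff) simp

section \<open>Homogeneous components\<close>

definition tdeg :: "(var \<Rightarrow>\<^sub>0 nat) \<Rightarrow> nat" where
  "tdeg m = (\<Sum>v\<in>Poly_Mapping.keys m. Poly_Mapping.lookup m v)"

lemma tdeg_add: "tdeg (m + m') = tdeg m + tdeg m'"
  unfolding tdeg_def by (rule setsum_keys_plus_distrib) simp_all

lemma homogeneous_alt: "homogeneous d p \<longleftrightarrow> (\<forall>m\<in>Poly_Mapping.keys p. tdeg m = d)"
  by (simp add: homogeneous_def tdeg_def)

lemma homogeneous_0 [simp]: "homogeneous d 0"
  by (simp add: homogeneous_def)

lemma homogeneous_single: "homogeneous (tdeg m) (Poly_Mapping.single m c)"
  by (simp add: homogeneous_alt)

lemma homogeneous_Const [simp]: "homogeneous 0 (Const c)"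
  by (simp add: homogeneous_alt tdeg_def)

lemma homogeneous_of_int [simp]: "homogeneous 0 (of_int c)"
  using homogeneous_Const[of "of_int c"] by (simp only: single_of_int)

lemma homogeneous_1 [simp]: "homogeneous 0 1"
  using homogeneous_Const[of 1] by simp

lemma homogeneous_Var: "homogeneous 1 (Var v)"
  by (simp add: Var_def homogeneous_alt tdeg_def)

lemmas homogeneous_Var_Suc_0 [simp] = homogeneous_Var[unfolded One_nat_def]

lemma homogeneous_add: "homogeneous d p \<Longrightarrow> homogeneous d q \<Longrightarrow> homogeneous d (p + q)"
  using keys_add[of p q] unfolding homogeneous_alt by blast

lemma homogeneous_uminus: "homogeneous d p \<Longrightarrow> homogeneous d (- p)"
  by (simp add: homogeneous_alt in_keys_iff)

lemma homogeneous_diff: "homogeneous d p \<Longrightarrow> homogeneous d q \<Longrightarrow> homogeneous d (p - q)"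
  using homogeneous_add[of d p "- q"] homogeneous_uminus[of d q] by simp

lemma homogeneous_sum: "(\<And>x. x \<in> A \<Longrightarrow> homogeneous d (f x)) \<Longrightarrow> homogeneous d (sum f A)"
  by (induction A rule: infinite_finite_induct) (simp_all add: homogeneous_add)

lemma homogeneous_mult:
  assumes "homogeneous d p" "homogeneous e q"
  shows "homogeneous (d + e) (p * q)"
  unfolding homogeneous_alt
proof
  fix m assume "m \<in> Poly_Mapping.keys (p * q)"
  then obtain a b where "m = a + b" "a \<in> Poly_Mapping.keys p" "b \<in> Poly_Mapping.keys q"
    using keys_mult[of p q] by blast
  then show "tdeg m = d + e"
    using assms by (simp add: homogeneous_alt tdeg_add)
qed

lemma homogeneous_prod:
  "(\<And>x. x \<in> A \<Longrightarrow> homogeneous (d x) (f x)) \<Longrightarrow> homogeneous (sum d A) (prod f A)"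
  by (induction A rule: infinite_finite_induct) (simp_all add: homogeneous_mult)

lemma homogeneous_power: "homogeneous d p \<Longrightarrow> homogeneous (d * e) (p ^ e)"
  using homogeneous_prod[of "{..<e}" "\<lambda>_. d" "\<lambda>_. p"] by (simp add: mult.commute)

definition hcomp :: "nat \<Rightarrow> mpoly \<Rightarrow> mpoly" where
  "hcomp d p = (\<Sum>m\<in>Poly_Mapping.keys p.
     if tdeg m = d then Poly_Mapping.single m (Poly_Mapping.lookup p m) else 0)"

lemma hcomp_single:
  "hcomp d (Poly_Mapping.single m c) = (if tdeg m = d then Poly_Mapping.single m c else 0)"
  by (simp add: hcomp_def)

lemma hcomp_add: "hcomp d (p + q) = hcomp d p + hcomp d q"
  unfolding hcomp_def
  by (rule setsum_keys_plus_distrib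
      [where f="\<lambda>m c. if tdeg m = d then Poly_Mapping.single m c else 0"])
    (simp_all add: single_add)

lemma lookup_hcomp:
  "Poly_Mapping.lookup (hcomp d p) m = (if tdeg m = d then Poly_Mapping.lookup p m else 0)"
  by (induction p rule: poly_mapping_add_induct)
    (auto simp: hcomp_single hcomp_add lookup_add lookup_single when_def)

lemma homogeneous_hcomp: "homogeneous d (hcomp d p)"
  by (auto simp: homogeneous_alt in_keys_iff lookup_hcomp split: if_splits)

lemma vars_hcomp: "vars (hcomp d p) \<subseteq> vars p"
  by (force simp: vars_def in_keys_iff lookup_hcomp split: if_splits)

lemma hcomp_homogeneous:
  assumes "homogeneous e p"
  shows "hcomp d p = (if d = e then p else 0)"
  using assms
  by (intro poly_mapping_eqI) (auto simp: lookup_hcomp homogeneous_alt in_keys_iff)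

lemma hcomp_mult_homogeneous:
  assumes "homogeneous e q"
  shows "hcomp (d + e) (p * q) = hcomp d p * q"
proof (induction p rule: poly_mapping_add_induct)
  case (single m c)
  have "homogeneous (tdeg m + e) (Poly_Mapping.single m c * q)"
    by (intro homogeneous_mult homogeneous_single assms)
  from hcomp_homogeneous[OF this, of "d + e"] show ?case
    by (simp add: hcomp_single)
qed (simp add: hcomp_add ring_distribs)

text \<open>Comparing components of degree \<open>d + e\<close> gives
  \<open>hcomp d p * q = p * q\<close>, and \<open>q\<close> cancels. In this way the degree of a
  quotient is read off from numerator and denominator.\<close>

lemma homogeneous_mult_cancel:
  assumes "homogeneous (d + e) (p * q)" "homogeneous e q" "q \<noteq> 0"
  shows "homogeneous d p"
proof -
  have "hcomp d p * q = p * q"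
    using hcomp_mult_homogeneous[OF assms(2), of d p] hcomp_homogeneous[OF assms(1), of "d + e"]
    by metis
  then have "hcomp d p = p"
    using assms(3) mult_right_cancel by blast
  then show ?thesis
    using homogeneous_hcomp by metis
qed

lemma homogeneous_monom_eval:
  assumes "\<And>v. homogeneous 1 (f v)"
  shows "homogeneous (tdeg m) (monom_eval f m)"
  unfolding monom_eval_def tdeg_def
  using homogeneous_power[OF assms] by (intro homogeneous_prod) simp

lemma poly_subst_hcomp:
  assumes "\<And>v. homogeneous 1 (f v)"
  shows "poly_subst f (hcomp d p) = hcomp d (poly_subst f p)"
proof (induction p rule: poly_mapping_add_induct)
  case (single m c)
  have "homogeneous (0 + tdeg m) (Const c * monom_eval f m)"
    by (intro homogeneous_mult homogeneous_monom_eval assms homogeneous_Const)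
  from hcomp_homogeneous[OF this, of d] show ?case
    by (auto simp: hcomp_single poly_subst_single)
qed (simp add: hcomp_add)

section \<open>Interpolation at the permutations\<close>

text \<open>Restricting the substitution to indices in \<open>S\<close> allows the roots to be
  specialized one at a time.\<close>

definition T_subst :: "nat set \<Rightarrow> (nat \<Rightarrow> nat) \<Rightarrow> mpoly \<Rightarrow> mpoly" where
  "T_subst S w = poly_subst (\<lambda>v. case v of T a \<Rightarrow> if a \<in> S then Var (Z (w a)) else Var (T a) | _ \<Rightarrow> Var v)"

text \<open>The equation \<open>kill_T p = p\<close> expresses that no Chern root occurs in
  \<open>p\<close>. Since \<open>kill_T\<close> is a ring homomorphism, the property passes to
  quotients by cancellation.\<close>

definition kill_T :: "mpoly \<Rightarrow> mpoly" where
  "kill_T = poly_subst (\<lambda>v. case v of T a \<Rightarrow> 0 | _ \<Rightarrow> Var v)"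

lemma T_subst_simps [simp]:
  "T_subst S w (p + q) = T_subst S w p + T_subst S w q"
  "T_subst S w (p * q) = T_subst S w p * T_subst S w q"
  "T_subst S w (p - q) = T_subst S w p - T_subst S w q"
  "T_subst S w 0 = 0"
  "T_subst S w (Var (Z i)) = Var (Z i)"
  "T_subst S w (Var Hbar) = Var Hbar"
  "T_subst S w (Var (T a)) = (if a \<in> S then Var (Z (w a)) else Var (T a))"
  "T_subst S w (sum f A) = (\<Sum>x\<in>A. T_subst S w (f x))"
  "T_subst S w (prod f A) = (\<Prod>x\<in>A. T_subst S w (f x))"
  by (simp_all add: T_subst_def)

lemma T_subst_empty [simp]: "T_subst {} w p = p"
proof -
  have "(\<lambda>v. case v of T a \<Rightarrow> if a \<in> {} then Var (Z (w a)) else Var (T a) | _ \<Rightarrow> Var v) = Var"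
    by (auto split: var.split)
  then show ?thesis
    by (simp add: T_subst_def)
qed

lemma T_subst_cong: "(\<And>a. a \<in> S \<Longrightarrow> w a = w' a) \<Longrightarrow> T_subst S w p = T_subst S w' p"
  unfolding T_subst_def by (rule poly_subst_cong_vars) (auto split: var.split)

lemma T_subst_insert:
  assumes "s \<notin> S"
  shows "T_subst (insert s S) w p = T_subst {s} w (T_subst S w p)"
  unfolding T_subst_def poly_subst_poly_subst
  using assms by (intro poly_subst_cong_vars) (auto split: var.split)

lemma T_subst_insert':
  assumes "s \<notin> S"
  shows "T_subst (insert s S) w p = T_subst S w (T_subst {s} w p)"
  unfolding T_subst_def poly_subst_poly_subst
  using assms by (intro poly_subst_cong_vars) (auto split: var.split)

lemma T_subst_kill_T: "T_subst S w (kill_T p) = kill_T p"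
  unfolding T_subst_def kill_T_def poly_subst_poly_subst
  by (intro poly_subst_cong_vars) (auto split: var.split)

lemma T_subst_no_T: "kill_T p = p \<Longrightarrow> T_subst S w p = p"
  by (metis T_subst_kill_T)

text \<open>Replacing \<open>Z i\<close> by \<open>Z j\<close> makes \<open>w\<close> and
  \<open>transpose i j \<circ> w\<close> indistinguishable. These are the necessary congruences;
  \<open>flag_interpolation\<close> shows that they suffice.\<close>

lemma T_subst_transpose_dvd:
  assumes "i \<noteq> j"
  shows "(Var (Z i) - Var (Z j)) dvd T_subst S w p - T_subst S (transpose i j \<circ> w) p"
  unfolding Z_minus_Z_dvd_iff[OF assms] T_subst_def poly_subst_diff poly_subst_poly_subst
    right_minus_eq
  by (rule poly_subst_cong_vars) (auto split: var.split simp: transpose_def)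

text \<open>
  Newton interpolation in \<open>T s\<close> with the nodes \<open>Z b\<close>: the term of index \<open>c\<close> corrects the values
  at the \<open>w\<close> with \<open>w s = c\<close> and vanishes at those treated before.
\<close>

theorem flag_interpolation:
  assumes "finite S" "finite B" "card S = card B"
    and "\<And>w w'. (\<And>s. s \<in> S \<Longrightarrow> w s = w' s) \<Longrightarrow> f w = f w'"
    and "\<And>w. bij_betw w S B \<Longrightarrow> kill_T (f w) = f w"
    and "\<And>w i j. bij_betw w S B \<Longrightarrow> i \<in> B \<Longrightarrow> j \<in> B \<Longrightarrow> i \<noteq> j \<Longrightarrow>
      (Var (Z i) - Var (Z j)) dvd f w - f (transpose i j \<circ> w)"
  shows "\<exists>p. \<forall>w. kill_T (T_subst S w p) = T_subst S w p \<and> (bij_betw w S B \<longrightarrow> T_subst S w p = f w)"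
  using assms
proof (induction S arbitrary: B f rule: finite_induct)
  case empty
  then have B: "B = {}"
    by simp
  have f: "f w = f id" for w
    by (rule empty.prems(3)) simp
  have "kill_T (f id) = f id"
    using empty.prems(4)[of id] B by (simp add: bij_betw_def id_def)
  then show ?case
    using f by (metis T_subst_empty)
next
  case (insert s S)
  note cong = insert.prems(3) and noT = insert.prems(4) and gkm = insert.prems(5)
    and IH = insert.IH
  have "\<exists>p. \<forall>w. kill_T (T_subst (insert s S) w p) = T_subst (insert s S) w p \<and>
      (bij_betw w (insert s S) B \<longrightarrow> w s \<in> C \<longrightarrow> T_subst (insert s S) w p = f w)"
    if "C \<subseteq> B" for C
    using finite_subset[OF that \<open>finite B\<close>] that
  proof (induction C)
    case (insert c C)
    then obtain p where p: "\<And>w. bij_betw w (insert s S) B \<Longrightarrow> w s \<in> C \<Longrightarrow>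
        T_subst (insert s S) w p = f w"
      and p_noT: "\<And>w. kill_T (T_subst (insert s S) w p) = T_subst (insert s S) w p"
      by auto
    have c: "c \<in> B" "c \<notin> C" "C \<subseteq> B" "finite C"
      using insert by auto
    define f' where "f' w = f w - T_subst (insert s S) w p" for w
    define P where "P = (\<Prod>b\<in>C. Var (Z c) - Var (Z b))"
    \<comment> \<open>The quotient of the defect by \<open>P\<close>, unique where it exists because
      \<open>P\<close> is nonzero. Overwriting \<open>w s\<close> makes it depend on
      \<open>w\<close> only through \<open>S\<close>, as the outer induction hypothesis
      asks.\<close>
    define g where "g w = (SOME q. f' (w(s := c)) = P * q)" for w
    have P0: "P \<noteq> 0"
      using c by (auto simp: P_def)
    have f'_gkm: "(Var (Z i) - Var (Z j)) dvd f' w - f' (transpose i j \<circ> w)"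
      if "bij_betw w (insert s S) B" "i \<in> B" "j \<in> B" "i \<noteq> j" for w i j
    proof -
      have "f' w - f' (transpose i j \<circ> w) = (f w - f (transpose i j \<circ> w))
          - (T_subst (insert s S) w p - T_subst (insert s S) (transpose i j \<circ> w) p)"
        by (simp add: f'_def)
      then show ?thesis
        using gkm[OF that] T_subst_transpose_dvd[OF that(4)] by (metis dvd_diff)
    qed
    have bij_upd: "bij_betw (w(s := c)) (insert s S) B" if "bij_betw w S (B - {c})" for w
    proof -
      have "bij_betw (w(s := c)) S (B - {c})"
        using that insert.hyps \<open>s \<notin> S\<close> by (subst bij_betw_cong[where g = w]) auto
      from notIn_Un_bij_betw[OF \<open>s \<notin> S\<close> _ this] c show ?thesis
        by (simp add: insert_absorb)
    qed
    \<comment> \<open>For \<open>b \<in> C\<close>, exchanging \<open>c\<close> and \<open>b\<close>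
      leads to a bijection sending \<open>s\<close> to \<open>b\<close>, where the defect
      \<open>f'\<close> vanishes already. The congruence for \<open>f'\<close> then says that
      \<open>Z c - Z b\<close> divides \<open>f' w\<close>.\<close>
    have f'_dvd: "P dvd f' w" if w: "bij_betw w (insert s S) B" "w s = c" for w
      unfolding P_def
    proof (rule prod_Var_minus_dvd)
      fix b assume b: "b \<in> C"
      have "bij_betw (transpose c b \<circ> w) (insert s S) B"
        using w(1) c b by (intro bij_betw_trans[OF w(1)] bij_betw_transpose_iff) auto
      with p[of "transpose c b \<circ> w"] w(2) b have "f' (transpose c b \<circ> w) = 0"
        by (simp add: f'_def)
      then show "(Var (Z c) - Var (Z b)) dvd f' w"
        using f'_gkm[OF w(1), of c b] b c by auto
    qed (use c in auto)
    have g: "f' (w(s := c)) = P * g w" if "bij_betw w S (B - {c})" for w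
      unfolding g_def
      by (rule someI_ex) (use f'_dvd[OF bij_upd[OF that]] in \<open>auto elim: dvdE\<close>)
    have "\<exists>p'. \<forall>w. kill_T (T_subst S w p') = T_subst S w p' \<and>
        (bij_betw w S (B - {c}) \<longrightarrow> T_subst S w p' = g w)"
    proof (rule IH)
      show "finite (B - {c})" "card S = card (B - {c})"
        using insert.prems insert.hyps c \<open>finite B\<close> \<open>card (insert s S) = card B\<close> \<open>finite S\<close> \<open>s \<notin> S\<close> by auto
    next
      fix w w' :: "nat \<Rightarrow> nat"
      assume "\<And>a. a \<in> S \<Longrightarrow> w a = w' a"
      then have "f' (w(s := c)) = f' (w'(s := c))"
        unfolding f'_def by (intro arg_cong2[of _ _ _ _ "(-)"] cong T_subst_cong) auto
      then show "g w = g w'"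
        by (simp add: g_def)
    next
      fix w assume w: "bij_betw w S (B - {c})"
      have "kill_T P = P"
        by (simp add: P_def kill_T_def)
      moreover have "kill_T (f' (w(s := c))) = f' (w(s := c))"
        using noT[OF bij_upd[OF w]] p_noT[of "w(s := c)"]
        unfolding f'_def kill_T_def poly_subst_diff by (simp only:)
      ultimately have "P * kill_T (g w) = P * g w"
        unfolding g[OF w] by (simp add: kill_T_def)
      then show "kill_T (g w) = g w"
        using P0 mult_left_cancel by blast
    next
      fix w i j assume w: "bij_betw w S (B - {c})" and ij: "i \<in> B - {c}" "j \<in> B - {c}" "i \<noteq> j"
      let ?w = "transpose i j \<circ> w"
      have w': "bij_betw ?w S (B - {c})"
        using ij by (intro bij_betw_trans[OF w] bij_betw_transpose_iff) auto
      have "(transpose i j \<circ> w(s := c)) = ?w(s := c)"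
        using ij by (auto simp: fun_eq_iff transpose_def)
      then have "(Var (Z i) - Var (Z j)) dvd P * g w - P * g ?w"
        using f'_gkm[OF bij_upd[OF w], of i j] ij by (simp add: g[OF w] g[OF w'])
      then have "(Var (Z i) - Var (Z j)) dvd P * (g w - g ?w)"
        by (simp add: algebra_simps)
      \<comment> \<open>Both \<open>i\<close> and \<open>j\<close> differ from \<open>c\<close>, so
        no factor \<open>Z c - Z b\<close> of \<open>P\<close> collapses for
        \<open>Z i = Z j\<close>.\<close>
      moreover have "subst_var (Z i) (Var (Z j)) P \<noteq> 0"
        using c ij by (auto simp: P_def)
      ultimately show "(Var (Z i) - Var (Z j)) dvd g w - g ?w"
        using ij Var_minus_dvd_mult_cancel[of "Z i" "Var (Z j)" P "g w - g ?w"] by simp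
    qed
    then obtain p' where "\<forall>w. kill_T (T_subst S w p') = T_subst S w p' \<and>
        (bij_betw w S (B - {c}) \<longrightarrow> T_subst S w p' = g w)" ..
    then have p': "\<And>w. bij_betw w S (B - {c}) \<Longrightarrow> T_subst S w p' = g w"
      and p'_noT: "\<And>w. kill_T (T_subst S w p') = T_subst S w p'"
      by simp_all
    \<comment> \<open>This is used at every \<open>w\<close>, also where \<open>w\<close> is no
      bijection from \<open>S\<close> to \<open>B - {c}\<close>; hence the invariance under
      \<open>kill_T\<close> is carried through the induction for all \<open>w\<close>.\<close>
    have p'_insert: "T_subst (insert s S) w p' = T_subst S w p'" for w
      by (simp add: T_subst_insert[OF \<open>s \<notin> S\<close>] T_subst_no_T[OF p'_noT])
    define p'' where "p'' = p + (\<Prod>b\<in>C. Var (T s) - Var (Z b)) * p'"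
    have p'': "T_subst (insert s S) w p'' =
        T_subst (insert s S) w p + (\<Prod>b\<in>C. Var (Z (w s)) - Var (Z b)) * T_subst S w p'" for w
      by (simp add: p''_def p'_insert)
    show ?case
    proof (intro exI[of _ p''] allI conjI impI)
      fix w
      show "kill_T (T_subst (insert s S) w p'') = T_subst (insert s S) w p''"
        using p_noT[of w] p'_noT[of w] by (simp add: p'' kill_T_def)
    next
      fix w assume w: "bij_betw w (insert s S) B" "w s \<in> insert c C"
      show "T_subst (insert s S) w p'' = f w"
      proof (cases "w s = c")
        case True
        then have bij: "bij_betw w S (B - {c})"
          using notIn_Un_bij_betw3[of s S w "B - {c}"] w(1) c \<open>s \<notin> S\<close>
          by (simp add: insert_absorb)
        have "w(s := c) = w"
          using True by auto
        with g[OF bij] have "f w = P * g w + T_subst (insert s S) w p"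
          unfolding f'_def by (simp only: diff_eq_eq)
        then show ?thesis
          unfolding p'' p'[OF bij] True P_def by (simp only: add.commute)
      next
        case False
        then have "w s \<in> C"
          using w(2) by simp
        moreover from this have "(\<Prod>b\<in>C. Var (Z (w s)) - Var (Z b)) = 0"
          using c by (auto simp: prod_zero_iff)
        ultimately show ?thesis
          using p[OF w(1)] by (simp add: p'')
      qed
    qed
  qed (intro exI[of _ 0], simp add: kill_T_def)
  from this[OF subset_refl] obtain p where p:
    "\<forall>w. kill_T (T_subst (insert s S) w p) = T_subst (insert s S) w p \<and>
      (bij_betw w (insert s S) B \<longrightarrow> w s \<in> B \<longrightarrow> T_subst (insert s S) w p = f w)" ..
  show ?case
  proof (intro exI[of _ p] allI conjI impI)
    fix w assume w: "bij_betw w (insert s S) B"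
    then have "w s \<in> B"
      by (auto dest: bij_betwE)
    then show "T_subst (insert s S) w p = f w"
      using p w by simp
  qed (use p in simp)
qed

section \<open>The ideal of the union of the graphs of the permutations\<close>

text \<open>The ideal in the whole polynomial ring, with coefficients of no particular symmetry. The
  ideal of the invariant ring is reached from it by averaging.\<close>

inductive_set ideal_span :: "'a::comm_ring_1 set \<Rightarrow> 'a set" for G where
  zero: "0 \<in> ideal_span G"
| gen: "g \<in> G \<Longrightarrow> g \<in> ideal_span G"
| add: "p \<in> ideal_span G \<Longrightarrow> q \<in> ideal_span G \<Longrightarrow> p + q \<in> ideal_span G"
| mult: "p \<in> ideal_span G \<Longrightarrow> q * p \<in> ideal_span G"

lemma ideal_span_sum: "(\<And>x. x \<in> A \<Longrightarrow> f x \<in> ideal_span G) \<Longrightarrow> sum f A \<in> ideal_span G"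
  by (induction A rule: infinite_finite_induct) (auto intro: ideal_span.intros)

section \<open>Elementary symmetric polynomials over an arbitrary index set\<close>

definition esum :: "nat set \<Rightarrow> nat \<Rightarrow> (nat \<Rightarrow> 'a) \<Rightarrow> 'a::comm_ring_1" where
  "esum S m x = (\<Sum>A | A \<subseteq> S \<and> card A = m. \<Prod>a\<in>A. x a)"

lemma esum_0: "finite S \<Longrightarrow> esum S 0 x = 1"
proof -
  assume "finite S"
  then have "{A. A \<subseteq> S \<and> card A = 0} = {{}}"
    by (auto dest: finite_subset)
  then show ?thesis
    by (simp add: esum_def)
qed

lemma esum_eq_0:
  assumes "finite S" "card S < m"
  shows "esum S m x = 0"
proof -
  have "{A. A \<subseteq> S \<and> card A = m} = {}"
    using assms(2) card_mono[OF assms(1)] by (auto simp: not_le[symmetric])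
  then show ?thesis
    unfolding esum_def by (simp only: sum.empty)
qed

lemma esum_insert:
  assumes "finite S" "s \<notin> S"
  shows "esum (insert s S) (Suc m) x = esum S (Suc m) x + x s * esum S m x"
proof -
  let ?K = "\<lambda>S m. {A. A \<subseteq> S \<and> card A = m}"
  have K_dest: "finite A \<and> s \<notin> A" if "A \<subseteq> S" for A
    using that assms(2) finite_subset[OF that assms(1)] by blast
  have K: "?K (insert s S) (Suc m) = ?K S (Suc m) \<union> insert s ` ?K S m"
  proof (intro equalityI subsetI)
    fix A assume A: "A \<in> ?K (insert s S) (Suc m)"
    show "A \<in> ?K S (Suc m) \<union> insert s ` ?K S m"
    proof (cases "s \<in> A")
      case True
      then have "A = insert s (A - {s})" "A - {s} \<in> ?K S m"
        using A by (auto simp: card_Diff_singleton)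
      then show ?thesis
        by blast
    qed (use A in auto)
  next
    fix A assume "A \<in> ?K S (Suc m) \<union> insert s ` ?K S m"
    then show "A \<in> ?K (insert s S) (Suc m)"
      by (auto simp: K_dest)
  qed
  have fin: "finite (?K S m)" for m
    using assms(1) by (rule_tac finite_subset[of _ "Pow S"]) auto
  have inj: "inj_on (insert s) (?K S m)"
  proof (rule inj_onI)
    fix A A' assume "A \<in> ?K S m" "A' \<in> ?K S m" "insert s A = insert s A'"
    then show "A = A'"
      using insert_ident[of s A A'] K_dest[of A] K_dest[of A'] by simp
  qed
  have "(\<Sum>A\<in>insert s ` ?K S m. \<Prod>a\<in>A. x a) = (\<Sum>A\<in>?K S m. x s * (\<Prod>a\<in>A. x a))"
    unfolding sum.reindex[OF inj] o_def
    by (intro sum.cong refl prod.insert) (simp_all add: K_dest)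
  moreover have "?K S (Suc m) \<inter> insert s ` ?K S m = {}"
    using assms(2) by auto
  ultimately show ?thesis
    unfolding esum_def K by (simp add: sum.union_disjoint fin sum_distrib_left)
qed

lemma esum_bij:
  assumes "bij_betw w S B"
  shows "esum S m (\<lambda>a. x (w a)) = esum B m x"
proof -
  have inj: "inj_on w S" and im: "w ` S = B"
    using assms by (auto simp: bij_betw_def)
  have card: "card (w ` A) = card A" if "A \<subseteq> S" for A
    using card_image[OF inj_on_subset[OF inj that]] .
  have K: "{A. A \<subseteq> B \<and> card A = m} = image w ` {A. A \<subseteq> S \<and> card A = m}"
  proof (intro equalityI subsetI)
    fix A assume A: "A \<in> {A. A \<subseteq> B \<and> card A = m}"
    then obtain A' where "A' \<subseteq> S" "A = w ` A'"
      unfolding im[symmetric] by (auto simp: subset_image_iff)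
    with A card show "A \<in> image w ` {A. A \<subseteq> S \<and> card A = m}"
      by auto
  next
    fix A assume "A \<in> image w ` {A. A \<subseteq> S \<and> card A = m}"
    with card im show "A \<in> {A. A \<subseteq> B \<and> card A = m}"
      by auto
  qed
  have inj': "inj_on (image w) {A. A \<subseteq> S \<and> card A = m}"
    by (rule inj_on_subset[OF inj_on_image_Pow[OF inj]]) auto
  have "(\<Prod>a\<in>w ` A. x a) = (\<Prod>a\<in>A. x (w a))" if "A \<subseteq> S" for A
    using prod.reindex[OF inj_on_subset[OF inj that], of x] by simp
  then show ?thesis
    unfolding esum_def K sum.reindex[OF inj'] o_def by (intro sum.cong refl) simp
qed

text \<open>Vieta's formula: the product is expanded and the subsets of \<open>B\<close> are
  collected by cardinality.\<close>

lemma prod_diff_esum: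
  assumes "finite B"
  shows "(\<Prod>b\<in>B. y - x b) = (\<Sum>m\<le>card B. (- 1) ^ m * y ^ (card B - m) * esum B m x)"
proof -
  have "(\<Prod>b\<in>B. y - x b) = (\<Sum>X\<in>Pow B. (\<Prod>b\<in>X. - x b) * (\<Prod>b\<in>B - X. y))"
    using prod_add[OF assms, of "\<lambda>b. - x b" "\<lambda>_. y"] by simp
  also have "\<dots> = (\<Sum>X\<in>Pow B. (- 1) ^ card X * y ^ (card B - card X) * (\<Prod>b\<in>X. x b))"
    using assms by (intro sum.cong refl)
      (simp add: card_Diff_subset finite_subset prod_uminus mult_ac)
  also have "\<dots> = (\<Sum>m\<le>card B. \<Sum>X | X \<in> Pow B \<and> card X = m.
      (- 1) ^ card X * y ^ (card B - card X) * (\<Prod>b\<in>X. x b))"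
    using assms by (intro sum.group[symmetric]) (auto intro: card_mono)
  also have "\<dots> = (\<Sum>m\<le>card B. (- 1) ^ m * y ^ (card B - m) * esum B m x)"
    unfolding esum_def sum_distrib_left by (intro sum.cong) auto
  finally show ?thesis .
qed

definition chern_relations :: "nat set \<Rightarrow> nat set \<Rightarrow> mpoly set" where
  "chern_relations S B = {esum S m (\<lambda>a. Var (T a)) - esum B m (\<lambda>b. Var (Z b)) |m. True}"

lemma T_subst_relation:
  assumes "bij_betw w S B" "p \<in> ideal_span (chern_relations S B)"
  shows "T_subst S w p = 0"
  using assms(2)
proof induction
  case (gen g)
  have "T_subst S w (esum S m (\<lambda>a. Var (T a))) = esum S m (\<lambda>a. Var (Z (w a)))" for m
    unfolding esum_def by (simp, intro sum.cong refl prod.cong) auto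
  then have "T_subst S w (esum S m (\<lambda>a. Var (T a))) = esum B m (\<lambda>b. Var (Z b))" for m
    using esum_bij[OF assms(1), of m "\<lambda>b. Var (Z b)"] by simp
  moreover have "T_subst S w (esum B m (\<lambda>b. Var (Z b))) = esum B m (\<lambda>b. Var (Z b))" for m
    by (simp add: esum_def)
  ultimately show ?case
    using gen by (auto simp: chern_relations_def)
qed simp_all

text \<open>A Chern root is a root of the Chern polynomial. By Vieta this product differs from the
  product of all \<open>T s - T a\<close> with \<open>a \<in> S\<close> by a combination of
  relations, and the latter has the zero factor \<open>a = s\<close>.\<close>

lemma prod_in_ideal_span:
  assumes "finite S" "finite B" "card S = card B" "s \<in> S"
  shows "(\<Prod>b\<in>B. Var (T s) - Var (Z b)) \<in> ideal_span (chern_relations S B)"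
proof -
  let ?r = "\<lambda>m. esum S m (\<lambda>a. Var (T a)) - esum B m (\<lambda>b. Var (Z b))"
  have "(\<Prod>b\<in>B. Var (T s) - Var (Z b)) =
      (\<Prod>b\<in>B. Var (T s) - Var (Z b)) - (\<Prod>a\<in>S. Var (T s) - Var (T a))"
    using assms by (auto simp: prod_zero_iff)
  also have "\<dots> = (\<Sum>m\<le>card B. - ((- 1) ^ m * Var (T s) ^ (card B - m)) * ?r m)"
    unfolding prod_diff_esum[OF assms(1)] prod_diff_esum[OF assms(2)] assms(3)
      sum_subtractf[symmetric]
    by (intro sum.cong refl) (simp add: algebra_simps)
  also have "\<dots> \<in> ideal_span (chern_relations S B)"
    by (intro ideal_span_sum ideal_span.mult ideal_span.gen) (auto simp: chern_relations_def)
  finally show ?thesis .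
qed

text \<open>Modulo \<open>T s - Z b\<close> the extra root equals the extra parameter, and dividing
  both Chern polynomials by this common linear factor leaves the smaller relations. On coefficients
  this is the recursion \<open>esum_insert\<close>, solved for the smaller sets by induction on
  \<open>m\<close>.\<close>

lemma ideal_span_remove:
  assumes "finite S" "s \<notin> S" "finite B" "b \<in> B"
    and "p \<in> ideal_span (chern_relations S (B - {b}))"
  obtains i q where "i \<in> ideal_span (chern_relations (insert s S) B)"
    "p = i + (Var (T s) - Var (Z b)) * q"
proof -
  \<comment> \<open>The ideal generated by the larger relations together with
    \<open>T s - Z b\<close>; the smaller relations have to be found in it.\<close>
  define K where "K = {i + (Var (T s) - Var (Z b)) * q |i q.
      i \<in> ideal_span (chern_relations (insert s S) B)}"
  have K_I: "i + (Var (T s) - Var (Z b)) * q \<in> K"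
    if "i \<in> ideal_span (chern_relations (insert s S) B)" for i q
    using that unfolding K_def by blast
  have K_add: "x + y \<in> K" if xy: "x \<in> K" "y \<in> K" for x y
  proof -
    from xy(1) obtain i q where i: "i \<in> ideal_span (chern_relations (insert s S) B)"
      and x: "x = i + (Var (T s) - Var (Z b)) * q"
      unfolding K_def by blast
    from xy(2) obtain i' q' where i': "i' \<in> ideal_span (chern_relations (insert s S) B)"
      and y: "y = i' + (Var (T s) - Var (Z b)) * q'"
      unfolding K_def by blast
    have "x + y = (i + i') + (Var (T s) - Var (Z b)) * (q + q')"
      unfolding x y by (simp add: algebra_simps)
    then show ?thesis
      using K_I[OF ideal_span.add[OF i i']] by (simp only:)
  qed
  have K_mult: "y * x \<in> K" if "x \<in> K" for x y
  proof -
    from that obtain i q where i: "i \<in> ideal_span (chern_relations (insert s S) B)"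
      and x: "x = i + (Var (T s) - Var (Z b)) * q"
      unfolding K_def by blast
    have "y * x = y * i + (Var (T s) - Var (Z b)) * (y * q)"
      unfolding x by (simp add: algebra_simps)
    then show ?thesis
      using K_I[OF ideal_span.mult[OF i]] by (simp only:)
  qed
  have K_span: "x \<in> K" if "x \<in> ideal_span (chern_relations (insert s S) B)" for x
    using that unfolding K_def by (intro CollectI exI[of _ x] exI[of _ 0]) simp
  have K_lin: "(Var (T s) - Var (Z b)) * q \<in> K" for q
    unfolding K_def by (intro CollectI exI[of _ 0] exI[of _ q]) (simp add: ideal_span.zero)
  let ?x = "\<lambda>a. Var (T a)" and ?z = "\<lambda>b. Var (Z b)"
  have rel: "esum S m ?x - esum (B - {b}) m ?z \<in> K" for m
  proof (induction m)
    case 0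
    show ?case
      using assms K_span[OF ideal_span.zero] by (simp add: esum_0)
  next
    case (Suc m)
    have B: "esum B (Suc m) ?z = esum (B - {b}) (Suc m) ?z + ?z b * esum (B - {b}) m ?z"
      using esum_insert[of "B - {b}" b m ?z] assms by (simp add: insert_absorb)
    have "esum S (Suc m) ?x - esum (B - {b}) (Suc m) ?z =
        (esum (insert s S) (Suc m) ?x - esum B (Suc m) ?z)
        + (- ?z b) * (esum S m ?x - esum (B - {b}) m ?z)
        + (Var (T s) - Var (Z b)) * (- esum S m ?x)"
      unfolding B esum_insert[OF assms(1,2)] by (simp add: algebra_simps)
    also have "\<dots> \<in> K"
      by (intro K_add K_mult K_lin Suc K_span ideal_span.gen) (auto simp: chern_relations_def)
    finally show ?case .
  qed
  from assms(5) have "p \<in> K"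
    by induction (auto intro: K_add K_mult K_span ideal_span.zero rel simp: chern_relations_def)
  then show ?thesis
    using that by (auto simp: K_def)
qed

text \<open>Modulo the relations, \<open>p\<close> is pushed into the multiples of the product of
  \<open>T s - Z b\<close> over \<open>b \<in> C\<close> for growing \<open>C\<close>. At
  \<open>C = B\<close> this product is in the ideal itself, by
  \<open>prod_in_ideal_span\<close>.\<close>

theorem vanishing_ideal_of_flags:
  assumes "finite S" "finite B" "card S = card B"
    and "\<And>w. bij_betw w S B \<Longrightarrow> T_subst S w p = 0"
  shows "p \<in> ideal_span (chern_relations S B)"
  using assms
proof (induction S arbitrary: B p rule: finite_induct)
  case empty
  then show ?case
    by (auto simp: bij_betw_def intro: ideal_span.zero)
next
  case (insert s S)
  let ?I = "ideal_span (chern_relations (insert s S) B)"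
  have "\<exists>i q. i \<in> ?I \<and> p = i + (\<Prod>b\<in>C. Var (T s) - Var (Z b)) * q" if "C \<subseteq> B" for C
    using finite_subset[OF that \<open>finite B\<close>] that
  proof (induction C)
    case empty
    show ?case
      by (intro exI[of _ 0] exI[of _ p]) (simp add: ideal_span.zero)
  next
    case (insert c C)
    then obtain i q where i: "i \<in> ?I" and p: "p = i + (\<Prod>b\<in>C. Var (T s) - Var (Z b)) * q"
      by auto
    \<comment> \<open>The cofactor at \<open>T s = Z c\<close>. At a bijection with
      \<open>w s = c\<close> the product over \<open>C\<close> is nonzero because
      \<open>c \<notin> C\<close>, so \<open>q0\<close> vanishes at all bijections from
      \<open>S\<close> to \<open>B - {c}\<close> and the outer induction hypothesis applies.\<close>
    define q0 where "q0 = T_subst {s} (\<lambda>_. c) q"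
    have "q0 \<in> ideal_span (chern_relations S (B - {c}))"
    proof (rule \<open>\<And>B p. finite B \<Longrightarrow> card S = card B \<Longrightarrow> (\<And>w. bij_betw w S B \<Longrightarrow> T_subst S w p = 0) \<Longrightarrow> p \<in> ideal_span (chern_relations S B)\<close>)
      show "finite (B - {c})" "card S = card (B - {c})"
        using insert.prems insert.hyps \<open>finite B\<close> \<open>card (insert s S) = card B\<close>
          \<open>finite S\<close> \<open>s \<notin> S\<close> by auto
    next
      fix w assume w: "bij_betw w S (B - {c})"
      let ?w = "w(s := c)"
      have "bij_betw ?w S (B - {c})"
        using w \<open>s \<notin> S\<close> by (subst bij_betw_cong[where g = w]) auto
      from notIn_Un_bij_betw[OF \<open>s \<notin> S\<close> _ this] insert.prems
      have w': "bij_betw ?w (insert s S) B"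
        by (simp add: insert_absorb)
      have "T_subst (insert s S) ?w p = 0"
        by (rule \<open>\<And>w. bij_betw w (insert s S) B \<Longrightarrow> T_subst (insert s S) w p = 0\<close>[OF w'])
      then have "(\<Prod>b\<in>C. Var (Z c) - Var (Z b)) * T_subst (insert s S) ?w q = 0"
        unfolding p by (simp add: T_subst_relation[OF w' i])
      then have "T_subst (insert s S) ?w q = 0"
        using insert.hyps by auto
      moreover have "T_subst (insert s S) ?w q = T_subst S ?w (T_subst {s} ?w q)"
        by (rule T_subst_insert'[OF \<open>s \<notin> S\<close>])
      moreover have "T_subst {s} ?w q = q0"
        unfolding q0_def by (rule T_subst_cong) simp
      moreover have "T_subst S ?w q0 = T_subst S w q0"
        using \<open>s \<notin> S\<close> by (intro T_subst_cong) auto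
      ultimately show "T_subst S w q0 = 0"
        by simp
    qed
    \<comment> \<open>Up to a multiple of \<open>T s - Z c\<close> the polynomial \<open>q0\<close>
      lies in the larger ideal; by the remainder theorem so does \<open>q\<close>, which yields the
      next linear factor.\<close>
    then obtain i' q' where i': "i' \<in> ?I" and q0: "q0 = i' + (Var (T s) - Var (Z c)) * q'"
      using insert.prems by (auto elim!: ideal_span_remove[OF \<open>finite S\<close> \<open>s \<notin> S\<close> \<open>finite B\<close>, of c])
    have "T_subst {s} (\<lambda>_. c) q = subst_var (T s) (Var (Z c)) q"
      unfolding T_subst_def by (rule poly_subst_cong_vars) (auto split: var.split)
    then obtain q'' where "q - q0 = (Var (T s) - Var (Z c)) * q''"
      using Var_minus_dvd[of "T s" "Var (Z c)" q] unfolding q0_def by (auto elim!: dvdE)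
    then have q: "q = i' + (Var (T s) - Var (Z c)) * (q' + q'')"
      by (simp add: q0 algebra_simps)
    have "p = (i + (\<Prod>b\<in>C. Var (T s) - Var (Z b)) * i')
        + (\<Prod>b\<in>insert c C. Var (T s) - Var (Z b)) * (q' + q'')"
      using insert.hyps unfolding p q by (simp add: algebra_simps)
    moreover have "i + (\<Prod>b\<in>C. Var (T s) - Var (Z b)) * i' \<in> ?I"
      by (intro ideal_span.add ideal_span.mult i i')
    ultimately show ?case
      by blast
  qed
  then obtain i q where i: "i \<in> ?I" and p: "p = i + (\<Prod>b\<in>B. Var (T s) - Var (Z b)) * q"
    by blast
  have "q * (\<Prod>b\<in>B. Var (T s) - Var (Z b)) \<in> ?I"
    using insert by (intro ideal_span.mult prod_in_ideal_span) auto
  then show ?case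
    unfolding p mult.commute[of _ q] by (intro ideal_span.add i)
qed

section \<open>The super weight functions as quotients\<close>

definition vandermonde :: "nat \<Rightarrow> (nat \<Rightarrow> 'a) \<Rightarrow> 'a::comm_ring_1" where
  "vandermonde k t = (\<Prod>a\<in>{1..k}. \<Prod>b\<in>{a<..k}. t b - t a)"

definition ordered_pairs :: "nat \<Rightarrow> (nat \<times> nat) set" where
  "ordered_pairs k = {(a, b). 1 \<le> a \<and> a < b \<and> b \<le> k}"

lemma finite_ordered_pairs: "finite (ordered_pairs k)"
  by (rule finite_subset[of _ "{1..k} \<times> {1..k}"]) (auto simp: ordered_pairs_def)

lemma prod_ordered_pairs:
  "(\<Prod>a\<in>{1..k}. \<Prod>b\<in>{a<..k}. f a b) = (\<Prod>(a, b)\<in>ordered_pairs k. f a b)"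
proof -
  have "ordered_pairs k = (SIGMA a:{1..k}. {a<..k})"
    by (auto simp: ordered_pairs_def)
  then show ?thesis
    by (simp add: prod.Sigma)
qed

lemma vandermonde_alt: "vandermonde k t = (\<Prod>(a, b)\<in>ordered_pairs k. t b - t a)"
  unfolding vandermonde_def by (rule prod_ordered_pairs)

text \<open>An adjacent transposition permutes the ordered pairs other than
  \<open>(p, Suc p)\<close> without reversing any of them.\<close>

lemma vandermonde_adjacent:
  assumes "1 \<le> p" "Suc p \<le> k"
  shows "vandermonde k (t \<circ> transpose p (Suc p)) = - vandermonde k t"
proof -
  let ?s = "transpose p (Suc p)" and ?L = "ordered_pairs k - {(p, Suc p)}"
  have mem: "(p, Suc p) \<in> ordered_pairs k"
    using assms by (simp add: ordered_pairs_def)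
  have s: "map_prod ?s ?s x \<in> ?L" if "x \<in> ?L" for x
    using that assms by (cases x) (auto simp: ordered_pairs_def transpose_def)
  have "(\<Prod>(a, b)\<in>?L. t (?s b) - t (?s a)) = (\<Prod>(a, b)\<in>?L. t b - t a)"
    by (rule prod.reindex_bij_witness[of _ "map_prod ?s ?s" "map_prod ?s ?s"])
      (erule s | simp add: case_prod_beta map_prod_def)+
  then show ?thesis
    unfolding vandermonde_alt prod.remove[OF finite_ordered_pairs mem] by (simp add: algebra_simps)
qed

text \<open>A longer transposition is a shorter one conjugated by an adjacent one, which makes three
  changes of sign.\<close>

lemma vandermonde_transpose:
  assumes "1 \<le> p" "p < q" "q \<le> k"
  shows "vandermonde k (t \<circ> transpose p q) = - vandermonde k t"
  using assms(2,3)
proof (induction q arbitrary: t rule: less_induct)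
  case (less q)
  show ?case
  proof (cases "q = Suc p")
    case True
    then show ?thesis
      unfolding True using assms(1) less.prems True by (intro vandermonde_adjacent) simp_all
  next
    case False
    then obtain q' where q: "q = Suc q'" "p < q'"
      using less.prems by (cases q) auto
    let ?s = "transpose q' (Suc q')"
    have "transpose p q = ?s \<circ> transpose p q' \<circ> ?s"
      using q by (auto simp: fun_eq_iff transpose_def)
    then have "vandermonde k (t \<circ> transpose p q) = vandermonde k (((t \<circ> ?s) \<circ> transpose p q') \<circ> ?s)"
      by (simp add: o_assoc)
    also have "\<dots> = - vandermonde k ((t \<circ> ?s) \<circ> transpose p q')"
      using q less.prems assms by (intro vandermonde_adjacent) auto
    also have "vandermonde k ((t \<circ> ?s) \<circ> transpose p q') = - vandermonde k (t \<circ> ?s)"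
      using q less.prems by (intro less.IH) auto
    also have "vandermonde k (t \<circ> ?s) = - vandermonde k t"
      using q less.prems assms by (intro vandermonde_adjacent) auto
    finally show ?thesis
      by simp
  qed
qed

lemma vandermonde_permutes:
  assumes "\<tau> permutes {1..k}"
  shows "vandermonde k (t \<circ> \<tau>) = of_int (sign \<tau>) * vandermonde k t"
  using assms finite_atLeastAtMost
proof (induction arbitrary: t rule: permutes_induct)
  case (swap a b p)
  have "vandermonde k (t \<circ> transpose a b) = - vandermonde k t"
    using swap.hyps vandermonde_transpose[of a b k t] vandermonde_transpose[of b a k t]
    by (cases a b rule: linorder_cases) (auto simp: transpose_commute)
  moreover have "sign (transpose a b \<circ> p) = - sign p"
    using swap.hyps(3) sign_compose[OF permutation_swap_id
      permutes_imp_permutation[OF finite_atLeastAtMost swap.hyps(4)], of a b]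
    by (simp add: sign_swap_id)
  ultimately show ?case
    unfolding o_assoc swap.IH by (simp only: of_int_minus minus_mult_commute)
qed simp

text \<open>Numerator and denominator live in any commutative ring, so they can be formed among
  polynomials and commute with substitutions. The Vandermonde product is kept apart from
  \<open>U_den\<close>: the factors of \<open>U_den\<close> cancel in each single summand, the
  Vandermonde product only in the sum.\<close>

fun U_num :: "flavour \<Rightarrow> nat \<Rightarrow> nat \<Rightarrow> nat set \<Rightarrow> (nat \<Rightarrow> 'a) \<Rightarrow> (nat \<Rightarrow> 'a) \<Rightarrow> 'a \<Rightarrow> 'a::comm_ring_1" where
  "U_num R00 k n I z t h =
     (\<Prod>a\<in>{1..k}. (\<Prod>b\<in>{1..<nth_smallest I a}. t a - z b + h)
                 * (\<Prod>b\<in>{nth_smallest I a<..n}. z b - t a))"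
| "U_num R10 k n I z t h =
     (\<Prod>a\<in>{1..k}. (\<Prod>b\<in>{1..<nth_smallest I a}. t a - z b + h)
                 * (\<Prod>b\<in>{nth_smallest I a<..n}. z b - t a))"
| "U_num R01 k n I z t h =
     (\<Prod>a\<in>{1..k}. (\<Prod>b\<in>{1..<nth_smallest I a}. z b - t a + h)
                 * (\<Prod>b\<in>{nth_smallest I a<..n}. z b - t a))
   * h ^ k * (\<Prod>a\<in>{1..n}. \<Prod>b\<in>{a<..n}. z b - z a + h)"
| "U_num R11 k n I z t h =
     (\<Prod>a\<in>{1..k}. (\<Prod>b\<in>{1..<nth_smallest I a}. z b - t a + h)
                 * (\<Prod>b\<in>{nth_smallest I a<..n}. z b - t a))
   * (\<Prod>a\<in>{1..k}. \<Prod>b\<in>{a<..k}. t b - t a + h)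
   * h ^ k * (\<Prod>a\<in>{1..n}. \<Prod>b\<in>{a<..n}. z b - z a + h)"

fun U_den :: "flavour \<Rightarrow> nat \<Rightarrow> nat \<Rightarrow> (nat \<Rightarrow> 'a) \<Rightarrow> (nat \<Rightarrow> 'a) \<Rightarrow> 'a \<Rightarrow> 'a::comm_ring_1" where
  "U_den R00 k n z t h = (\<Prod>a\<in>{1..k}. \<Prod>b\<in>{a<..k}. t b - t a + h)"
| "U_den R10 k n z t h = 1"
| "U_den R01 k n z t h = (\<Prod>a\<in>{1..k}. \<Prod>b\<in>{1..n}. z b - t a + h)"
| "U_den R11 k n z t h = (\<Prod>a\<in>{1..k}. \<Prod>b\<in>{1..n}. z b - t a + h)"

lemma U_fun_quotient:
  "U_fun r k n I z t h = U_num r k n I z t h / (U_den r k n z t h * vandermonde k t)"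
  by (cases r) (simp_all add: vandermonde_def prod_dividef prod.distrib)

lemma U_num_poly_subst:
  "poly_subst f (U_num r k n I z t h) =
    U_num r k n I (\<lambda>b. poly_subst f (z b)) (\<lambda>a. poly_subst f (t a)) (poly_subst f h)"
  by (cases r) simp_all

lemma U_den_poly_subst:
  "poly_subst f (U_den r k n z t h) =
    U_den r k n (\<lambda>b. poly_subst f (z b)) (\<lambda>a. poly_subst f (t a)) (poly_subst f h)"
  by (cases r) simp_all

lemma vandermonde_poly_subst:
  "poly_subst f (vandermonde k t) = vandermonde k (\<lambda>a. poly_subst f (t a))"
  by (simp add: vandermonde_def)

section \<open>Polynomials inside their field of fractions\<close>

definition fract_of :: "'a::idom \<Rightarrow> 'a fract" where
  "fract_of p = Fract p 1"

lemma fract_of_simps [simp]: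
  "fract_of (p + q) = fract_of p + fract_of q"
  "fract_of (p - q) = fract_of p - fract_of q"
  "fract_of (p * q) = fract_of p * fract_of q"
  "fract_of 0 = 0" "fract_of 1 = 1"
  by (simp_all add: fract_of_def Zero_fract_def One_fract_def)

lemma fract_of_uminus [simp]: "fract_of (- p) = - fract_of p"
  by (simp add: fract_of_def)

lemma fract_of_eq_iff [simp]: "fract_of p = fract_of q \<longleftrightarrow> p = q"
  by (simp add: fract_of_def eq_fract)

lemma fract_of_eq_0_iff [simp]: "fract_of p = 0 \<longleftrightarrow> p = 0"
  using fract_of_eq_iff[of p 0] by (simp del: fract_of_eq_iff)

lemma fract_of_prod [simp]: "fract_of (prod f A) = (\<Prod>x\<in>A. fract_of (f x))"
  by (induction A rule: infinite_finite_induct) simp_all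

lemma fract_of_sum [simp]: "fract_of (sum f A) = (\<Sum>x\<in>A. fract_of (f x))"
  by (induction A rule: infinite_finite_induct) simp_all

lemma fract_of_power [simp]: "fract_of (p ^ e) = fract_of p ^ e"
  by (induction e) simp_all

lemma fract_of_sign: "fract_of (of_int (sign \<tau>)) = of_int (sign \<tau>)"
  by (cases \<tau> rule: sign_cases) simp_all

lemma U_num_fract_of:
  "U_num r k n I (\<lambda>b. fract_of (z b)) (\<lambda>a. fract_of (t a)) (fract_of h) = fract_of (U_num r k n I z t h)"
  by (cases r) simp_all

lemma U_den_fract_of:
  "U_den r k n (\<lambda>b. fract_of (z b)) (\<lambda>a. fract_of (t a)) (fract_of h) = fract_of (U_den r k n z t h)"
  by (cases r) simp_all

lemma vandermonde_fract_of:
  "vandermonde k (\<lambda>a. fract_of (t a)) = fract_of (vandermonde k t)"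
  by (simp add: vandermonde_def)

lemma sorted_nth_smallest:
  assumes "finite I" "1 \<le> a" "a < b" "b \<le> card I"
  shows "nth_smallest I a < nth_smallest I b"
  unfolding nth_smallest_def
  using assms by (intro sorted_wrt_nth_less[OF strict_sorted_list_of_set]) auto

lemma nth_smallest_mem:
  assumes "finite I" "1 \<le> a" "a \<le> card I"
  shows "nth_smallest I a \<in> I"
  using assms nth_mem[of "a - 1" "sorted_list_of_set I"] by (simp add: nth_smallest_def)

lemma bij_nth_smallest:
  assumes "finite J"
  shows "bij_betw (nth_smallest J) {1..card J} J"
proof -
  have "bij_betw (\<lambda>a. a - 1) {1..card J} {..<card J}"
    by (rule bij_betw_byWitness[where f' = Suc]) auto
  moreover have "bij_betw (nth (sorted_list_of_set J)) {..<card J} J"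
    using assms by (intro bij_betw_nth) auto
  ultimately have "bij_betw (nth (sorted_list_of_set J) \<circ> (\<lambda>a. a - 1)) {1..card J} J"
    by (rule bij_betw_trans)
  then show ?thesis
    by (simp add: nth_smallest_def[abs_def] o_def)
qed

section \<open>Cancellation of the vertical weights\<close>

text \<open>A diagonal pair \<open>(j, j)\<close> contributes the factor \<open>h\<close>.\<close>

definition ver_prod :: "(nat \<Rightarrow> 'a) \<Rightarrow> 'a \<Rightarrow> (nat \<times> nat) set \<Rightarrow> 'a::comm_ring_1" where
  "ver_prod z h S = (\<Prod>(i, j)\<in>S. z i - z j + h)"

lemma ver_prod_Un:
  "finite S \<Longrightarrow> finite S' \<Longrightarrow> S \<inter> S' = {} \<Longrightarrow> ver_prod z h (S \<union> S') = ver_prod z h S * ver_prod z h S'"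
  unfolding ver_prod_def by (rule prod.union_disjoint)

lemma ver_prod_diff:
  "finite S \<Longrightarrow> S' \<subseteq> S \<Longrightarrow> ver_prod z h S = ver_prod z h S' * ver_prod z h (S - S')"
  by (subst ver_prod_Un[symmetric]) (auto simp: Un_absorb1 intro: finite_subset)

lemma dvd_ver_prod:
  assumes "finite S" "(j, j) \<in> S"
  shows "h dvd ver_prod z h S"
  unfolding ver_prod_def prod.remove[OF assms] by simp

text \<open>The repelling vertical pairs for the identity permutation; relabelling by the inverse of
  \<sigma> reduces the general case to this one.\<close>

definition repelling_ver :: "flavour \<Rightarrow> nat \<Rightarrow> nat set \<Rightarrow> (nat \<times> nat) set" where
  "repelling_ver r n J = {(i, j) \<in> ver_weights r n J. j < i}"

text \<open>
  For an enumeration \<open>\<mu>\<close> of \<open>J\<close> the shift \<open>\<iota>\<close> maps \<open>\<mu> a\<close> to \<open>i\<^sub>a\<close>.  The factors of the weight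
  functions become sets of pairs, and cancellation becomes inclusion of such sets.
\<close>

locale shifted_subset =
  fixes n :: nat and J :: "nat set" and \<iota> :: "nat \<Rightarrow> nat"
  assumes J: "J \<subseteq> {1..n}"
    and inj: "inj_on \<iota> J"
    and ge: "\<And>j. j \<in> J \<Longrightarrow> j \<le> \<iota> j"
    and le_n: "\<And>j. j \<in> J \<Longrightarrow> \<iota> j \<le> n"
begin

text \<open>With \<open>(x, y)\<close> standing for \<open>z x - z y + h\<close>, the first five
  sets are factors of the weight functions at \<open>t a = z (\<mu> a)\<close>: \<open>A\<close> and
  \<open>A'\<close> come from the products over \<open>b < i_a\<close> in their two orientations,
  \<open>C\<close> from \<open>t b - t a + h\<close>, \<open>P\<close> from the pairs of parameters,
  \<open>B\<close> from the denominator of \<open>R01\<close> and \<open>R11\<close>.\<close>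

definition A :: "(nat \<times> nat) set" where "A = {(j, b). j \<in> J \<and> 1 \<le> b \<and> b < \<iota> j}"
definition A' :: "(nat \<times> nat) set" where "A' = {(b, j). j \<in> J \<and> 1 \<le> b \<and> b < \<iota> j}"
definition C :: "(nat \<times> nat) set" where "C = {(x, y). x \<in> J \<and> y \<in> J \<and> \<iota> y < \<iota> x}"
definition P :: "(nat \<times> nat) set" where "P = {(b, a). 1 \<le> a \<and> a < b \<and> b \<le> n}"
definition B :: "(nat \<times> nat) set" where "B = {1..n} \<times> J"

text \<open>The pieces into which the former sets are cut. \<open>D\<close> collects the factors of
  \<open>h ^ k\<close>, \<open>L\<close> and \<open>U\<close> the pairs of \<open>B\<close> below
  and above the diagonal, \<open>M\<close> the excess of \<open>A'\<close> over \<open>L\<close>,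
  and \<open>E\<close> the repelling pairs that \<open>R11\<close> has in addition to
  \<open>R01\<close>.\<close>

definition E :: "(nat \<times> nat) set" where "E = {(i, j). i \<in> J \<and> j \<in> J \<and> j < i}"
definition M :: "(nat \<times> nat) set" where "M = {(b, j). j \<in> J \<and> j \<le> b \<and> b < \<iota> j}"
definition L :: "(nat \<times> nat) set" where "L = {(b, j). j \<in> J \<and> 1 \<le> b \<and> b < j}"
definition U :: "(nat \<times> nat) set" where "U = {(b, j). j \<in> J \<and> j < b \<and> b \<le> n}"
definition D :: "(nat \<times> nat) set" where "D = {(b, j). j \<in> J \<and> b = j}"

lemma finite_pairs:
  "finite A" "finite A'" "finite C" "finite P" "finite B" "finite E" "finite M" "finite L"
  "finite U" "finite D" "finite (repelling_ver r n J)"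
proof -
  have "A \<union> A' \<union> C \<union> P \<union> B \<union> E \<union> M \<union> L \<union> U \<union> D \<union> repelling_ver r n J \<subseteq> {1..n} \<times> {1..n}"
    using J le_n ge by (cases r)
      (force simp: A_def A'_def C_def P_def B_def E_def M_def L_def U_def D_def repelling_ver_def)+
  from finite_subset[OF this]
  show "finite A" "finite A'" "finite C" "finite P" "finite B" "finite E" "finite M" "finite L"
    "finite U" "finite D" "finite (repelling_ver r n J)"
    by simp_all
qed

lemma finite_J: "finite J"
  using J finite_subset by blast

lemma ver_prod_D: "ver_prod z h D = h ^ card J"
proof -
  have "ver_prod z h D = (\<Prod>(i, j)\<in>(\<lambda>j. (j, j)) ` J. z i - z j + h)"
    unfolding ver_prod_def by (rule prod.cong) (auto simp: D_def)
  also have "\<dots> = h ^ card J"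
    by (subst prod.reindex) (auto intro: inj_onI)
  finally show ?thesis .
qed

lemma iota_less_iff: "x \<in> J \<Longrightarrow> y \<in> J \<Longrightarrow> x \<noteq> y \<Longrightarrow> \<not> \<iota> y < \<iota> x \<longleftrightarrow> \<iota> x < \<iota> y"
  using inj_onD[OF inj, of x y] by (auto simp: not_less le_less)

lemma P_eq: "P = repelling_ver R01 n J \<union> U" "repelling_ver R01 n J \<inter> U = {}"
  using J by (auto simp: P_def repelling_ver_def U_def)

lemma B_eq: "B = (U \<union> D) \<union> L" "(U \<union> D) \<inter> L = {}" "U \<inter> D = {}"
  using J by (auto simp: B_def U_def D_def L_def)

lemma A'_eq: "A' = L \<union> M" "L \<inter> M = {}"
  using J ge by (fastforce simp: A'_def L_def M_def)+

lemma repelling_R11: "repelling_ver R11 n J = repelling_ver R01 n J \<union> E" "repelling_ver R01 n J \<inter> E = {}"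
  using J by (auto simp: repelling_ver_def E_def)

text \<open>A pair of \<open>E\<close> outside \<open>C\<close> satisfies
  \<open>j < i \<le> \<iota> i < \<iota> j\<close>. So the repelling weights of \<open>R11\<close>
  that \<open>C\<close> fails to supply are found in the excess \<open>M\<close>.\<close>

lemma C_E: "E - C \<subseteq> M"
  using ge iota_less_iff by (fastforce simp: E_def C_def M_def)

end

fun (in shifted_subset) ver_num :: "flavour \<Rightarrow> (nat \<Rightarrow> 'a) \<Rightarrow> 'a \<Rightarrow> 'a::comm_ring_1" where
  "ver_num R00 z h = ver_prod z h A"
| "ver_num R10 z h = ver_prod z h A"
| "ver_num R01 z h = ver_prod z h A' * h ^ card J * ver_prod z h P"
| "ver_num R11 z h = ver_prod z h A' * ver_prod z h C * h ^ card J * ver_prod z h P"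

fun (in shifted_subset) ver_den :: "flavour \<Rightarrow> (nat \<Rightarrow> 'a) \<Rightarrow> 'a \<Rightarrow> 'a::comm_ring_1" where
  "ver_den R00 z h = ver_prod z h C"
| "ver_den R10 z h = 1"
| "ver_den R01 z h = ver_prod z h B"
| "ver_den R11 z h = ver_prod z h B"

text \<open>The explicit cofactor left after removing the denominator and the repelling vertical
  weights.\<close>

fun (in shifted_subset) rest :: "flavour \<Rightarrow> (nat \<Rightarrow> 'a) \<Rightarrow> 'a \<Rightarrow> 'a::comm_ring_1" where
  "rest R00 z h = ver_prod z h (A - C - repelling_ver R00 n J)"
| "rest R10 z h = ver_prod z h (A - repelling_ver R10 n J)"
| "rest R01 z h = ver_prod z h M"
| "rest R11 z h = ver_prod z h (M - (E - C)) * ver_prod z h (C - E)"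

context shifted_subset
begin

text \<open>The denominator \<open>B\<close> is used up exactly by \<open>L\<close> from
  \<open>A'\<close>, \<open>U\<close> from \<open>P\<close> and \<open>D\<close> from the power of
  \<open>h\<close>. The repelling part of \<open>P\<close> and the excess \<open>M\<close>
  remain.\<close>

lemma ver_num_R01: "ver_num R01 z h = ver_prod z h B * ver_prod z h (repelling_ver R01 n J) * ver_prod z h M"
  by (simp add: A'_eq ver_prod_Un finite_pairs P_eq B_eq ver_prod_D mult_ac del: Un_assoc)

text \<open>For \<open>R00\<close>, a pair of \<open>C\<close> has
  \<open>y \<le> \<iota> y < \<iota> x\<close>, hence lies in \<open>A\<close>; repelling pairs lie
  in \<open>A\<close> because \<open>j < i \<le> \<iota> i\<close>, and avoid \<open>C\<close>
  because their second entry is outside \<open>J\<close>. For \<open>R11\<close>, the part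
  \<open>C \<inter> E\<close> of \<open>C\<close> and the part \<open>E - C\<close> of
  \<open>M\<close> together make up \<open>E\<close>.\<close>

lemma ver_num_factor:
  "ver_num r z h = ver_den r z h * ver_prod z h (repelling_ver r n J) * rest r z h"
proof (cases r)
  case R00
  have sub: "C \<subseteq> A" "repelling_ver R00 n J \<subseteq> A - C"
    using J ge by (fastforce simp: A_def C_def repelling_ver_def)+
  show ?thesis
    using ver_prod_diff[OF finite_pairs(1) sub(1), of z h] ver_prod_diff[OF _ sub(2), of z h]
    by (simp add: R00 finite_pairs mult.assoc)
next
  case R10
  have sub: "repelling_ver R10 n J \<subseteq> A"
    using J ge by (fastforce simp: A_def repelling_ver_def)
  show ?thesis
    using ver_prod_diff[OF finite_pairs(1) sub, of z h] by (simp add: R10)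
next
  case R01
  show ?thesis
    unfolding R01 ver_num_R01 by simp
next
  case R11
  have 1: "ver_prod z h M = ver_prod z h (E - C) * ver_prod z h (M - (E - C))"
    using finite_pairs C_E by (intro ver_prod_diff)
  have 2: "ver_prod z h C = ver_prod z h (C \<inter> E) * ver_prod z h (C - E)"
    using ver_prod_diff[of C "C \<inter> E" z h] finite_pairs by (simp add: Diff_Int)
  have 3: "ver_prod z h E = ver_prod z h (C \<inter> E) * ver_prod z h (E - C)"
    using ver_prod_diff[of E "C \<inter> E" z h] finite_pairs by (simp add: Diff_Int)
  have "ver_num R11 z h = ver_num R01 z h * ver_prod z h C"
    by (simp add: mult_ac)
  also have "\<dots> = ver_prod z h B * (ver_prod z h (repelling_ver R01 n J) * ver_prod z h E) * rest R11 z h"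
    unfolding ver_num_R01 1 2 3 by (simp add: mult_ac)
  also have "ver_prod z h (repelling_ver R01 n J) * ver_prod z h E = ver_prod z h (repelling_ver R11 n J)"
    unfolding repelling_R11 by (rule ver_prod_Un[symmetric]) (simp_all add: finite_pairs repelling_R11)
  finally show ?thesis
    by (simp add: R11)
qed

text \<open>The diagonal pair \<open>(j, j)\<close> contributes the factor \<open>h\<close>. It
  occurs among the factors as soon as \<open>j < \<iota> j\<close>, and since \<open>C\<close>,
  \<open>E\<close> and the repelling pairs are irreflexive it is never removed.\<close>

lemma dvd_rest:
  assumes "j \<in> J" "j < \<iota> j"
  shows "h dvd rest r z h"
proof (cases r)
  case R00
  have "(j, j) \<in> A - C - repelling_ver R00 n J"
    using assms J by (auto simp: A_def C_def repelling_ver_def)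
  from dvd_ver_prod[OF _ this] show ?thesis
    by (simp add: R00 finite_pairs)
next
  case R10
  have "(j, j) \<in> A - repelling_ver R10 n J"
    using assms J by (auto simp: A_def repelling_ver_def)
  from dvd_ver_prod[OF _ this] show ?thesis
    by (simp add: R10 finite_pairs)
next
  case R01
  have "(j, j) \<in> M"
    using assms by (auto simp: M_def)
  from dvd_ver_prod[OF _ this] show ?thesis
    by (simp add: R01 finite_pairs)
next
  case R11
  have "(j, j) \<in> M - (E - C)"
    using assms by (auto simp: M_def E_def)
  from dvd_ver_prod[OF _ this, of h z] show ?thesis
    by (simp add: R11 finite_pairs dvd_mult2)
qed

text \<open>Without a shift nothing is left over; this is the exactness behind (A1), where
  \<open>dvd_rest\<close> serves (A2).\<close>

lemma rest_eq_1:
  assumes "\<And>j. j \<in> J \<Longrightarrow> \<iota> j = j"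
  shows "rest r z h = 1"
proof -
  have "A - C - repelling_ver R00 n J = {}" "A - repelling_ver R10 n J = {}"
    "M = {}" "M - (E - C) = {}" "C - E = {}"
    using J assms by (auto simp: A_def C_def repelling_ver_def M_def E_def)
  moreover have "ver_prod z h {} = 1"
    by (simp add: ver_prod_def)
  ultimately show ?thesis
    by (cases r) (simp_all only: rest.simps mult_1_left)
qed

end

text \<open>\<open>I\<close> indexes the weight function and \<open>J\<close> the fixed point, both
  already relabelled by the inverse of \<sigma>; \<open>\<mu> a\<close> is the parameter substituted
  for the root of index \<open>a\<close>. The last assumption characterizes the summands that do not
  vanish.\<close>

locale shifted_enumeration =
  fixes k n :: nat and I J :: "nat set" and \<mu> :: "nat \<Rightarrow> nat"
  assumes I: "I \<in> ksubsets k n" and J_n: "J \<subseteq> {1..n}" and \<mu>: "bij_betw \<mu> {1..k} J"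
    and \<mu>_le: "\<And>a. a \<in> {1..k} \<Longrightarrow> \<mu> a \<le> nth_smallest I a"
begin

definition \<iota> :: "nat \<Rightarrow> nat" where
  "\<iota> j = nth_smallest I (inv_into {1..k} \<mu> j)"

lemma iota_mu: "a \<in> {1..k} \<Longrightarrow> \<iota> (\<mu> a) = nth_smallest I a"
  using \<mu> by (simp add: \<iota>_def bij_betw_def)

lemma finite_I: "finite I" "card I = k" "I \<subseteq> {1..n}"
  using I by (auto simp: ksubsets_def intro: finite_subset)

lemma J_cases:
  assumes "j \<in> J"
  obtains a where "a \<in> {1..k}" "j = \<mu> a"
  using \<mu> assms by (auto simp: bij_betw_def)

lemma nth_less_iff: "a \<in> {1..k} \<Longrightarrow> b \<in> {1..k} \<Longrightarrow> nth_smallest I a < nth_smallest I b \<longleftrightarrow> a < b"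
  using sorted_nth_smallest[of I a b] sorted_nth_smallest[of I b a] finite_I
  by (cases a b rule: linorder_cases) auto

sublocale shifted_subset n J \<iota>
proof
  show "J \<subseteq> {1..n}"
    by (rule J_n)
  show "inj_on \<iota> J"
  proof (rule inj_onI)
    fix x y assume "x \<in> J" "y \<in> J" and eq: "\<iota> x = \<iota> y"
    then obtain a b where "a \<in> {1..k}" "x = \<mu> a" "b \<in> {1..k}" "y = \<mu> b"
      by (metis J_cases)
    with eq show "x = y"
      using nth_less_iff[of a b] nth_less_iff[of b a] by (auto simp: iota_mu)
  qed
  fix j assume "j \<in> J"
  then obtain a where a: "a \<in> {1..k}" "j = \<mu> a"
    by (metis J_cases)
  then show "j \<le> \<iota> j" "\<iota> j \<le> n"
    using \<mu>_le nth_smallest_mem[of I a] finite_I by (auto simp: iota_mu)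
qed

lemma prod_A: "(\<Prod>a\<in>{1..k}. \<Prod>b\<in>{1..<nth_smallest I a}. f (\<mu> a) b) = (\<Prod>(j, b)\<in>A. f j b)"
proof -
  have "(\<Prod>a\<in>{1..k}. \<Prod>b\<in>{1..<nth_smallest I a}. f (\<mu> a) b)
      = (\<Prod>a\<in>{1..k}. \<Prod>b\<in>{1..<\<iota> (\<mu> a)}. f (\<mu> a) b)"
    by (rule prod.cong) (simp_all add: iota_mu)
  also have "\<dots> = (\<Prod>j\<in>J. \<Prod>b\<in>{1..<\<iota> j}. f j b)"
    by (rule prod.reindex_bij_betw[OF \<mu>])
  also have "\<dots> = (\<Prod>(j, b)\<in>(SIGMA j:J. {1..<\<iota> j}). f j b)"
    using finite_J by (rule prod.Sigma) simp
  also have "(SIGMA j:J. {1..<\<iota> j}) = A"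
    by (auto simp: A_def)
  finally show ?thesis .
qed

lemma prod_A': "(\<Prod>(j, b)\<in>A. f b j) = (\<Prod>(b, j)\<in>A'. f b j)"
  by (rule prod.reindex_bij_witness[of _ prod.swap prod.swap]) (auto simp: A_def A'_def)

lemma prod_B: "(\<Prod>a\<in>{1..k}. \<Prod>b\<in>{1..n}. f b (\<mu> a)) = (\<Prod>(b, j)\<in>B. f b j)"
proof -
  have "(\<Prod>a\<in>{1..k}. \<Prod>b\<in>{1..n}. f b (\<mu> a)) = (\<Prod>j\<in>J. \<Prod>b\<in>{1..n}. f b j)"
    by (rule prod.reindex_bij_betw[OF \<mu>])
  also have "\<dots> = (\<Prod>b\<in>{1..n}. \<Prod>j\<in>J. f b j)"
    by (rule prod.swap)
  also have "\<dots> = (\<Prod>(b, j)\<in>B. f b j)"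
    unfolding B_def using finite_J by (simp add: prod.cartesian_product)
  finally show ?thesis .
qed

lemma prod_C: "(\<Prod>(a, b)\<in>ordered_pairs k. f (\<mu> b) (\<mu> a)) = (\<Prod>(x, y)\<in>C. f x y)"
proof (rule prod.reindex_bij_betw[THEN trans[rotated]])
  have inj: "inj_on \<mu> {1..k}"
    using \<mu> by (simp add: bij_betw_def)
  show "bij_betw (\<lambda>(a, b). (\<mu> b, \<mu> a)) (ordered_pairs k) C"
  proof (rule bij_betwI')
    fix x y assume "x \<in> ordered_pairs k" "y \<in> ordered_pairs k"
    then show "((case x of (a, b) \<Rightarrow> (\<mu> b, \<mu> a)) = (case y of (a, b) \<Rightarrow> (\<mu> b, \<mu> a))) = (x = y)"
      using inj_onD[OF inj] by (cases x; cases y) (auto simp: ordered_pairs_def)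
  next
    fix x assume "x \<in> ordered_pairs k"
    then obtain a b where x: "x = (a, b)" "a \<in> {1..k}" "b \<in> {1..k}" "a < b"
      by (auto simp: ordered_pairs_def)
    then show "(case x of (a, b) \<Rightarrow> (\<mu> b, \<mu> a)) \<in> C"
      using bij_betw_apply[OF \<mu>] nth_less_iff[of a b] by (simp add: C_def iota_mu)
  next
    fix y assume "y \<in> C"
    then obtain a b where "a \<in> {1..k}" "b \<in> {1..k}" "y = (\<mu> b, \<mu> a)" "\<iota> (\<mu> a) < \<iota> (\<mu> b)"
      unfolding C_def by (auto elim!: J_cases)
    then show "\<exists>x\<in>ordered_pairs k. y = (case x of (a, b) \<Rightarrow> (\<mu> b, \<mu> a))"
      using nth_less_iff[of a b] by (intro bexI[of _ "(a, b)"]) (auto simp: iota_mu ordered_pairs_def)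
  qed
qed (rule prod.cong, auto)

lemma prod_P: "(\<Prod>a\<in>{1..n}. \<Prod>b\<in>{a<..n}. f b a) = (\<Prod>(b, a)\<in>P. f b a)"
  unfolding prod_ordered_pairs
  by (rule prod.reindex_bij_witness[of _ prod.swap prod.swap]) (auto simp: P_def ordered_pairs_def)

lemma U_num_eq:
  "U_num r k n I z (\<lambda>a. z (\<mu> a)) h =
    ver_num r z h * (\<Prod>a\<in>{1..k}. \<Prod>b\<in>{nth_smallest I a<..n}. z b - z (\<mu> a))"
proof -
  have A: "(\<Prod>a\<in>{1..k}. \<Prod>b\<in>{1..<nth_smallest I a}. z (\<mu> a) - z b + h) = ver_prod z h A"
    unfolding ver_prod_def by (rule prod_A)
  have A': "(\<Prod>a\<in>{1..k}. \<Prod>b\<in>{1..<nth_smallest I a}. z b - z (\<mu> a) + h) = ver_prod z h A'"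
    unfolding ver_prod_def prod_A'[symmetric] by (rule prod_A)
  have C: "(\<Prod>a\<in>{1..k}. \<Prod>b\<in>{a<..k}. z (\<mu> b) - z (\<mu> a) + h) = ver_prod z h C"
    unfolding ver_prod_def prod_C[symmetric] by (rule prod_ordered_pairs)
  have P: "(\<Prod>a\<in>{1..n}. \<Prod>b\<in>{a<..n}. z b - z a + h) = ver_prod z h P"
    unfolding ver_prod_def by (rule prod_P)
  have J: "card J = k"
    using bij_betw_same_card[OF \<mu>] by simp
  show ?thesis
    by (cases r) (simp_all only: U_num.simps ver_num.simps prod.distrib A A' C P J mult_ac)
qed

lemma U_den_eq: "U_den r k n z (\<lambda>a. z (\<mu> a)) h = ver_den r z h"
proof -
  have C: "(\<Prod>a\<in>{1..k}. \<Prod>b\<in>{a<..k}. z (\<mu> b) - z (\<mu> a) + h) = ver_prod z h C"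
    unfolding ver_prod_def prod_C[symmetric] by (rule prod_ordered_pairs)
  have B: "(\<Prod>a\<in>{1..k}. \<Prod>b\<in>{1..n}. z b - z (\<mu> a) + h) = ver_prod z h B"
    unfolding ver_prod_def by (rule prod_B)
  show ?thesis
    by (cases r) (simp_all only: U_den.simps ver_den.simps B C)
qed

lemma U_num_factor:
  "U_num r k n I z (\<lambda>a. z (\<mu> a)) h =
    U_den r k n z (\<lambda>a. z (\<mu> a)) h * ver_prod z h (repelling_ver r n J) * rest r z h
    * (\<Prod>a\<in>{1..k}. \<Prod>b\<in>{nth_smallest I a<..n}. z b - z (\<mu> a))"
  unfolding U_num_eq U_den_eq ver_num_factor ..

end

section \<open>Localization\<close>

text \<open>A retraction onto the polynomials in \<open>V\<close>. Being a ring homomorphism, it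
  shows that a quotient of polynomials in \<open>V\<close> involves only variables in
  \<open>V\<close>.\<close>

definition restrict_vars :: "var set \<Rightarrow> mpoly \<Rightarrow> mpoly" where
  "restrict_vars V = poly_subst (\<lambda>v. if v \<in> V then Var v else 0)"

lemma restrict_vars_id: "vars p \<subseteq> V \<Longrightarrow> restrict_vars V p = p"
  unfolding restrict_vars_def by (subst poly_subst_cong_vars[where g = Var]) auto

lemma vars_restrict_vars: "vars (restrict_vars V p) \<subseteq> V"
  unfolding restrict_vars_def by (rule vars_poly_subst) auto

lemma restrict_vars_mult: "restrict_vars W (p * q) = restrict_vars W p * restrict_vars W q"
  by (simp add: restrict_vars_def)

text \<open>The retraction fixes \<open>p\<close> and \<open>e\<close>, so it turns any cofactor
  into one from the subring.\<close>

lemma divides_mpoly_ringI: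
  assumes "vars p \<subseteq> V" "vars e \<subseteq> V" "e dvd p"
  shows "e divides\<^bsub>mpoly_ring V\<^esub> p"
proof -
  from assms(3) obtain x where x: "p = e * x" ..
  have "p = restrict_vars V (e * x)"
    using assms(1) x restrict_vars_id by simp
  then have "p = e * restrict_vars V x"
    using restrict_vars_id[OF assms(2)] by (simp add: restrict_vars_def)
  then show ?thesis
    unfolding factor_def using vars_restrict_vars[of V x]
    by (intro bexI[of _ "restrict_vars V x"]) (auto simp: mem_mpoly_ring_iff, simp add: mpoly_ring_def)
qed

definition perm_T :: "(nat \<Rightarrow> nat) \<Rightarrow> mpoly \<Rightarrow> mpoly" where
  "perm_T \<tau> = poly_subst (\<lambda>v. case v of T a \<Rightarrow> Var (T (\<tau> a)) | _ \<Rightarrow> Var v)"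

lemma perm_T_simps [simp]:
  "perm_T \<tau> (p + q) = perm_T \<tau> p + perm_T \<tau> q"
  "perm_T \<tau> (p * q) = perm_T \<tau> p * perm_T \<tau> q"
  "perm_T \<tau> (p - q) = perm_T \<tau> p - perm_T \<tau> q"
  "perm_T \<tau> (- p) = - perm_T \<tau> p"
  "perm_T \<tau> 0 = 0" "perm_T \<tau> 1 = 1"
  "perm_T \<tau> (Const c) = Const c"
  "perm_T \<tau> (Var (Z i)) = Var (Z i)"
  "perm_T \<tau> (Var Hbar) = Var Hbar"
  "perm_T \<tau> (Var (T a)) = Var (T (\<tau> a))"
  "perm_T \<tau> (sum f A) = (\<Sum>x\<in>A. perm_T \<tau> (f x))"
  "perm_T \<tau> (prod f A) = (\<Prod>x\<in>A. perm_T \<tau> (f x))"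
  by (simp_all add: perm_T_def)

lemma perm_T_perm_T: "perm_T \<sigma> (perm_T \<tau> p) = perm_T (\<sigma> \<circ> \<tau>) p"
  unfolding perm_T_def poly_subst_poly_subst
  by (rule poly_subst_cong_vars) (auto split: var.split)

lemma perm_T_hcomp: "perm_T \<tau> (hcomp d p) = hcomp d (perm_T \<tau> p)"
  unfolding perm_T_def by (rule poly_subst_hcomp) (simp split: var.split)

lemma T_subst_hcomp: "T_subst S w (hcomp d p) = hcomp d (T_subst S w p)"
  unfolding T_subst_def by (rule poly_subst_hcomp) (simp split: var.split)

section \<open>The ring of invariants and averaging\<close>

locale grassmannian =
  fixes k n :: nat
  assumes k_le_n: "k \<le> n"
begin

definition V :: "var set" where
  "V = insert Hbar (Z ` {1..n} \<union> T ` {1..n})"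

text \<open>The Young subgroup \<open>S_k \<times> S_(n-k)\<close>, whose cosets correspond to the
  fixed points.\<close>

definition G :: "(nat \<Rightarrow> nat) set" where
  "G = {\<tau>. \<tau> permutes {1..n} \<and> \<tau> ` {1..k} = {1..k}}"

abbreviation C :: "mpoly ring" where
  "C \<equiv> chern_ring k n"

definition K :: "mpoly set" where
  "K = genideal C {esym n m (\<lambda>a. Var (T a)) - esym n m (\<lambda>b. Var (Z b)) |m. m \<in> {1..n}}"

lemma carrier_iff: "p \<in> carrier C \<longleftrightarrow> vars p \<subseteq> V \<and> (\<forall>\<tau>\<in>G. perm_T \<tau> p = p)"
  by (auto simp: chern_ring_def mem_mpoly_ring_iff V_def G_def perm_T_def)

lemma chern_ring_sel [simp]:
  "mult C = (*)" "one C = 1" "zero C = 0" "add C = (+)"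
  by (simp_all add: chern_ring_def mpoly_ring_def)

lemma finite_G: "finite G"
  unfolding G_def by (rule finite_subset[OF _ finite_permutations[of "{1..n}"]]) auto

lemma id_G: "id \<in> G"
  by (simp add: G_def permutes_id)

lemma compose_G:
  assumes "\<sigma> \<in> G" "\<tau> \<in> G"
  shows "\<sigma> \<circ> \<tau> \<in> G"
proof -
  have "(\<sigma> \<circ> \<tau>) ` {1..k} = \<sigma> ` (\<tau> ` {1..k})"
    by (rule image_comp[symmetric])
  then show ?thesis
    using assms by (simp add: G_def permutes_compose del: o_apply)
qed

lemma inj_compose_G: "\<sigma> \<in> G \<Longrightarrow> inj_on ((\<circ>) \<sigma>) G"
  unfolding G_def by (auto intro!: inj_onI simp: fun_eq_iff dest!: permutes_inj simp: inj_eq)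

lemma carrier_closed:
  assumes "p \<in> carrier C" "q \<in> carrier C"
  shows "p + q \<in> carrier C" "p * q \<in> carrier C" "- p \<in> carrier C"
  using assms vars_add[of p q] vars_mult[of p q] by (auto simp: carrier_iff)

lemma Const_carrier: "Const c \<in> carrier C"
  by (simp add: carrier_iff)

lemma carrier_0_1: "0 \<in> carrier C" "1 \<in> carrier C"
  by (auto simp: carrier_iff)

lemma cring_chern_ring: "cring C"
proof (rule cringI)
  show "abelian_group C"
  proof (rule abelian_groupI)
    fix x assume "x \<in> carrier C"
    then show "\<exists>y\<in>carrier C. y \<oplus>\<^bsub>C\<^esub> x = \<zero>\<^bsub>C\<^esub>"
      by (intro bexI[of _ "- x"]) (auto intro: carrier_closed)
  qed (auto intro: carrier_closed carrier_0_1 simp: algebra_simps)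
  show "comm_monoid C"
    by (rule comm_monoidI) (auto intro: carrier_closed carrier_0_1 simp: algebra_simps)
qed (auto simp: algebra_simps)

sublocale cring C
  by (rule cring_chern_ring)

text \<open>The Reynolds operator without its denominator. The retraction comes first because
  interpolating polynomials may contain variables outside \<open>V\<close>.\<close>

definition avg :: "mpoly \<Rightarrow> mpoly" where
  "avg p = (\<Sum>\<tau>\<in>G. perm_T \<tau> (restrict_vars V p))"

lemma vars_perm_T_V: "\<tau> \<in> G \<Longrightarrow> vars p \<subseteq> V \<Longrightarrow> vars (perm_T \<tau> p) \<subseteq> V"
  unfolding perm_T_def
proof (rule vars_poly_subst)
  fix v assume \<tau>: "\<tau> \<in> G" and v: "vars p \<subseteq> V" "v \<in> vars p"
  then have "v \<in> V"
    by blast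
  then show "vars (case v of T a \<Rightarrow> Var (T (\<tau> a)) | _ \<Rightarrow> Var v) \<subseteq> V"
    using permutes_in_image[of \<tau> "{1..n}"] \<tau> by (cases v) (auto simp: V_def G_def)
qed

lemma avg_carrier: "avg p \<in> carrier C"
proof -
  have "vars (avg p) \<subseteq> V"
    unfolding avg_def by (intro vars_sum vars_perm_T_V vars_restrict_vars)
  moreover have "perm_T \<sigma> (avg p) = avg p" if "\<sigma> \<in> G" for \<sigma>
  proof -
    have "(\<circ>) \<sigma> ` G = G"
      using that by (intro endo_inj_surj finite_G inj_compose_G) (auto intro: compose_G)
    then have "avg p = (\<Sum>\<tau>\<in>(\<circ>) \<sigma> ` G. perm_T \<tau> (restrict_vars V p))"
      unfolding avg_def by (simp only:)
    also have "\<dots> = (\<Sum>\<tau>\<in>G. perm_T (\<sigma> \<circ> \<tau>) (restrict_vars V p))"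
      unfolding sum.reindex[OF inj_compose_G[OF that]] by (intro sum.cong refl) simp
    also have "\<dots> = perm_T \<sigma> (avg p)"
      by (simp add: avg_def perm_T_perm_T)
    finally show ?thesis ..
  qed
  ultimately show ?thesis
    by (simp add: carrier_iff)
qed

lemma avg_mult: "p \<in> carrier C \<Longrightarrow> avg (q * p) = avg q * p"
  unfolding avg_def sum_distrib_right restrict_vars_mult
  by (intro sum.cong refl) (simp add: carrier_iff restrict_vars_id[of p])

lemma avg_add: "avg (p + q) = avg p + avg q"
  by (simp add: avg_def restrict_vars_def sum.distrib)

lemma avg_0: "avg 0 = 0"
  by (simp add: avg_def restrict_vars_def)

lemma avg_1: "avg 1 = of_nat (card G)"
  by (simp add: avg_def restrict_vars_def)

lemma card_G: "card G \<noteq> 0"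
  using finite_G id_G by auto

lemma Const_card_G: "Const (1 / of_nat (card G)) * of_nat (card G) = 1"
  using card_G by (simp only: single_of_nat[symmetric] mult_single) simp

lemma esym_esum: "esym n m x = esum {1..n} m x"
  by (simp add: esym_def esum_def)

lemma esum_perm_T:
  assumes "\<tau> \<in> G"
  shows "perm_T \<tau> (esum {1..n} m (\<lambda>a. Var (T a))) = esum {1..n} m (\<lambda>a. Var (T a))"
proof -
  have "bij_betw \<tau> {1..n} {1..n}"
    using assms by (auto simp: G_def permutes_imp_bij)
  from esum_bij[OF this, of m "\<lambda>a. Var (T a)"] show ?thesis
    by (simp add: esum_def)
qed

lemma relations_carrier: "chern_relations {1..n} {1..n} \<subseteq> carrier C"
proof -
  have "vars (esum {1..n} m x) \<subseteq> V" if "\<And>a. a \<in> {1..n} \<Longrightarrow> vars (x a) \<subseteq> V" for m x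
    unfolding esum_def using that by (intro vars_sum vars_prod) blast
  then have "vars (esum {1..n} m (\<lambda>a. Var (T a))) \<subseteq> V" "vars (esum {1..n} m (\<lambda>a. Var (Z a))) \<subseteq> V" for m
    by (auto simp: V_def)
  moreover have "perm_T \<tau> (esum {1..n} m (\<lambda>a. Var (Z a))) = esum {1..n} m (\<lambda>a. Var (Z a))" for m \<tau>
    by (simp add: esum_def)
  ultimately have "esum {1..n} m (\<lambda>a. Var (T a)) \<in> carrier C" "esum {1..n} m (\<lambda>a. Var (Z a)) \<in> carrier C" for m
    unfolding carrier_iff by (blast intro: esum_perm_T)+
  then have "esum {1..n} m (\<lambda>a. Var (T a)) + - esum {1..n} m (\<lambda>a. Var (Z a)) \<in> carrier C" for m
    by (intro carrier_closed)
  then show ?thesis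
    by (auto simp: chern_relations_def)
qed

lemma gens_subset:
  "{esym n m (\<lambda>a. Var (T a)) - esym n m (\<lambda>b. Var (Z b)) |m. m \<in> {1..n}} \<subseteq> chern_relations {1..n} {1..n}"
  by (auto simp: chern_relations_def esym_esum)

sublocale ideal K C
  unfolding K_def using gens_subset relations_carrier by (intro genideal_ideal) blast

lemma relations_K: "chern_relations {1..n} {1..n} \<subseteq> K"
proof
  fix g assume "g \<in> chern_relations {1..n} {1..n}"
  then obtain m where g: "g = esum {1..n} m (\<lambda>a. Var (T a)) - esum {1..n} m (\<lambda>b. Var (Z b))"
    by (auto simp: chern_relations_def)
  show "g \<in> K"
  proof (cases "m \<in> {1..n}")
    case True
    moreover have "{esym n m (\<lambda>a. Var (T a)) - esym n m (\<lambda>b. Var (Z b)) |m. m \<in> {1..n}} \<subseteq> K"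
      unfolding K_def using gens_subset relations_carrier by (intro genideal_self) blast
    ultimately show ?thesis
      unfolding g esym_esum by blast
  next
    case False
    then have "m = 0 \<or> n < m"
      by auto
    then have "g = 0"
      unfolding g by (auto simp: esum_0 esum_eq_0)
    then show ?thesis
      using zero_closed by simp
  qed
qed

text \<open>The generators are invariant, so averaging acts on coefficients alone and makes them
  invariant. The free multiplier \<open>q\<close> absorbs the factors of the rule
  \<open>mult\<close>.\<close>

lemma avg_ideal_span:
  assumes "p \<in> ideal_span (chern_relations {1..n} {1..n})"
  shows "avg (q * p) \<in> K"
  using assms
proof (induction arbitrary: q)
  case zero
  show ?case
    using zero_closed by (simp add: avg_0)
next
  case (gen g)
  then have "avg q * g \<in> K"
    using I_l_closed[of g "avg q"] relations_K avg_carrier by auto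
  then show ?case
    using gen relations_carrier by (simp add: avg_mult subset_eq)
next
  case (add p p')
  then show ?case
    using a_closed by (simp add: ring_distribs avg_add)
next
  case (mult p q')
  then show ?case
    by (simp add: mult.assoc[symmetric])
qed

section \<open>Fixed points as cosets of permutations\<close>

definition enum :: "nat set \<Rightarrow> nat \<Rightarrow> nat" where
  "enum J a = (if a \<le> k then nth_smallest J a else nth_smallest ({1..n} - J) (a - k))"

lemma ksubsetsD: "J \<in> ksubsets k n \<Longrightarrow> J \<subseteq> {1..n} \<and> finite J \<and> card J = k"
  by (auto simp: ksubsets_def intro: finite_subset)

lemma bij_enum:
  assumes J: "J \<in> ksubsets k n"
  shows "bij_betw (enum J) {1..n} {1..n}" "bij_betw (enum J) {1..k} J"
proof -
  note J = ksubsetsD[OF J]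
  have 1: "bij_betw (enum J) {1..k} J"
    using bij_nth_smallest[of J] J by (subst bij_betw_cong[where g = "nth_smallest J"]) (auto simp: enum_def)
  have "bij_betw (\<lambda>a. a - k) {k<..n} {1..n - k}"
    by (rule bij_betw_byWitness[where f' = "\<lambda>a. a + k"]) auto
  moreover have "card ({1..n} - J) = n - k"
    using J by (simp add: card_Diff_subset)
  ultimately have "bij_betw (nth_smallest ({1..n} - J) \<circ> (\<lambda>a. a - k)) {k<..n} ({1..n} - J)"
    using bij_nth_smallest[of "{1..n} - J"] by (intro bij_betw_trans) auto
  then have "bij_betw (enum J) {k<..n} ({1..n} - J)"
    by (subst bij_betw_cong[where g = "nth_smallest ({1..n} - J) \<circ> (\<lambda>a. a - k)"])
      (auto simp: enum_def)
  with 1 have "bij_betw (enum J) ({1..k} \<union> {k<..n}) (J \<union> ({1..n} - J))"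
    by (intro bij_betw_combine) auto
  moreover have "{1..k} \<union> {k<..n} = {1..n}" "J \<union> ({1..n} - J) = {1..n}"
    using k_le_n J by auto
  ultimately show "bij_betw (enum J) {1..n} {1..n}"
    by simp
  show "bij_betw (enum J) {1..k} J"
    by (rule 1)
qed

lemma fixed_point_subst_eq:
  assumes J: "J \<in> ksubsets k n" and p: "vars p \<subseteq> V"
  shows "fixed_point_subst n J p = T_subst {1..n} (enum J) p"
  unfolding fixed_point_subst_def T_subst_def
proof (rule poly_subst_cong_vars)
  fix v assume "v \<in> vars p"
  then show "(case v of T a \<Rightarrow> if a \<le> card J then Var (Z (nth_smallest J a))
        else Var (Z (nth_smallest ({1..n} - J) (a - card J))) | _ \<Rightarrow> Var v)
      = (case v of T a \<Rightarrow> if a \<in> {1..n} then Var (Z (enum J a)) else Var (T a) | _ \<Rightarrow> Var v)"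
    using p ksubsetsD[OF J] by (cases v) (auto simp: V_def enum_def)
qed

lemma T_subst_perm_T:
  assumes "\<tau> \<in> G"
  shows "T_subst {1..n} w (perm_T \<tau> p) = T_subst {1..n} (w \<circ> \<tau>) p"
proof -
  define A where "A = {1..n}"
  have \<tau>: "\<tau> permutes A"
    using assms by (simp add: G_def A_def)
  show ?thesis
    unfolding T_subst_def perm_T_def poly_subst_poly_subst A_def[symmetric]
    using permutes_in_image[OF \<tau>] permutes_not_in[OF \<tau>]
    by (intro poly_subst_cong_vars) (simp split: var.split)
qed

text \<open>The coset decomposition of \<open>S_n\<close> by \<open>G\<close>: a coset is recorded
  by the image of \<open>{1..k}\<close>, and \<open>enum\<close> is its representative increasing on
  both blocks.\<close>

lemma enum_G:
  assumes w: "bij_betw w {1..n} {1..n}"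
  obtains \<rho> where "\<rho> \<in> G" "w ` {1..k} \<in> ksubsets k n"
    "\<And>a. a \<in> {1..n} \<Longrightarrow> w a = enum (w ` {1..k}) (\<rho> a)"
proof -
  let ?J = "w ` {1..k}"
  have inj: "inj_on w {1..n}" and im: "w ` {1..n} = {1..n}"
    using w by (auto simp: bij_betw_def)
  have k: "{1..k} \<subseteq> {1..n}"
    using k_le_n by auto
  have J: "?J \<in> ksubsets k n"
    using card_image[OF inj_on_subset[OF inj k]] image_mono[OF k, of w] im by (simp add: ksubsets_def)
  note e = bij_enum[OF J]
  define \<rho> where "\<rho> a = (if a \<in> {1..n} then inv_into {1..n} (enum ?J) (w a) else a)" for a
  have e\<rho>: "enum ?J (\<rho> a) = w a" if "a \<in> {1..n}" for a
    using that im e(1) by (auto simp: \<rho>_def bij_betw_def intro!: f_inv_into_f)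
  have "bij_betw (inv_into {1..n} (enum ?J) \<circ> w) {1..n} {1..n}"
    by (rule bij_betw_trans[OF w bij_betw_inv_into[OF e(1)]])
  then have "bij_betw \<rho> {1..n} {1..n}"
    by (subst bij_betw_cong[where g = "inv_into {1..n} (enum ?J) \<circ> w"]) (auto simp: \<rho>_def)
  then have perm: "\<rho> permutes {1..n}"
    by (rule bij_imp_permutes) (auto simp: \<rho>_def)
  have "enum ?J ` (\<rho> ` {1..k}) = w ` {1..k}"
    unfolding image_image using e\<rho> k by (intro image_cong) auto
  then have "enum ?J ` (\<rho> ` {1..k}) = enum ?J ` {1..k}"
    using e(2) by (simp add: bij_betw_def)
  moreover have "\<rho> ` {1..k} \<subseteq> {1..n}"
    using image_mono[OF k, of \<rho>] permutes_image[OF perm] by simp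
  ultimately have "\<rho> ` {1..k} = {1..k}"
    using inj_on_image_eq_iff[OF bij_betw_imp_inj_on[OF e(1)] _ k] by blast
  with perm have "\<rho> \<in> G"
    by (simp add: G_def)
  with J e\<rho> show ?thesis
    by (intro that) auto
qed

text \<open>An invariant polynomial takes the same value on a whole coset, so the flag fixed points
  yield nothing beyond the Grassmannian ones below them.\<close>

lemma T_subst_carrier:
  assumes w: "bij_betw w {1..n} {1..n}" and p: "p \<in> carrier C"
  shows "w ` {1..k} \<in> ksubsets k n"
    "T_subst {1..n} w p = fixed_point_subst n (w ` {1..k}) p"
proof -
  obtain \<rho> where \<rho>: "\<rho> \<in> G" and J: "w ` {1..k} \<in> ksubsets k n"
    and w\<rho>: "\<And>a. a \<in> {1..n} \<Longrightarrow> w a = enum (w ` {1..k}) (\<rho> a)"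
    using enum_G[OF w] by blast
  show "w ` {1..k} \<in> ksubsets k n"
    by (rule J)
  have "T_subst {1..n} w p = T_subst {1..n} (enum (w ` {1..k}) \<circ> \<rho>) p"
    by (rule T_subst_cong) (simp add: w\<rho>)
  also have "\<dots> = T_subst {1..n} (enum (w ` {1..k})) p"
    using p \<rho> T_subst_perm_T[OF \<rho>, of "enum (w ` {1..k})" p] by (simp add: carrier_iff)
  finally show "T_subst {1..n} w p = fixed_point_subst n (w ` {1..k}) p"
    using fixed_point_subst_eq[OF J] p by (simp add: carrier_iff)
qed

lemma fixed_point_subst_diff:
  "fixed_point_subst m J (p - q) = fixed_point_subst m J p - fixed_point_subst m J q"
  by (simp add: fixed_point_subst_def)

lemma fixed_point_subst_add:
  "fixed_point_subst m J (p + q) = fixed_point_subst m J p + fixed_point_subst m J q"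
  by (simp add: fixed_point_subst_def)

lemma fixed_point_subst_uminus: "fixed_point_subst m J (- p) = - fixed_point_subst m J p"
  by (simp add: fixed_point_subst_def)

text \<open>Vanishing polynomials form an ideal containing the relations. Conversely, vanishing at
  the fixed points means vanishing at all permutations, so \<open>p\<close> is a combination of
  relations with arbitrary coefficients, and averaging makes these invariant.\<close>

lemma K_iff:
  assumes p: "p \<in> carrier C"
  shows "p \<in> K \<longleftrightarrow> (\<forall>J\<in>ksubsets k n. fixed_point_subst n J p = 0)"
proof
  let ?N = "{p \<in> carrier C. \<forall>J\<in>ksubsets k n. fixed_point_subst n J p = 0}"
  have "ideal ?N C"
  proof (rule idealI)
    show "ring C"
      by (rule ring_axioms)
    have "subgroup ?N (add_monoid C)"
    proof (rule add.subgroupI)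
      show "?N \<noteq> {}"
        using carrier_0_1 by (auto simp: fixed_point_subst_def)
      fix x assume x: "x \<in> ?N"
      have "\<ominus>\<^bsub>C\<^esub> x = - x"
        using x carrier_closed(3)[of x x] by (intro minus_equality) auto
      then show "\<ominus>\<^bsub>C\<^esub> x \<in> ?N"
        using x carrier_closed(3)[of x x] by (simp add: fixed_point_subst_uminus)
    qed (auto intro: carrier_closed simp: fixed_point_subst_add)
    then show "subgroup ?N (add_monoid C)" .
  qed (auto intro: carrier_closed simp: fixed_point_subst_def)
  moreover have "chern_relations {1..n} {1..n} \<subseteq> ?N"
  proof
    fix g assume g: "g \<in> chern_relations {1..n} {1..n}"
    then have gC: "g \<in> carrier C"
      using relations_carrier by blast
    have "fixed_point_subst n J g = 0" if "J \<in> ksubsets k n" for J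
      using that gC T_subst_relation[OF bij_enum(1)[OF that] ideal_span.gen[OF g]]
      by (simp add: fixed_point_subst_eq carrier_iff)
    with gC show "g \<in> ?N"
      by blast
  qed
  ultimately have "K \<subseteq> ?N"
    unfolding K_def using gens_subset by (intro genideal_minimal) (simp_all add: subset_trans)
  then show "\<forall>J\<in>ksubsets k n. fixed_point_subst n J p = 0" if "p \<in> K"
    using that by blast
next
  assume zero: "\<forall>J\<in>ksubsets k n. fixed_point_subst n J p = 0"
  have "p \<in> ideal_span (chern_relations {1..n} {1..n})"
  proof (rule vanishing_ideal_of_flags)
    fix w assume "bij_betw w {1..n} {1..n}"
    from T_subst_carrier[OF this p] zero show "T_subst {1..n} w p = 0"
      by simp
  qed simp_all
  from avg_ideal_span[OF this, of 1] have "avg 1 * p \<in> K"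
    using avg_mult[OF p, of 1] by simp
  \<comment> \<open>As \<open>p\<close> is invariant, its average is \<open>card G\<close> times
    \<open>p\<close>.\<close>
  then have "Const (1 / of_nat (card G)) * (avg 1 * p) \<in> K"
    using I_l_closed[of _ "Const (1 / of_nat (card G))"] Const_carrier by simp
  moreover have "Const (1 / of_nat (card G)) * avg 1 = 1"
    by (simp only: avg_1 Const_card_G)
  ultimately show "p \<in> K"
    by (simp add: mult.assoc[symmetric])
qed

lemma HT_Gr_alt: "HT_Gr k n = C Quot K"
  by (simp add: HT_Gr_def K_def)

lemma carrier_HT_Gr: "carrier (HT_Gr k n) = (\<lambda>p. K +>\<^bsub>C\<^esub> p) ` carrier C"
  by (auto simp: HT_Gr_alt FactRing_def A_RCOSETS_def')

lemma coset_eq: "K +>\<^bsub>C\<^esub> p = (\<lambda>h. h + p) ` K"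
  by (auto simp: a_r_coset_def')

lemma restrict_coset:
  assumes p: "p \<in> carrier C" and J: "J \<in> ksubsets k n"
  shows "restrict_class n (K +>\<^bsub>C\<^esub> p) J = fixed_point_subst n J p"
proof -
  have "fixed_point_subst n J h = 0" if "h \<in> K" for h
    using that J K_iff[of h] Icarr by blast
  then have "fixed_point_subst n J ` (K +>\<^bsub>C\<^esub> p) = (\<lambda>h. fixed_point_subst n J p) ` K"
    unfolding coset_eq image_image by (intro image_cong) (simp_all add: fixed_point_subst_add)
  also have "\<dots> = {fixed_point_subst n J p}"
    using zero_closed by (intro image_constant)
  finally show ?thesis
    by (simp add: restrict_class_def)
qed

theorem class_eqI:
  assumes \<kappa>: "\<kappa> \<in> carrier (HT_Gr k n)" and \<kappa>': "\<kappa>' \<in> carrier (HT_Gr k n)"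
    and eq: "\<And>J. J \<in> ksubsets k n \<Longrightarrow> restrict_class n \<kappa> J = restrict_class n \<kappa>' J"
  shows "\<kappa> = \<kappa>'"
proof -
  obtain p q where p: "p \<in> carrier C" "\<kappa> = K +>\<^bsub>C\<^esub> p" and q: "q \<in> carrier C" "\<kappa>' = K +>\<^bsub>C\<^esub> q"
    using \<kappa> \<kappa>' by (auto simp: carrier_HT_Gr)
  have "p + - q \<in> carrier C"
    using p q by (intro carrier_closed)
  then have pq: "p - q \<in> carrier C"
    by simp
  have "p - q \<in> K"
    unfolding K_iff[OF pq] using eq p q by (simp add: restrict_coset fixed_point_subst_diff)
  then have "p \<in> K +>\<^bsub>C\<^esub> q"
    unfolding coset_eq by (intro image_eqI[of _ _ "p - q"]) auto
  then show ?thesis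
    using p q a_repr_independence' by blast
qed

theorem class_exists:
  assumes vars_F: "\<And>J. J \<in> ksubsets k n \<Longrightarrow> vars (F J) \<subseteq> insert Hbar (Z ` {1..n})"
    and hom_F: "\<And>J. J \<in> ksubsets k n \<Longrightarrow> homogeneous d (F J)"
    and gkm: "\<And>i j J. J \<in> ksubsets k n \<Longrightarrow> i \<in> {1..n} \<Longrightarrow> j \<in> {1..n} \<Longrightarrow> i \<noteq> j \<Longrightarrow>
      (Var (Z i) - Var (Z j)) dvd F J - F (transpose i j ` J)"
  shows "\<exists>\<kappa>\<in>carrier (HT_Gr k n). homogeneous_class d \<kappa> \<and>
    (\<forall>J\<in>ksubsets k n. restrict_class n \<kappa> J = F J)"
proof -
  have ks: "w ` {1..k} \<in> ksubsets k n" if "bij_betw w {1..n} {1..n}" for w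
    using T_subst_carrier(1)[OF that carrier_0_1(1)] .
  have "\<exists>p. \<forall>w. kill_T (T_subst {1..n} w p) = T_subst {1..n} w p \<and>
      (bij_betw w {1..n} {1..n} \<longrightarrow> T_subst {1..n} w p = F (w ` {1..k}))"
  proof (rule flag_interpolation)
    fix w w' :: "nat \<Rightarrow> nat" assume "\<And>s. s \<in> {1..n} \<Longrightarrow> w s = w' s"
    then have "w ` {1..k} = w' ` {1..k}"
      using k_le_n by (intro image_cong) auto
    then show "F (w ` {1..k}) = F (w' ` {1..k})"
      by simp
  next
    fix w assume w: "bij_betw w {1..n} {1..n}"
    show "kill_T (F (w ` {1..k})) = F (w ` {1..k})"
      unfolding kill_T_def using vars_F[OF ks[OF w]]
      by (subst poly_subst_cong_vars[where g = Var]) (auto split: var.split)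
  next
    fix w i j assume w: "bij_betw w {1..n} {1..n}" and ij: "i \<in> {1..n}" "j \<in> {1..n}" "i \<noteq> (j::nat)"
    show "(Var (Z i) - Var (Z j)) dvd F (w ` {1..k}) - F ((transpose i j \<circ> w) ` {1..k})"
      using gkm[OF ks[OF w] ij] by (simp add: image_comp)
  qed auto
  then obtain p where p: "\<And>w. bij_betw w {1..n} {1..n} \<Longrightarrow> T_subst {1..n} w p = F (w ` {1..k})"
    by auto
  define q where "q = Const (1 / of_nat (card G)) * hcomp d (avg p)"
  have "hcomp d (avg p) \<in> carrier C"
    using avg_carrier[of p] vars_hcomp[of d "avg p"] by (auto simp: carrier_iff perm_T_hcomp)
  then have q: "q \<in> carrier C"
    unfolding q_def by (intro carrier_closed Const_carrier)
  have "homogeneous (0 + d) q"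
    unfolding q_def by (intro homogeneous_mult homogeneous_hcomp homogeneous_Const)
  then have hom_q: "homogeneous d q"
    by simp
  have q_J: "fixed_point_subst n J q = F J" if J: "J \<in> ksubsets k n" for J
  proof -
    let ?w = "enum J"
    \<comment> \<open>Precomposition with \<tau> only permutes \<open>{1..k}\<close>, so each of the
      \<open>card G\<close> terms of the average restricts to \<open>F J\<close>.\<close>
    have T: "T_subst {1..n} ?w (perm_T \<tau> (restrict_vars V p)) = F J" if \<tau>: "\<tau> \<in> G" for \<tau>
    proof -
      have "bij_betw \<tau> {1..n} {1..n}" and im: "\<tau> ` {1..k} = {1..k}"
        using \<tau> by (auto simp: G_def permutes_imp_bij)
      then have w: "bij_betw (?w \<circ> \<tau>) {1..n} {1..n}"
        using bij_enum(1)[OF J] by (intro bij_betw_trans)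
      then have mem: "(?w \<circ> \<tau>) a \<in> {1..n}" if "a \<in> {1..n}" for a
        using that by (rule bij_betw_apply)
      have "(?w \<circ> \<tau>) ` {1..k} = ?w ` {1..k}"
        unfolding image_comp[symmetric] im ..
      then have J': "(?w \<circ> \<tau>) ` {1..k} = J"
        using bij_enum(2)[OF J] by (simp add: bij_betw_def)
      have "T_subst {1..n} ?w (perm_T \<tau> (restrict_vars V p))
          = T_subst {1..n} (?w \<circ> \<tau>) (restrict_vars V p)"
        by (rule T_subst_perm_T[OF \<tau>])
      \<comment> \<open>The two substitutions commute because the substituted parameters lie in
        \<open>V\<close>.\<close>
      also have "\<dots> = restrict_vars V (T_subst {1..n} (?w \<circ> \<tau>) p)"
        unfolding T_subst_def restrict_vars_def poly_subst_poly_subst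
        using mem by (intro poly_subst_cong_vars) (auto split: var.split simp: V_def)
      also have "\<dots> = restrict_vars V (F J)"
        using p[OF w] J' by simp
      also have "\<dots> = F J"
        using vars_F[OF J] by (intro restrict_vars_id) (auto simp: V_def)
      finally show ?thesis .
    qed
    have "T_subst {1..n} ?w (avg p) = of_nat (card G) * F J"
      unfolding avg_def T_subst_simps using sum.cong[OF refl T] by simp
    also have "\<dots> = Const (of_nat (card G)) * F J"
      by simp
    finally have avg: "T_subst {1..n} ?w (avg p) = Const (of_nat (card G)) * F J" .
    have "homogeneous (0 + d) (Const (of_nat (card G)) * F J)"
      by (intro homogeneous_mult hom_F J homogeneous_Const)
    then have "T_subst {1..n} ?w (hcomp d (avg p)) = Const (of_nat (card G)) * F J"
      unfolding T_subst_hcomp avg by (subst hcomp_homogeneous) auto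
    then have "T_subst {1..n} ?w q = Const (1 / of_nat (card G)) * of_nat (card G) * F J"
      unfolding q_def by (simp add: T_subst_def mult.assoc)
    also have "\<dots> = F J"
      by (simp only: Const_card_G mult_1_left)
    finally show ?thesis
      using fixed_point_subst_eq[OF J] q by (simp add: carrier_iff)
  qed
  show ?thesis
  proof (intro bexI[of _ "K +>\<^bsub>C\<^esub> q"] conjI ballI)
    show "K +>\<^bsub>C\<^esub> q \<in> carrier (HT_Gr k n)"
      unfolding carrier_HT_Gr using q by blast
    have "0 + q \<in> K +>\<^bsub>C\<^esub> q"
      unfolding coset_eq using zero_closed by (intro imageI) simp
    then show "homogeneous_class d (K +>\<^bsub>C\<^esub> q)"
      unfolding homogeneous_class_def using hom_q by (intro bexI[of _ q]) simp_all
    show "restrict_class n (K +>\<^bsub>C\<^esub> q) J = F J" if "J \<in> ksubsets k n" for J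
      using restrict_coset[OF q that] q_J[OF that] by simp
  qed
qed

end

section \<open>The restrictions of the weight functions\<close>

lemma prod_nonzero: "(\<And>x. x \<in> A \<Longrightarrow> f x \<noteq> (0::'a::idom)) \<Longrightarrow> prod f A \<noteq> 0"
  by (cases "finite A") (auto simp: prod_zero_iff)

text \<open>The case \<open>i = j\<close> is included: it arises when two parameters are identified,
  and \<hbar> keeps the weight alive.\<close>

lemma weight_nonzero: "Var (Z i) - Var (Z j) + Var Hbar \<noteq> 0"
proof
  assume "Var (Z i) - Var (Z j) + Var Hbar = 0"
  then have "poly_subst (\<lambda>v. if v = Hbar then 1 else 0) (Var (Z i) - Var (Z j) + Var Hbar) = 0"
    by (simp only: poly_subst_0)
  then show False
    by simp
qed

lemma U_den_nonzero:
  "U_den r k n (\<lambda>b. Var (Z (f b))) (\<lambda>a. Var (Z (g a))) (Var Hbar) \<noteq> 0"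
  by (cases r) (auto intro!: prod_nonzero weight_nonzero simp del: prod_zero_iff)

lemma U_num_cong:
  assumes "I \<in> ksubsets k n" "\<And>a. a \<in> {1..k} \<Longrightarrow> t a = t' a" "\<And>b. b \<in> {1..n} \<Longrightarrow> z b = z' b"
  shows "U_num r k n I z t h = U_num r k n I z' t' h"
proof -
  have I: "finite I" "card I = k" "I \<subseteq> {1..n}"
    using assms(1) by (auto simp: ksubsets_def intro: finite_subset)
  have i: "1 \<le> nth_smallest I a \<and> nth_smallest I a \<le> n" if "a \<in> {1..k}" for a
    using nth_smallest_mem[of I a] I that by auto
  have 1: "(\<Prod>a\<in>{1..k}. (\<Prod>b\<in>{1..<nth_smallest I a}. t a - z b + h) * (\<Prod>b\<in>{nth_smallest I a<..n}. z b - t a))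
      = (\<Prod>a\<in>{1..k}. (\<Prod>b\<in>{1..<nth_smallest I a}. t' a - z' b + h) * (\<Prod>b\<in>{nth_smallest I a<..n}. z' b - t' a))"
    using i by (intro prod.cong refl arg_cong2[of _ _ _ _ "(*)"]) (fastforce simp: assms(2,3))+
  have 2: "(\<Prod>a\<in>{1..k}. (\<Prod>b\<in>{1..<nth_smallest I a}. z b - t a + h) * (\<Prod>b\<in>{nth_smallest I a<..n}. z b - t a))
      = (\<Prod>a\<in>{1..k}. (\<Prod>b\<in>{1..<nth_smallest I a}. z' b - t' a + h) * (\<Prod>b\<in>{nth_smallest I a<..n}. z' b - t' a))"
    using i by (intro prod.cong refl arg_cong2[of _ _ _ _ "(*)"]) (fastforce simp: assms(2,3))+
  have 3: "(\<Prod>a\<in>{1..k}. \<Prod>b\<in>{a<..k}. t b - t a + h) = (\<Prod>a\<in>{1..k}. \<Prod>b\<in>{a<..k}. t' b - t' a + h)"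
    by (intro prod.cong refl) (simp add: assms(2))
  have 4: "(\<Prod>a\<in>{1..n}. \<Prod>b\<in>{a<..n}. z b - z a + h) = (\<Prod>a\<in>{1..n}. \<Prod>b\<in>{a<..n}. z' b - z' a + h)"
    by (intro prod.cong refl) (simp add: assms(3))
  show ?thesis
    by (cases r) (simp_all only: U_num.simps 1 2 3 4)
qed

lemma U_den_cong:
  assumes "\<And>a. a \<in> {1..k} \<Longrightarrow> t a = t' a" "\<And>b. b \<in> {1..n} \<Longrightarrow> z b = z' b"
  shows "U_den r k n z t h = U_den r k n z' t' h"
proof -
  have 1: "(\<Prod>a\<in>{1..k}. \<Prod>b\<in>{a<..k}. t b - t a + h) = (\<Prod>a\<in>{1..k}. \<Prod>b\<in>{a<..k}. t' b - t' a + h)"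
    by (intro prod.cong refl) (simp add: assms(1))
  have 2: "(\<Prod>a\<in>{1..k}. \<Prod>b\<in>{1..n}. z b - t a + h) = (\<Prod>a\<in>{1..k}. \<Prod>b\<in>{1..n}. z' b - t' a + h)"
    by (intro prod.cong refl) (simp add: assms)
  show ?thesis
    by (cases r) (simp_all only: U_den.simps 1 2)
qed

lemma vandermonde_cong:
  "(\<And>a. a \<in> {1..k} \<Longrightarrow> t a = t' a) \<Longrightarrow> vandermonde k t = vandermonde k t'"
  unfolding vandermonde_def by (intro prod.cong refl) simp

lemma hor_dvd_U_num:
  "(\<Prod>a\<in>{1..k}. \<Prod>b\<in>{nth_smallest I a<..n}. z b - t a) dvd U_num r k n I z t h"
  by (cases r) (simp_all add: prod.distrib)

lemma two_choose_two: "2 * (m choose 2) + m = m * m"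
  by (induction m) (simp_all add: numeral_2_eq_2)

lemma homogeneous_prod_linear:
  "finite A \<Longrightarrow> (\<And>x. x \<in> A \<Longrightarrow> homogeneous 1 (f x)) \<Longrightarrow> homogeneous (card A) (prod f A)"
  using homogeneous_prod[of A "\<lambda>_. 1" f] by simp

lemma sum_diff_choose_two: "(\<Sum>a\<in>{1..m}. m - a) = m choose 2"
proof (induction m)
  case (Suc m)
  have "(\<Sum>a\<in>{1..Suc m}. Suc m - a) = (\<Sum>a\<in>{1..m}. (m - a) + 1)"
    by (simp, intro sum.cong refl) auto
  also have "\<dots> = (m choose 2) + m"
    by (simp only: sum.distrib Suc) simp
  finally show ?case
    by (simp add: numeral_2_eq_2)
qed simp

lemma homogeneous_prod_pairs:
  assumes "\<And>a b. homogeneous 1 (f a b)"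
  shows "homogeneous (m choose 2) (\<Prod>a\<in>{1..m}. \<Prod>b\<in>{a<..m}. f a b)"
proof -
  have "homogeneous (\<Sum>a\<in>{1..m}. card {a<..m}) (\<Prod>a\<in>{1..m}. \<Prod>b\<in>{a<..m}. f a b)"
    by (intro homogeneous_prod homogeneous_prod_linear assms) simp
  then show ?thesis
    by (simp add: sum_diff_choose_two[simplified])
qed

fun den_degree :: "flavour \<Rightarrow> nat \<Rightarrow> nat \<Rightarrow> nat" where
  "den_degree R00 k n = k choose 2"
| "den_degree R10 k n = 0"
| "den_degree R01 k n = k * n"
| "den_degree R11 k n = k * n"

lemma homogeneous_U_den:
  assumes "\<And>b. homogeneous 1 (z b)" "\<And>a. homogeneous 1 (t a)" "homogeneous 1 h"
  shows "homogeneous (den_degree r k n) (U_den r k n z t h)"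
proof -
  have "homogeneous (k choose 2) (\<Prod>a\<in>{1..k}. \<Prod>b\<in>{a<..k}. t b - t a + h)"
    by (intro homogeneous_prod_pairs homogeneous_add homogeneous_diff assms)
  moreover have "homogeneous (\<Sum>a\<in>{1..k}. card {1..n}) (\<Prod>a\<in>{1..k}. \<Prod>b\<in>{1..n}. z b - t a + h)"
    by (intro homogeneous_prod homogeneous_prod_linear homogeneous_add homogeneous_diff assms) simp
  ultimately show ?thesis
    by (cases r) simp_all
qed

text \<open>The root of index \<open>a\<close> meets every parameter except the one at position
  \<open>i_a\<close>, which accounts for \<open>k * (n - 1)\<close> factors. The degree is stated as
  a sum of three so that cancelling \<open>U_den\<close> and then the Vandermonde product leaves
  \<open>env_degree\<close>.\<close>

lemma homogeneous_U_num:
  assumes "I \<in> ksubsets k n" "k \<le> n"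
    and lin: "\<And>b. homogeneous 1 (z b)" "\<And>a. homogeneous 1 (t a)" "homogeneous 1 h"
  shows "homogeneous (env_degree r k n + (k choose 2) + den_degree r k n) (U_num r k n I z t h)"
proof -
  have I: "finite I" "card I = k" "I \<subseteq> {1..n}"
    using assms(1) by (auto simp: ksubsets_def intro: finite_subset)
  have i: "card {1..<nth_smallest I a} + card {nth_smallest I a<..n} = n - 1" if "a \<in> {1..k}" for a
    using nth_smallest_mem[of I a] I that by auto
  have sum: "(\<Sum>a\<in>{1..k}. card {1..<nth_smallest I a} + card {nth_smallest I a<..n}) = k * (n - 1)"
  proof -
    have "(\<Sum>a\<in>{1..k}. card {1..<nth_smallest I a} + card {nth_smallest I a<..n}) = (\<Sum>a\<in>{1..k}. n - 1)"
      by (rule sum.cong[OF refl i])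
    then show ?thesis
      by simp
  qed
  have 1: "homogeneous (k * (n - 1)) (\<Prod>a\<in>{1..k}. (\<Prod>b\<in>{1..<nth_smallest I a}. t a - z b + h) * (\<Prod>b\<in>{nth_smallest I a<..n}. z b - t a))"
    unfolding sum[symmetric]
    by (intro homogeneous_prod homogeneous_mult homogeneous_prod_linear homogeneous_add homogeneous_diff lin) simp_all
  have 2: "homogeneous (k * (n - 1)) (\<Prod>a\<in>{1..k}. (\<Prod>b\<in>{1..<nth_smallest I a}. z b - t a + h) * (\<Prod>b\<in>{nth_smallest I a<..n}. z b - t a))"
    unfolding sum[symmetric]
    by (intro homogeneous_prod homogeneous_mult homogeneous_prod_linear homogeneous_add homogeneous_diff lin) simp_all
  have 3: "homogeneous (k choose 2) (\<Prod>a\<in>{1..k}. \<Prod>b\<in>{a<..k}. t b - t a + h)"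
    by (intro homogeneous_prod_pairs homogeneous_add homogeneous_diff lin)
  have 4: "homogeneous (n choose 2) (\<Prod>a\<in>{1..n}. \<Prod>b\<in>{a<..n}. z b - z a + h)"
    by (intro homogeneous_prod_pairs homogeneous_add homogeneous_diff lin)
  have 5: "homogeneous k (h ^ k)"
    using homogeneous_power[OF lin(3), of k] by simp
  \<comment> \<open>Writing \<open>n = k + m\<close> removes the truncated subtraction from the
    degree identities.\<close>
  obtain m where n: "n = k + m"
    using assms(2) le_Suc_ex by blast
  have kn: "k * (n - 1) + k = k * n"
    by (cases k; cases n) (simp_all add: n)
  have binom: "n choose 2 = (k choose 2) + (m choose 2) + k * m"
    using two_choose_two[of n] two_choose_two[of k] two_choose_two[of m] by (simp add: n algebra_simps)
  have k2: "k * n = k * m + 2 * (k choose 2) + k"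
    using two_choose_two[of k] by (simp add: n algebra_simps)
  show ?thesis
  proof (cases r)
    case R00
    have "env_degree r k n + (k choose 2) + den_degree r k n = k * (n - 1)"
      using kn k2 by (simp add: R00 n)
    then show ?thesis
      using 1 by (simp add: R00)
  next
    case R10
    have "env_degree r k n + (k choose 2) + den_degree r k n = k * (n - 1)"
      using kn k2 by (simp add: R10 n)
    then show ?thesis
      using 1 by (simp add: R10)
  next
    case R01
    have "env_degree r k n + (k choose 2) + den_degree r k n = k * (n - 1) + k + (n choose 2)"
      using kn binom by (simp add: R01 n)
    then show ?thesis
      using homogeneous_mult[OF homogeneous_mult[OF 2 5] 4] by (simp only: R01 U_num.simps)
  next
    case R11
    have "env_degree r k n + (k choose 2) + den_degree r k n = k * (n - 1) + (k choose 2) + k + (n choose 2)"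
      using kn by (simp add: R11)
    then show ?thesis
      using homogeneous_mult[OF homogeneous_mult[OF homogeneous_mult[OF 2 3] 5] 4]
      by (simp only: R11 U_num.simps)
  qed
qed

text \<open>Both enumerations have the same sum, so no inequality can be strict. This singles out
  the identity among the summands at \<open>I\<close>.\<close>

lemma termwise_le_imp_eq:
  fixes \<mu> \<nu> :: "nat \<Rightarrow> nat"
  assumes "bij_betw \<mu> {1..k} I" "bij_betw \<nu> {1..k} I" "\<And>a. a \<in> {1..k} \<Longrightarrow> \<mu> a \<le> \<nu> a" "a \<in> {1..k}"
  shows "\<mu> a = \<nu> a"
proof (rule ccontr)
  assume "\<mu> a \<noteq> \<nu> a"
  then have "sum \<mu> {1..k} < sum \<nu> {1..k}"
    using assms(3,4) by (intro sum_strict_mono_ex1) (auto intro!: bexI[of _ a] le_neq_implies_less)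
  moreover have "sum \<mu> {1..k} = \<Sum>I" "sum \<nu> {1..k} = \<Sum>I"
    using sum.reindex_bij_betw[OF assms(1), of "\<lambda>x. x"] sum.reindex_bij_betw[OF assms(2), of "\<lambda>x. x"] by simp_all
  ultimately show False
    by simp
qed

section \<open>A single summand of the restriction\<close>

locale super_weight =
  fixes k n :: nat and \<sigma> :: "nat \<Rightarrow> nat" and r :: flavour and I :: "nat set"
  assumes k_le_n: "k \<le> n" and \<sigma>: "\<sigma> permutes {1..n}" and I: "I \<in> ksubsets k n"
begin

abbreviation \<sigma>' :: "nat \<Rightarrow> nat" where "\<sigma>' \<equiv> inv_into UNIV \<sigma>"
abbreviation I' :: "nat set" where "I' \<equiv> \<sigma>' ` I"
abbreviation X :: "nat \<Rightarrow> mpoly" where "X \<equiv> \<lambda>b. Var (Z (\<sigma> b))"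

text \<open>The index \<open>w a\<close> is in the original labelling, whereas \<open>X\<close> and
  \<open>I'\<close> carry the relabelling by \<sigma> from \<open>W_perm\<close>.\<close>

definition num :: "(nat \<Rightarrow> nat) \<Rightarrow> mpoly" where
  "num w = U_num r k n I' X (\<lambda>a. Var (Z (w a))) (Var Hbar)"
definition den :: "(nat \<Rightarrow> nat) \<Rightarrow> mpoly" where
  "den w = U_den r k n X (\<lambda>a. Var (Z (w a))) (Var Hbar)"
definition vdm :: "(nat \<Rightarrow> nat) \<Rightarrow> mpoly" where
  "vdm w = vandermonde k (\<lambda>a. Var (Z (w a)))"

text \<open>The divisor of the restriction to \<open>p\<^sub>J\<close> that (A2) and (A3) ask for.\<close>

definition divisor :: "nat set \<Rightarrow> mpoly" where
  "divisor J = e_ver r n \<sigma> J * (if J = I then 1 else Var Hbar)"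

lemma \<sigma>_simps [simp]: "\<sigma> (\<sigma>' x) = x" "\<sigma>' (\<sigma> x) = x"
  using permutes_inverses[OF \<sigma>] by simp_all

lemma \<sigma>_mem: "\<sigma> x \<in> {1..n} \<longleftrightarrow> x \<in> {1..n}" "\<sigma>' x \<in> {1..n} \<longleftrightarrow> x \<in> {1..n}"
  using permutes_in_image[OF \<sigma>] permutes_in_image[OF permutes_inv[OF \<sigma>]] by simp_all

lemma image_\<sigma>': "x \<in> \<sigma>' ` J \<longleftrightarrow> \<sigma> x \<in> J"
proof
  assume "x \<in> \<sigma>' ` J"
  then obtain y where "y \<in> J" "x = \<sigma>' y" ..
  then show "\<sigma> x \<in> J"
    by simp
next
  assume "\<sigma> x \<in> J"
  then have "\<sigma>' (\<sigma> x) \<in> \<sigma>' ` J"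
    by (rule imageI)
  then show "x \<in> \<sigma>' ` J"
    by simp
qed

lemma image_\<sigma>'_subset: "J \<subseteq> {1..n} \<Longrightarrow> \<sigma>' ` J \<subseteq> {1..n}"
  using \<sigma>_mem(2) by blast

lemma bij_\<sigma>': "bij_betw w A J \<Longrightarrow> bij_betw (\<sigma>' \<circ> w) A (\<sigma>' ` J)"
  by (erule bij_betw_trans, rule bij_betw_imageI[OF inj_on_inverseI[where g = \<sigma>] refl]) simp

lemma ksubset_\<sigma>': "J \<in> ksubsets k n \<Longrightarrow> \<sigma>' ` J \<in> ksubsets k n"
  using image_\<sigma>'_subset[of J] card_image[of \<sigma>' J] inj_on_inverseI[of J \<sigma> \<sigma>']
  by (simp add: ksubsets_def)

lemma I'_facts: "I' \<in> ksubsets k n" "finite I'" "card I' = k" "I' \<subseteq> {1..n}"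
  using ksubset_\<sigma>'[OF I] by (auto simp: ksubsets_def intro: finite_subset)

lemma bij_nth_I': "bij_betw (nth_smallest I') {1..k} I'"
  using bij_nth_smallest[OF I'_facts(2)] I'_facts by simp

lemma prod_reindex_\<sigma>:
  assumes "\<And>i j. (\<sigma> i, \<sigma> j) \<in> S \<longleftrightarrow> (i, j) \<in> S'"
  shows "(\<Prod>(i, j)\<in>S. f i j) = (\<Prod>(i, j)\<in>S'. f (\<sigma> i) (\<sigma> j))"
proof -
  have "bij_betw (map_prod \<sigma> \<sigma>) S' S"
  proof (rule bij_betw_byWitness[where f' = "map_prod \<sigma>' \<sigma>'"])
    show "map_prod \<sigma> \<sigma> ` S' \<subseteq> S"
      using assms by auto
    show "map_prod \<sigma>' \<sigma>' ` S \<subseteq> S'"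
    proof
      fix x assume "x \<in> map_prod \<sigma>' \<sigma>' ` S"
      then obtain i j where "(i, j) \<in> S" "x = (\<sigma>' i, \<sigma>' j)"
        by auto
      then show "x \<in> S'"
        using assms[of "\<sigma>' i" "\<sigma>' j"] by simp
    qed
  qed (simp_all add: map_prod_def case_prod_beta)
  from prod.reindex_bij_betw[OF this, of "\<lambda>(i, j). f i j"] show ?thesis
    by (simp add: case_prod_beta)
qed

text \<open>Relabelling by the inverse of \<sigma> turns the repelling condition into
  \<open>j < i\<close>.\<close>

lemma e_ver_eq:
  "e_ver r n \<sigma> J = ver_prod X (Var Hbar) (repelling_ver r n (\<sigma>' ` J))"
  unfolding e_ver_def ver_prod_def
proof (rule prod_reindex_\<sigma>)
  fix i j
  have "(\<sigma> i, \<sigma> j) \<in> ver_weights r n J \<longleftrightarrow> (i, j) \<in> ver_weights r n (\<sigma>' ` J)"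
    by (cases r) (simp_all only: ver_weights.simps mem_Sigma_iff Un_iff Diff_iff image_\<sigma>' \<sigma>_mem)
  then show "(\<sigma> i, \<sigma> j) \<in> {(i, j) \<in> ver_weights r n J. repelling \<sigma> i j} \<longleftrightarrow>
      (i, j) \<in> repelling_ver r n (\<sigma>' ` J)"
    by (simp add: repelling_ver_def repelling_def)
qed

lemma e_hor_eq:
  "e_hor n \<sigma> I = (\<Prod>(i, j)\<in>{(i, j). i \<in> {1..n} - I' \<and> j \<in> I' \<and> j < i}. X i - X j)"
  unfolding e_hor_def
proof (rule prod_reindex_\<sigma>)
  fix i j
  show "(\<sigma> i, \<sigma> j) \<in> {(i, j) \<in> hor_weights n I. repelling \<sigma> i j} \<longleftrightarrow>
      (i, j) \<in> {(i, j). i \<in> {1..n} - I' \<and> j \<in> I' \<and> j < i}"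
    unfolding mem_Collect_eq prod.case hor_weights_def mem_Sigma_iff Diff_iff image_\<sigma>' \<sigma>_mem repelling_def
    by simp
qed

text \<open>The factor with \<open>b = \<sigma>' (w a)\<close>, which occurs because
  \<open>b\<close> exceeds \<open>i_a\<close>, is zero.\<close>

lemma num_eq_0:
  assumes "bij_betw w {1..k} J" "J \<subseteq> {1..n}" "a \<in> {1..k}" "nth_smallest I' a < \<sigma>' (w a)"
  shows "num w = 0"
proof -
  have "\<sigma>' (w a) \<in> {nth_smallest I' a<..n}"
    using assms \<sigma>_mem(2)[of "w a"] bij_betw_apply[OF assms(1,3)] by auto
  moreover have "X (\<sigma>' (w a)) - Var (Z (w a)) = 0"
    by simp
  ultimately have "(\<Prod>b\<in>{nth_smallest I' a<..n}. X b - Var (Z (w a))) = 0"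
    by (intro prod_zero) (auto simp only: finite_greaterThanAtMost)
  then have "(\<Prod>a\<in>{1..k}. \<Prod>b\<in>{nth_smallest I' a<..n}. X b - Var (Z (w a))) = 0"
    using assms(3) by (intro prod_zero) (auto simp only: finite_atLeastAtMost)
  moreover have "(\<Prod>a\<in>{1..k}. \<Prod>b\<in>{nth_smallest I' a<..n}. X b - Var (Z (w a))) dvd num w"
    unfolding num_def by (rule hor_dvd_U_num)
  ultimately show ?thesis
    by (simp only: dvd_0_left_iff)
qed

lemma shifted:
  assumes "bij_betw w {1..k} J" "J \<subseteq> {1..n}" "\<And>a. a \<in> {1..k} \<Longrightarrow> \<sigma>' (w a) \<le> nth_smallest I' a"
  shows "shifted_enumeration k n I' (\<sigma>' ` J) (\<sigma>' \<circ> w)"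
  using assms bij_\<sigma>'[OF assms(1)] image_\<sigma>'_subset[OF assms(2)] I'_facts(1)
  by unfold_locales auto

lemma num_factor:
  assumes w: "bij_betw w {1..k} J" and J: "J \<subseteq> {1..n}"
  shows "\<exists>y. num w = den w * (divisor J * y)"
proof (cases "\<forall>a\<in>{1..k}. \<sigma>' (w a) \<le> nth_smallest I' a")
  case False
  then obtain a where "a \<in> {1..k}" "nth_smallest I' a < \<sigma>' (w a)"
    by (auto simp: not_le)
  then show ?thesis
    using num_eq_0[OF w J] by (intro exI[of _ 0]) simp
next
  case True
  then interpret S: shifted_enumeration k n I' "\<sigma>' ` J" "\<sigma>' \<circ> w"
    by (intro shifted w J) simp
  let ?rest = "S.rest r X (Var Hbar)"
  have "(if J = I then 1 else Var Hbar) dvd ?rest"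
  proof (cases "J = I")
    case False
    have "\<exists>a\<in>{1..k}. \<sigma>' (w a) < nth_smallest I' a"
    proof (rule ccontr)
      assume "\<not> ?thesis"
      then have "\<sigma>' (w a) = nth_smallest I' a" if "a \<in> {1..k}" for a
        using True that by (simp add: le_less)
      then have "(\<sigma>' \<circ> w) ` {1..k} = nth_smallest I' ` {1..k}"
        by (intro image_cong) auto
      then have "\<sigma>' ` J = I'"
        using bij_\<sigma>'[OF w] bij_nth_I' by (simp add: bij_betw_def)
      then have "\<sigma> ` \<sigma>' ` J = \<sigma> ` I'"
        by simp
      then show False
        using False by (simp add: image_image)
    qed
    then obtain a where a: "a \<in> {1..k}" "\<sigma>' (w a) < nth_smallest I' a"
      by blast
    then have "\<sigma>' (w a) \<in> \<sigma>' ` J" "\<sigma>' (w a) < S.\<iota> (\<sigma>' (w a))"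
      using bij_betw_apply[OF w a(1)] S.iota_mu[OF a(1)] by auto
    then show ?thesis
      using S.dvd_rest[of "\<sigma>' (w a)" "Var Hbar" r X] False by simp
  qed simp
  then obtain y where "?rest = (if J = I then 1 else Var Hbar) * y" ..
  then show ?thesis
    using S.U_num_factor[of r X "Var Hbar"] unfolding num_def den_def divisor_def e_ver_eq
    by (simp add: mult.assoc)
qed

text \<open>The divisor is separated from the cofactor because only the sum of the cofactors is
  divided by the Vandermonde product. The choice depends on \<open>w\<close> through its values on
  \<open>{1..k}\<close> alone.\<close>

definition quot :: "(nat \<Rightarrow> nat) \<Rightarrow> mpoly" where
  "quot w = (SOME y. num w = den w * (divisor (w ` {1..k}) * y))"

definition summand :: "(nat \<Rightarrow> nat) \<Rightarrow> mpoly" where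
  "summand w = divisor (w ` {1..k}) * quot w"

lemma num_eq:
  assumes "inj_on w {1..k}" "w ` {1..k} \<subseteq> {1..n}"
  shows "num w = den w * summand w"
proof -
  have "num w = den w * (divisor (w ` {1..k}) * quot w)"
    unfolding quot_def by (rule someI_ex, rule num_factor) (use assms in \<open>simp_all add: bij_betw_def\<close>)
  then show ?thesis
    unfolding summand_def .
qed

lemma num_cong: "(\<And>a. a \<in> {1..k} \<Longrightarrow> w a = w' a) \<Longrightarrow> num w = num w'"
  unfolding num_def by (rule U_num_cong[OF I'_facts(1)]) auto

lemma den_cong: "(\<And>a. a \<in> {1..k} \<Longrightarrow> w a = w' a) \<Longrightarrow> den w = den w'"
  unfolding den_def by (rule U_den_cong) auto

lemma vdm_cong: "(\<And>a. a \<in> {1..k} \<Longrightarrow> w a = w' a) \<Longrightarrow> vdm w = vdm w'"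
  unfolding vdm_def by (rule vandermonde_cong) auto

lemma summand_cong:
  assumes "\<And>a. a \<in> {1..k} \<Longrightarrow> w a = w' a"
  shows "quot w = quot w'" "summand w = summand w'"
proof -
  have eq: "w ` {1..k} = w' ` {1..k}"
    using assms by (rule image_cong[OF refl])
  have "num w = num w'"
    by (rule num_cong) (rule assms)
  moreover have "den w = den w'"
    by (rule den_cong) (rule assms)
  ultimately show "quot w = quot w'" "summand w = summand w'"
    unfolding summand_def quot_def eq by simp_all
qed

lemma den_nonzero: "den w \<noteq> 0"
  unfolding den_def by (rule U_den_nonzero)

lemma vdm_alt: "vdm w = (\<Prod>(a, b)\<in>ordered_pairs k. Var (Z (w b)) - Var (Z (w a)))"
  unfolding vdm_def by (rule vandermonde_alt)

lemma vdm_nonzero: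
  assumes "inj_on w {1..k}"
  shows "vdm w \<noteq> 0"
  unfolding vdm_alt
proof (rule prod_nonzero)
  fix x assume "x \<in> ordered_pairs k"
  then obtain a b where "x = (a, b)" "a \<in> {1..k}" "b \<in> {1..k}" "a \<noteq> b"
    by (auto simp: ordered_pairs_def)
  then show "(case x of (a, b) \<Rightarrow> Var (Z (w b)) - Var (Z (w a))) \<noteq> 0"
    using inj_onD[OF assms, of b a] by auto
qed

lemma vdm_permutes: "\<tau> permutes {1..k} \<Longrightarrow> vdm (w \<circ> \<tau>) = of_int (sign \<tau>) * vdm w"
  using vandermonde_permutes[of \<tau> k "\<lambda>a. Var (Z (w a))"] by (simp add: vdm_def o_def)

section \<open>Identifying two equivariant parameters\<close>

abbreviation specialize :: "nat \<Rightarrow> nat \<Rightarrow> mpoly \<Rightarrow> mpoly" where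
  "specialize i j \<equiv> subst_var (Z i) (Var (Z j))"

lemma specialize_Z: "specialize i j (Var (Z x)) = Var (Z (if x = i then j else x))"
  by simp

lemma specialize_transpose: "specialize i j (Var (Z (transpose i j x))) = specialize i j (Var (Z x))"
  by (simp add: transpose_def)

lemma specialize_num: "specialize i j (num (transpose i j \<circ> w)) = specialize i j (num w)"
  unfolding num_def U_num_poly_subst o_def specialize_transpose ..

lemma specialize_den: "specialize i j (den (transpose i j \<circ> w)) = specialize i j (den w)"
  unfolding den_def U_den_poly_subst o_def specialize_transpose ..

lemma specialize_vdm: "specialize i j (vdm (transpose i j \<circ> w)) = specialize i j (vdm w)"
  unfolding vdm_def vandermonde_poly_subst o_def specialize_transpose ..

lemma specialize_Hbar: "specialize i j (Var Hbar) = Var Hbar"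
  by simp

lemma specialize_den_nonzero: "specialize i j (den w) \<noteq> 0"
  unfolding den_def U_den_poly_subst specialize_Z specialize_Hbar by (rule U_den_nonzero)

lemma specialize_vdm_nonzero:
  assumes "inj_on w {1..k}" "\<not> (i \<in> w ` {1..k} \<and> j \<in> w ` {1..k})"
  shows "specialize i j (vdm w) \<noteq> 0"
  unfolding vdm_alt poly_subst_prod
proof (rule prod_nonzero)
  fix x assume "x \<in> ordered_pairs k"
  then obtain a b where x: "x = (a, b)" "a \<in> {1..k}" "b \<in> {1..k}" "a \<noteq> b"
    by (auto simp: ordered_pairs_def)
  then have "w a \<noteq> w b" "w a \<in> w ` {1..k}" "w b \<in> w ` {1..k}"
    using assms(1) by (auto dest: inj_onD)
  then show "specialize i j (case x of (a, b) \<Rightarrow> Var (Z (w b)) - Var (Z (w a))) \<noteq> 0"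
    using assms(2) unfolding x(1) prod.case poly_subst_diff specialize_Z by auto
qed

lemma divisor_nonzero: "divisor J \<noteq> 0" "specialize i j (divisor J) \<noteq> 0"
proof -
  have "e_ver r n \<sigma> J \<noteq> 0"
    unfolding e_ver_def by (intro prod_nonzero) (auto simp: weight_nonzero)
  moreover have "specialize i j (e_ver r n \<sigma> J) \<noteq> 0"
    unfolding e_ver_def poly_subst_prod
  proof (rule prod_nonzero)
    fix x :: "nat \<times> nat"
    obtain a b where x: "x = (a, b)"
      by fastforce
    show "specialize i j (case x of (a, b) \<Rightarrow> Var (Z a) - Var (Z b) + Var Hbar) \<noteq> 0"
      unfolding x prod.case poly_subst_diff poly_subst_add specialize_Z specialize_Hbar
      by (rule weight_nonzero)
  qed
  ultimately show "divisor J \<noteq> 0" "specialize i j (divisor J) \<noteq> 0"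
    by (simp_all add: divisor_def)
qed

text \<open>Numerators and denominators agree after the specialization, and the denominator survives
  it. The claim is about \<open>summand\<close> since the divisors belong to different fixed points
  in general; they coincide when the transposition preserves the image of \<open>w\<close>.\<close>

lemma specialize_summand:
  assumes "inj_on w {1..k}" "w ` {1..k} \<subseteq> {1..n}" "i \<in> {1..n}" "j \<in> {1..n}"
  shows "specialize i j (summand (transpose i j \<circ> w)) = specialize i j (summand w)"
proof -
  have "inj_on (transpose i j \<circ> w) {1..k}"
    by (rule comp_inj_on[OF assms(1) inj_on_subset[OF bij_is_inj[OF bij_transpose] subset_UNIV]])
  moreover have "(transpose i j \<circ> w) ` {1..k} \<subseteq> {1..n}"
    unfolding image_comp[symmetric]
    using image_mono[OF assms(2), of "transpose i j"] transpose_image_eq[of i "{1..n}" j] assms(3,4)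
    by simp
  ultimately have "num (transpose i j \<circ> w) = den (transpose i j \<circ> w) * summand (transpose i j \<circ> w)"
    by (rule num_eq)
  then have "specialize i j (den (transpose i j \<circ> w)) * specialize i j (summand (transpose i j \<circ> w))
      = specialize i j (num (transpose i j \<circ> w))"
    by (simp only: poly_subst_mult)
  then have "specialize i j (den w) * specialize i j (summand (transpose i j \<circ> w)) =
      specialize i j (den w) * specialize i j (summand w)"
    using num_eq[OF assms(1,2)] by (simp only: specialize_den specialize_num poly_subst_mult)
  then show ?thesis
    using specialize_den_nonzero mult_left_cancel by blast
qed

definition antisym_sum :: "(nat \<Rightarrow> nat) \<Rightarrow> mpoly" where
  "antisym_sum w = (\<Sum>\<tau> | \<tau> permutes {1..k}. of_int (sign \<tau>) * quot (w \<circ> \<tau>))"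

lemma permutes_image_comp: "\<tau> permutes {1..k} \<Longrightarrow> (w \<circ> \<tau>) ` {1..k} = w ` {1..k}"
  by (simp only: image_comp[symmetric] permutes_image)

lemma permutes_inj_comp: "\<tau> permutes {1..k} \<Longrightarrow> inj_on w {1..k} \<Longrightarrow> inj_on (w \<circ> \<tau>) {1..k}"
  by (intro comp_inj_on) (simp_all add: permutes_inj_on permutes_image)

lemma sum_summand: "(\<Sum>\<tau> | \<tau> permutes {1..k}. of_int (sign \<tau>) * summand (w \<circ> \<tau>)) = divisor (w ` {1..k}) * antisym_sum w"
  unfolding antisym_sum_def sum_distrib_left
  by (intro sum.cong refl) (simp only: mem_Collect_eq summand_def permutes_image_comp mult_ac)

text \<open>For \<open>Z (w b) = Z (w a)\<close> the terms of \<tau> and of \<tau> followed by the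
  transposition of \<open>a\<close> and \<open>b\<close> have equal cofactors and opposite signs, so
  the sum vanishes. This gives one linear factor for each pair of positions.\<close>

lemma vdm_dvd_antisym_sum:
  assumes w: "inj_on w {1..k}" and n: "w ` {1..k} \<subseteq> {1..n}"
  shows "vdm w dvd antisym_sum w"
  unfolding vdm_alt case_prod_beta
proof (rule prod_Var_minus_dvd)
  fix x assume "x \<in> ordered_pairs k"
  then obtain a b where x: "x = (a, b)" and ab: "a \<in> {1..k}" "b \<in> {1..k}" "a \<noteq> b"
    by (auto simp: ordered_pairs_def)
  let ?i = "w b" and ?j = "w a"
  have ij: "?i \<noteq> ?j" "?i \<in> {1..n}" "?j \<in> {1..n}"
    using ab inj_onD[OF w, of b a] subsetD[OF n imageI[of _ "{1..k}" w]] by blast+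
  show "Z (w (snd x)) \<notin> vars (Var (Z (w (fst x))))"
    using ij by (simp add: x)
  let ?s = "transpose a b"
  have s: "?s permutes {1..k}"
    using ab by (intro permutes_swap_id) auto
  \<comment> \<open>Both enumerations have the image of \<open>w\<close>, hence the same divisor,
    which survives the specialization and cancels.\<close>
  have swap: "specialize ?i ?j (quot (w \<circ> (?s \<circ> \<tau>))) = specialize ?i ?j (quot (w \<circ> \<tau>))"
    if \<tau>: "\<tau> permutes {1..k}" for \<tau>
  proof -
    \<comment> \<open>By injectivity of \<open>w\<close>, exchanging the values \<open>w a\<close>
      and \<open>w b\<close> amounts to exchanging the positions \<open>a\<close> and
      \<open>b\<close>.\<close>
    have eq: "(transpose ?i ?j \<circ> (w \<circ> \<tau>)) c = (w \<circ> (?s \<circ> \<tau>)) c" if "c \<in> {1..k}" for c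
    proof -
      have "\<tau> c \<in> {1..k}"
        using permutes_in_image[OF \<tau>] that by blast
      then have "w (\<tau> c) = w a \<longleftrightarrow> \<tau> c = a" "w (\<tau> c) = w b \<longleftrightarrow> \<tau> c = b"
        using inj_on_eq_iff[OF w] ab by blast+
      then show ?thesis
        by (simp add: transpose_def)
    qed
    have im: "(w \<circ> (?s \<circ> \<tau>)) ` {1..k} = w ` {1..k}" "(w \<circ> \<tau>) ` {1..k} = w ` {1..k}"
      by (intro permutes_image_comp permutes_compose \<tau> s)+
    have "specialize ?i ?j (summand (w \<circ> (?s \<circ> \<tau>))) = specialize ?i ?j (summand (transpose ?i ?j \<circ> (w \<circ> \<tau>)))"
      by (rule arg_cong[OF summand_cong(2)[OF eq, symmetric]])
    also have "\<dots> = specialize ?i ?j (summand (w \<circ> \<tau>))"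
      using ij n by (intro specialize_summand permutes_inj_comp \<tau> w) (simp_all only: im)
    finally have "specialize ?i ?j (divisor (w ` {1..k})) * specialize ?i ?j (quot (w \<circ> (?s \<circ> \<tau>))) =
        specialize ?i ?j (divisor (w ` {1..k})) * specialize ?i ?j (quot (w \<circ> \<tau>))"
      unfolding summand_def im by (simp only: poly_subst_mult)
    then show ?thesis
      using divisor_nonzero(2) mult_left_cancel by blast
  qed
  have "sign (?s \<circ> \<tau>) = - sign \<tau>" if "\<tau> permutes {1..k}" for \<tau>
    using ab sign_compose[OF permutation_swap_id permutes_imp_permutation[OF finite_atLeastAtMost that], of a b]
    by (simp add: sign_swap_id)
  \<comment> \<open>Reindexing by \<open>?s\<close> exhibits the specialized sum as its own
    negative.\<close>
  then have "specialize ?i ?j (antisym_sum w) =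
      (\<Sum>\<tau> | \<tau> permutes {1..k}. - (of_int (sign (?s \<circ> \<tau>)) * specialize ?i ?j (quot (w \<circ> (?s \<circ> \<tau>)))))"
    unfolding antisym_sum_def poly_subst_sum poly_subst_mult poly_subst_of_int
    by (intro sum.cong refl) (simp add: swap del: o_apply)
  also have "\<dots> = - (\<Sum>\<tau> | \<tau> permutes {1..k}. of_int (sign \<tau>) * specialize ?i ?j (quot (w \<circ> \<tau>)))"
    unfolding sum_negf
    using setum_permutations_compose_left[OF s, of "\<lambda>\<tau>. of_int (sign \<tau>) * specialize ?i ?j (quot (w \<circ> \<tau>))"]
    by simp
  also have "\<dots> = - specialize ?i ?j (antisym_sum w)"
    unfolding antisym_sum_def poly_subst_sum poly_subst_mult poly_subst_of_int ..
  finally have "2 * specialize ?i ?j (antisym_sum w) = 0"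
    by (simp only: eq_neg_iff_add_eq_0 mult_2)
  then have "specialize ?i ?j (antisym_sum w) = 0"
    by simp
  then show "(Var (Z (w (snd x))) - Var (Z (w (fst x)))) dvd antisym_sum w"
    using Z_minus_Z_dvd_iff[OF ij(1)] by (simp add: x)
next
  fix x y assume "x \<in> ordered_pairs k" "y \<in> ordered_pairs k" "x \<noteq> y"
  then obtain a b c d where xy: "x = (a, b)" "y = (c, d)" "(a, b) \<noteq> (c, d)" "a < b" "c < d"
    and mem: "a \<in> {1..k}" "b \<in> {1..k}" "c \<in> {1..k}" "d \<in> {1..k}"
    by (auto simp: ordered_pairs_def)
  have "w d = w b \<longleftrightarrow> d = b" "w c = w b \<longleftrightarrow> c = b" "w a = w c \<longleftrightarrow> a = c" "w d = w c \<longleftrightarrow> d = c" "w d = w a \<longleftrightarrow> d = a"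
    using inj_on_eq_iff[OF w] mem by blast+
  \<comment> \<open>Equality would force \<open>{c, d} = {a, b}\<close>, and the order within the
    pairs would make them equal.\<close>
  then have "(if w d = w b then w a else w d) \<noteq> (if w c = w b then w a else w c)"
    using xy by auto
  then show "specialize (w (snd x)) (w (fst x)) (Var (Z (w (snd y))) - Var (Z (w (fst y)))) \<noteq> 0"
    unfolding xy fst_conv snd_conv poly_subst_diff specialize_Z by simp
qed (rule finite_ordered_pairs)

section \<open>The restrictions as polynomials\<close>

definition F :: "nat set \<Rightarrow> mpoly" where
  "F J = divisor J * (SOME x. antisym_sum (nth_smallest J) = vdm (nth_smallest J) * x)"

lemma bij_nth_smallest_ksubset: "J \<in> ksubsets k n \<Longrightarrow> bij_betw (nth_smallest J) {1..k} J"
  using bij_nth_smallest[of J]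
  by (auto simp: ksubsets_def intro: finite_subset)

lemma divisor_dvd_F: "divisor J dvd F J"
  by (simp add: F_def)

lemma vdm_F_nth:
  assumes J: "J \<in> ksubsets k n"
  shows "vdm (nth_smallest J) * F J = (\<Sum>\<tau> | \<tau> permutes {1..k}. of_int (sign \<tau>) * summand (nth_smallest J \<circ> \<tau>))"
proof -
  let ?w = "nth_smallest J"
  have im: "?w ` {1..k} = J" and inj: "inj_on ?w {1..k}" and sub: "J \<subseteq> {1..n}"
    using bij_nth_smallest_ksubset[OF J] J by (auto simp: bij_betw_def ksubsets_def)
  have "\<exists>x. antisym_sum ?w = vdm ?w * x"
    using vdm_dvd_antisym_sum[OF inj] im sub by (auto elim: dvdE)
  then have "antisym_sum ?w = vdm ?w * (SOME x. antisym_sum ?w = vdm ?w * x)"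
    by (rule someI_ex)
  then show ?thesis
    unfolding sum_summand im F_def by (metis mult.left_commute)
qed

text \<open>Passing from the increasing enumeration to \<open>w\<close> multiplies both sides by the
  sign of the permutation between them. Enumerations that are not increasing occur in the
  congruences and at \<open>p_I\<close>.\<close>

lemma vdm_F:
  assumes J: "J \<in> ksubsets k n" and w: "bij_betw w {1..k} J"
  shows "vdm w * F J = (\<Sum>\<tau> | \<tau> permutes {1..k}. of_int (sign \<tau>) * summand (w \<circ> \<tau>))"
proof -
  let ?v = "nth_smallest J"
  note v = bij_nth_smallest_ksubset[OF J]
  define \<rho> where "\<rho> a = (if a \<in> {1..k} then inv_into {1..k} ?v (w a) else a)" for a
  have v\<rho>: "w a = (?v \<circ> \<rho>) a" if "a \<in> {1..k}" for a
    using that v bij_betw_apply[OF w that] by (auto simp: \<rho>_def bij_betw_def f_inv_into_f)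
  have "bij_betw (inv_into {1..k} ?v \<circ> w) {1..k} {1..k}"
    by (rule bij_betw_trans[OF w bij_betw_inv_into[OF v]])
  then have "bij_betw \<rho> {1..k} {1..k}"
    by (subst bij_betw_cong[where g = "inv_into {1..k} ?v \<circ> w"]) (auto simp: \<rho>_def)
  then have \<rho>: "\<rho> permutes {1..k}"
    by (rule bij_imp_permutes) (auto simp: \<rho>_def)
  have sgn: "sign \<tau> = sign \<rho> * sign (\<rho> \<circ> \<tau>)" if "\<tau> permutes {1..k}" for \<tau>
    using \<rho> that by (simp add: sign_compose permutes_imp_permutation[OF finite_atLeastAtMost])
  have tm: "summand (w \<circ> \<tau>) = summand (?v \<circ> (\<rho> \<circ> \<tau>))" if \<tau>: "\<tau> permutes {1..k}" for \<tau>
  proof (rule summand_cong(2))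
    fix a assume "a \<in> {1..k}"
    then have "\<tau> a \<in> {1..k}"
      using permutes_in_image[OF \<tau>] by blast
    from v\<rho>[OF this] show "(w \<circ> \<tau>) a = (?v \<circ> (\<rho> \<circ> \<tau>)) a"
      by simp
  qed
  have "vdm w * F J = vdm (?v \<circ> \<rho>) * F J"
    by (rule arg_cong[where f = "\<lambda>x. x * F J"], rule vdm_cong[OF v\<rho>])
  also have "\<dots> = of_int (sign \<rho>) * (vdm ?v * F J)"
    by (simp only: vdm_permutes[OF \<rho>] mult.assoc)
  also have "\<dots> = (\<Sum>\<tau> | \<tau> permutes {1..k}. of_int (sign \<rho>) * (of_int (sign \<tau>) * summand (?v \<circ> \<tau>)))"
    unfolding vdm_F_nth[OF J] sum_distrib_left ..
  also have "\<dots> = (\<Sum>\<tau> | \<tau> permutes {1..k}. of_int (sign \<rho>) * (of_int (sign (\<rho> \<circ> \<tau>)) * summand (?v \<circ> (\<rho> \<circ> \<tau>))))"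
    by (rule setum_permutations_compose_left[OF \<rho>])
  also have "\<dots> = (\<Sum>\<tau> | \<tau> permutes {1..k}. of_int (sign \<tau>) * summand (w \<circ> \<tau>))"
    by (intro sum.cong refl) (simp add: tm sgn mult.assoc del: o_apply)
  finally show ?thesis .
qed

text \<open>Permuting the roots changes the Vandermonde product by the sign of \<tau>, so all
  summands share one denominator.\<close>

lemma W_restr_eq:
  assumes J: "J \<in> ksubsets k n"
  shows "W_restr r k n \<sigma> I J = Fract (F J) 1"
proof -
  let ?w = "nth_smallest J"
  have im: "?w ` {1..k} = J" and inj: "inj_on ?w {1..k}" and sub: "J \<subseteq> {1..n}"
    using bij_nth_smallest_ksubset[OF J] J by (auto simp: bij_betw_def ksubsets_def)
  have V: "fract_of (vdm ?w) \<noteq> 0"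
    using vdm_nonzero[OF inj] by simp
  have U: "U_fun r k n I' (\<lambda>b. fract_of (X b)) (\<lambda>a. fract_of (Var (Z (?w (\<tau> a))))) (fract_of (Var Hbar))
      = of_int (sign \<tau>) * fract_of (summand (?w \<circ> \<tau>)) / fract_of (vdm ?w)" if \<tau>: "\<tau> permutes {1..k}" for \<tau>
  proof -
    have num: "num (?w \<circ> \<tau>) = den (?w \<circ> \<tau>) * summand (?w \<circ> \<tau>)"
      using \<tau> inj sub im by (intro num_eq permutes_inj_comp) (simp_all only: permutes_image_comp)
    have D: "fract_of (den (?w \<circ> \<tau>)) \<noteq> 0"
      using den_nonzero by simp
    have "U_fun r k n I' (\<lambda>b. fract_of (X b)) (\<lambda>a. fract_of (Var (Z (?w (\<tau> a))))) (fract_of (Var Hbar))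
        = fract_of (num (?w \<circ> \<tau>)) / (fract_of (den (?w \<circ> \<tau>)) * fract_of (vdm (?w \<circ> \<tau>)))"
      unfolding U_fun_quotient U_num_fract_of U_den_fract_of vandermonde_fract_of
        num_def den_def vdm_def o_def ..
    also have "\<dots> = fract_of (summand (?w \<circ> \<tau>)) / (of_int (sign \<tau>) * fract_of (vdm ?w))"
      unfolding num vdm_permutes[OF \<tau>] using D by (simp add: fract_of_sign del: o_apply)
    also have "\<dots> = of_int (sign \<tau>) * fract_of (summand (?w \<circ> \<tau>)) / fract_of (vdm ?w)"
      by (cases \<tau> rule: sign_cases) simp_all
    finally show ?thesis .
  qed
  have "W_restr r k n \<sigma> I J = (\<Sum>\<tau> | \<tau> permutes {1..k}.
      U_fun r k n I' (\<lambda>b. fract_of (X b)) (\<lambda>a. fract_of (Var (Z (?w (\<tau> a))))) (fract_of (Var Hbar)))"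
    unfolding W_restr_def W_perm_def W_fun_def Sym_def fract_of_def ..
  also have "\<dots> = (\<Sum>\<tau> | \<tau> permutes {1..k}. of_int (sign \<tau>) * fract_of (summand (?w \<circ> \<tau>)) / fract_of (vdm ?w))"
    by (intro sum.cong refl) (simp only: mem_Collect_eq U)
  also have "\<dots> = fract_of (\<Sum>\<tau> | \<tau> permutes {1..k}. of_int (sign \<tau>) * summand (?w \<circ> \<tau>)) / fract_of (vdm ?w)"
    by (simp add: sum_divide_distrib fract_of_sign del: o_apply)
  also have "\<dots> = fract_of (F J)"
    unfolding vdm_F_nth[OF J, symmetric] using V by simp
  finally show ?thesis
    by (simp add: fract_of_def)
qed

lemma vars_num_den:
  assumes "w ` {1..k} \<subseteq> {1..n}"
  shows "restrict_vars (insert Hbar (Z ` {1..n})) (num w) = num w"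
    "restrict_vars (insert Hbar (Z ` {1..n})) (den w) = den w"
    "restrict_vars (insert Hbar (Z ` {1..n})) (vdm w) = vdm w"
proof -
  have t: "restrict_vars (insert Hbar (Z ` {1..n})) (Var (Z (w a))) = Var (Z (w a))" if "a \<in> {1..k}" for a
    using subsetD[OF assms imageI[OF that]] by (intro restrict_vars_id) auto
  have z: "restrict_vars (insert Hbar (Z ` {1..n})) (X b) = X b" if "b \<in> {1..n}" for b
    using \<sigma>_mem(1)[of b] that by (intro restrict_vars_id) auto
  have h: "restrict_vars (insert Hbar (Z ` {1..n})) (Var Hbar) = Var Hbar"
    by (intro restrict_vars_id) auto
  note * = t[unfolded restrict_vars_def] z[unfolded restrict_vars_def] h[unfolded restrict_vars_def]
  show "restrict_vars (insert Hbar (Z ` {1..n})) (num w) = num w"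
    unfolding restrict_vars_def num_def U_num_poly_subst *(3)
    by (intro U_num_cong[OF I'_facts(1)] *(1,2))
  show "restrict_vars (insert Hbar (Z ` {1..n})) (den w) = den w"
    unfolding restrict_vars_def den_def U_den_poly_subst *(3)
    by (intro U_den_cong *(1,2))
  show "restrict_vars (insert Hbar (Z ` {1..n})) (vdm w) = vdm w"
    unfolding restrict_vars_def vdm_def vandermonde_poly_subst
    by (intro vandermonde_cong *(1))
qed

text \<open>The retraction onto the admissible variables fixes numerators, denominators and the
  Vandermonde product, hence also the quotients.\<close>

lemma vars_F:
  assumes J: "J \<in> ksubsets k n"
  shows "vars (F J) \<subseteq> insert Hbar (Z ` {1..n})"
proof -
  let ?R = "restrict_vars (insert Hbar (Z ` {1..n}))" and ?w = "nth_smallest J"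
  have im: "?w ` {1..k} = J" and inj: "inj_on ?w {1..k}" and sub: "J \<subseteq> {1..n}"
    using bij_nth_smallest_ksubset[OF J] J by (auto simp: bij_betw_def ksubsets_def)
  have s: "?R (summand (?w \<circ> \<tau>)) = summand (?w \<circ> \<tau>)" if \<tau>: "\<tau> permutes {1..k}" for \<tau>
  proof -
    have sub': "(?w \<circ> \<tau>) ` {1..k} \<subseteq> {1..n}"
      using sub im by (simp only: permutes_image_comp[OF \<tau>])
    have "num (?w \<circ> \<tau>) = den (?w \<circ> \<tau>) * summand (?w \<circ> \<tau>)"
      by (rule num_eq[OF permutes_inj_comp[OF \<tau> inj] sub'])
    then have "den (?w \<circ> \<tau>) * ?R (summand (?w \<circ> \<tau>)) = den (?w \<circ> \<tau>) * summand (?w \<circ> \<tau>)"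
      by (metis vars_num_den(1,2)[OF sub'] restrict_vars_mult)
    then show ?thesis
      using den_nonzero mult_left_cancel by blast
  qed
  have "vdm ?w * ?R (F J) = ?R (vdm ?w * F J)"
    using vars_num_den(3)[of ?w] im sub by (simp add: restrict_vars_def)
  also have "\<dots> = (\<Sum>\<tau> | \<tau> permutes {1..k}. of_int (sign \<tau>) * ?R (summand (?w \<circ> \<tau>)))"
    unfolding vdm_F_nth[OF J] restrict_vars_def by (simp del: o_apply)
  also have "\<dots> = vdm ?w * F J"
    unfolding vdm_F_nth[OF J] by (intro sum.cong refl) (simp only: mem_Collect_eq s)
  finally have "?R (F J) = F J"
    using vdm_nonzero[OF inj] by simp
  then show ?thesis
    using vars_restrict_vars by metis
qed

lemma homogeneous_F:
  assumes J: "J \<in> ksubsets k n"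
  shows "homogeneous (env_degree r k n) (F J)"
proof -
  let ?w = "nth_smallest J"
  have im: "?w ` {1..k} = J" and inj: "inj_on ?w {1..k}" and sub: "J \<subseteq> {1..n}"
    using bij_nth_smallest_ksubset[OF J] J by (auto simp: bij_betw_def ksubsets_def)
  have "homogeneous (env_degree r k n + (k choose 2)) (summand (?w \<circ> \<tau>))" if \<tau>: "\<tau> permutes {1..k}" for \<tau>
  proof (rule homogeneous_mult_cancel)
    have "(?w \<circ> \<tau>) ` {1..k} \<subseteq> {1..n}"
      using sub im by (simp only: permutes_image_comp[OF \<tau>])
    then have "summand (?w \<circ> \<tau>) * den (?w \<circ> \<tau>) = num (?w \<circ> \<tau>)"
      using num_eq[OF permutes_inj_comp[OF \<tau> inj]] by (simp only: mult.commute)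
    moreover have "homogeneous (env_degree r k n + (k choose 2) + den_degree r k n) (num (?w \<circ> \<tau>))"
      unfolding num_def by (rule homogeneous_U_num[OF I'_facts(1) k_le_n]) (rule homogeneous_Var)+
    ultimately show "homogeneous (env_degree r k n + (k choose 2) + den_degree r k n) (summand (?w \<circ> \<tau>) * den (?w \<circ> \<tau>))"
      by simp
    show "homogeneous (den_degree r k n) (den (?w \<circ> \<tau>))"
      unfolding den_def by (rule homogeneous_U_den) (rule homogeneous_Var)+
  qed (rule den_nonzero)
  then have "homogeneous (0 + (env_degree r k n + (k choose 2))) (of_int (sign \<tau>) * summand (?w \<circ> \<tau>))" if "\<tau> permutes {1..k}" for \<tau>
    using that by (intro homogeneous_mult homogeneous_of_int)
  then have "homogeneous (env_degree r k n + (k choose 2)) (vdm ?w * F J)"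
    unfolding vdm_F_nth[OF J] by (intro homogeneous_sum) simp
  then have "homogeneous (env_degree r k n + (k choose 2)) (F J * vdm ?w)"
    by (simp only: mult.commute)
  moreover have "homogeneous (k choose 2) (vdm ?w)"
    unfolding vdm_def vandermonde_def by (intro homogeneous_prod_pairs homogeneous_diff homogeneous_Var)
  ultimately show ?thesis
    by (rule homogeneous_mult_cancel[OF _ _ vdm_nonzero[OF inj]])
qed

text \<open>Only the case of exactly one of \<open>i\<close>, \<open>j\<close> in \<open>J\<close>
  has content. Then the summands for \<open>J\<close> and its transposed set agree for
  \<open>Z i = Z j\<close>, and the Vandermonde product stays nonzero there and cancels.\<close>

lemma gkm_F:
  assumes J: "J \<in> ksubsets k n" and ij: "i \<in> {1..n}" "j \<in> {1..n}" "i \<noteq> j"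
  shows "(Var (Z i) - Var (Z j)) dvd F J - F (transpose i j ` J)"
proof (cases "i \<in> J \<longleftrightarrow> j \<in> J")
  case True
  then have "transpose i j ` J = J"
    by (rule transpose_image_eq)
  then show ?thesis
    by simp
next
  case False
  let ?w = "nth_smallest J" and ?s = "transpose i j"
  have bij: "bij_betw ?w {1..k} J"
    by (rule bij_nth_smallest_ksubset[OF J])
  have im: "?w ` {1..k} = J" and inj: "inj_on ?w {1..k}" and sub: "J \<subseteq> {1..n}"
    using bij J by (auto simp: bij_betw_def ksubsets_def)
  have inj_s: "inj_on ?s A" for A
    by (rule inj_on_subset[OF bij_is_inj[OF bij_transpose] subset_UNIV])
  \<comment> \<open>This enumeration of the transposed set need not be increasing, whence
    \<open>vdm_F\<close> instead of \<open>vdm_F_nth\<close>.\<close>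
  have sw: "bij_betw (?s \<circ> ?w) {1..k} (?s ` J)"
    by (rule bij_betw_trans[OF bij]) (rule bij_betw_imageI[OF inj_s refl])
  have "?s ` J \<subseteq> {1..n}"
    using image_mono[OF sub, of ?s] transpose_image_eq[of i "{1..n}" j] ij by simp
  then have sJ: "?s ` J \<in> ksubsets k n"
    using J card_image[OF inj_s, of J] by (simp add: ksubsets_def)
  have "specialize i j (vdm ?w) * specialize i j (F (?s ` J)) = specialize i j (vdm (?s \<circ> ?w) * F (?s ` J))"
    by (simp only: poly_subst_mult specialize_vdm)
  also have "\<dots> = (\<Sum>\<tau> | \<tau> permutes {1..k}. of_int (sign \<tau>) * specialize i j (summand (?s \<circ> (?w \<circ> \<tau>))))"
    unfolding vdm_F[OF sJ sw] by (simp only: poly_subst_sum poly_subst_mult poly_subst_of_int comp_assoc)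
  also have "\<dots> = (\<Sum>\<tau> | \<tau> permutes {1..k}. of_int (sign \<tau>) * specialize i j (summand (?w \<circ> \<tau>)))"
    using sub by (intro sum.cong refl arg_cong2[of _ _ _ _ "(*)"] specialize_summand ij permutes_inj_comp inj)
      (simp_all only: mem_Collect_eq permutes_image_comp im)
  also have "\<dots> = specialize i j (vdm ?w * F J)"
    unfolding vdm_F_nth[OF J] by (simp only: poly_subst_sum poly_subst_mult poly_subst_of_int)
  also have "\<dots> = specialize i j (vdm ?w) * specialize i j (F J)"
    by simp
  finally have "specialize i j (F (?s ` J)) = specialize i j (F J)"
    using specialize_vdm_nonzero[OF inj, of i j] False im mult_left_cancel by blast
  then show ?thesis
    unfolding Z_minus_Z_dvd_iff[OF ij(3)] by (simp only: poly_subst_diff) simp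
qed

section \<open>Normalization at the fixed point of \<open>I\<close>\<close>

lemma hor_prod_eq:
  "(\<Prod>a\<in>{1..k}. \<Prod>b\<in>{nth_smallest I' a<..n}. f b (nth_smallest I' a)) =
    (\<Prod>(a, b)\<in>ordered_pairs k. f (nth_smallest I' b) (nth_smallest I' a))
    * (\<Prod>(i, j)\<in>{(i, j). i \<in> {1..n} - I' \<and> j \<in> I' \<and> j < i}. f i j)"
proof -
  interpret S: shifted_enumeration k n I' I' "nth_smallest I'"
    using I'_facts bij_nth_I' by unfold_locales auto
  have \<iota>: "S.\<iota> j = j" if j: "j \<in> I'" for j
  proof -
    from j obtain a where a: "a \<in> {1..k}" "j = nth_smallest I' a"
      by (rule S.J_cases)
    then show ?thesis
      using S.iota_mu[OF a(1)] by simp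
  qed
  let ?H = "{(i, j). i \<in> {1..n} - I' \<and> j \<in> I' \<and> j < i}"
  have "(\<Prod>a\<in>{1..k}. \<Prod>b\<in>{nth_smallest I' a<..n}. f b (nth_smallest I' a)) = (\<Prod>j\<in>I'. \<Prod>b\<in>{j<..n}. f b j)"
    by (rule prod.reindex_bij_betw[OF bij_nth_I'])
  also have "\<dots> = (\<Prod>(j, b)\<in>(SIGMA j:I'. {j<..n}). f b j)"
    using I'_facts(2) by (rule prod.Sigma) simp
  also have "\<dots> = (\<Prod>(b, j)\<in>S.C \<union> ?H. f b j)"
    using I'_facts(4)
    by (intro prod.reindex_bij_witness[of _ prod.swap prod.swap]) (auto simp: S.C_def \<iota>)
  also have "\<dots> = (\<Prod>(b, j)\<in>S.C. f b j) * (\<Prod>(b, j)\<in>?H. f b j)"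
  proof (rule prod.union_disjoint)
    show "finite S.C"
      by (rule S.finite_pairs)
    show "finite ?H"
      by (rule finite_subset[of _ "{1..n} \<times> {1..n}"]) (use I'_facts(4) in auto)
  qed (auto simp: S.C_def)
  finally show ?thesis
    unfolding S.prod_C .
qed

text \<open>By triangularity the identity is the only permutation with a nonzero summand. There the
  shift is trivial, so the vertical cofactor is \<open>1\<close>; in the horizontal product the
  factors with \<open>b \<in> I'\<close> form the Vandermonde product and those with
  \<open>b \<notin> I'\<close> form \<open>e_hor\<close>.\<close>

lemma F_I: "F I = e_ver r n \<sigma> I * e_hor n \<sigma> I"
proof -
  \<comment> \<open>The enumeration of \<open>I\<close> in the order given by \<sigma>: it meets
    every bound with equality, and any other enumeration of \<open>I\<close> exceeds one.\<close>
  define w where "w a = \<sigma> (nth_smallest I' a)" for a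
  have I_n: "I \<subseteq> {1..n}"
    using I by (simp add: ksubsets_def)
  have w: "bij_betw w {1..k} I"
  proof -
    have "bij_betw \<sigma> I' I"
      by (rule bij_betw_byWitness[where f' = \<sigma>']) auto
    from bij_betw_trans[OF bij_nth_I' this] show ?thesis
      by (simp add: w_def[abs_def] o_def)
  qed
  then have inj: "inj_on w {1..k}" and im: "w ` {1..k} = I"
    by (auto simp: bij_betw_def)
  have zero: "summand (w \<circ> \<tau>) = 0" if \<tau>: "\<tau> permutes {1..k}" "\<tau> \<noteq> id" for \<tau>
  proof -
    have bij: "bij_betw (nth_smallest I' \<circ> \<tau>) {1..k} I'"
      by (rule bij_betw_trans[OF permutes_imp_bij[OF \<tau>(1)] bij_nth_I'])
    have "\<exists>a\<in>{1..k}. nth_smallest I' a < nth_smallest I' (\<tau> a)"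
    proof (rule ccontr)
      assume "\<not> ?thesis"
      then have le: "(nth_smallest I' \<circ> \<tau>) a \<le> nth_smallest I' a" if "a \<in> {1..k}" for a
        using that by (auto simp: not_less)
      have "\<tau> a = a" if a: "a \<in> {1..k}" for a
      proof -
        have "\<tau> a \<in> {1..k}"
          using permutes_in_image[OF \<tau>(1)] a by blast
        moreover have "nth_smallest I' (\<tau> a) = nth_smallest I' a"
          using termwise_le_imp_eq[OF bij bij_nth_I' le a] by simp
        ultimately show ?thesis
          using bij_betw_imp_inj_on[OF bij_nth_I'] a by (auto dest: inj_onD)
      qed
      then have "\<tau> = id"
        using permutes_not_in[OF \<tau>(1)] by (auto simp: fun_eq_iff)
      then show False
        using \<tau>(2) by simp
    qed
    then obtain a where a: "a \<in> {1..k}" "nth_smallest I' a < nth_smallest I' (\<tau> a)"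
      by blast
    have w\<tau>: "bij_betw (w \<circ> \<tau>) {1..k} I"
      by (rule bij_betw_trans[OF permutes_imp_bij[OF \<tau>(1)] w])
    have "num (w \<circ> \<tau>) = 0"
      by (rule num_eq_0[OF w\<tau> I_n a(1)]) (simp add: w_def a(2))
    moreover have "num (w \<circ> \<tau>) = den (w \<circ> \<tau>) * summand (w \<circ> \<tau>)"
      using w\<tau> I_n by (intro num_eq) (auto simp only: bij_betw_def)
    ultimately show ?thesis
      using den_nonzero by simp
  qed
  have "vdm w * F I = (\<Sum>\<tau> | \<tau> permutes {1..k}. if \<tau> = id then summand w else 0)"
    unfolding vdm_F[OF I w] by (intro sum.cong refl) (auto simp: zero simp del: o_apply)
  also have "\<dots> = summand w"
    by (simp add: sum.delta finite_permutations permutes_id)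
  finally have "vdm w * F I = summand w" .
  interpret S: shifted_enumeration k n I' I' "\<sigma>' \<circ> w"
    by (rule shifted[OF w I_n]) (simp add: w_def)
  have \<sigma>'w: "\<sigma>' \<circ> w = nth_smallest I'"
    by (auto simp: w_def)
  have \<iota>: "S.\<iota> j = j" if j: "j \<in> I'" for j
  proof -
    from j obtain a where a: "a \<in> {1..k}" "j = (\<sigma>' \<circ> w) a"
      by (rule S.J_cases)
    then show ?thesis
      using S.iota_mu[OF a(1)] by (simp add: w_def)
  qed
  have "num w = den w * (e_ver r n \<sigma> I *
      (\<Prod>a\<in>{1..k}. \<Prod>b\<in>{nth_smallest I' a<..n}. X b - X (nth_smallest I' a)))"
    using S.U_num_factor[of r X "Var Hbar"] S.rest_eq_1[OF \<iota>, of r X "Var Hbar"]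
    unfolding num_def den_def e_ver_eq by (simp add: w_def mult.assoc)
  moreover have "(\<Prod>a\<in>{1..k}. \<Prod>b\<in>{nth_smallest I' a<..n}. X b - X (nth_smallest I' a)) = vdm w * e_hor n \<sigma> I"
    unfolding hor_prod_eq[of "\<lambda>b a. X b - X a"] e_hor_eq vdm_alt w_def ..
  moreover have "num w = den w * summand w"
    using im I_n by (intro num_eq inj) simp
  ultimately have "den w * summand w = den w * (e_ver r n \<sigma> I * (vdm w * e_hor n \<sigma> I))"
    by (simp only:)
  then have "summand w = e_ver r n \<sigma> I * (vdm w * e_hor n \<sigma> I)"
    using den_nonzero mult_left_cancel by blast
  with \<open>vdm w * F I = summand w\<close> have "vdm w * F I = vdm w * (e_ver r n \<sigma> I * e_hor n \<sigma> I)"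
    by (simp only: mult.left_commute)
  then show ?thesis
    using vdm_nonzero[OF inj] mult_left_cancel by blast
qed

lemma vars_e_ver:
  assumes "J \<in> ksubsets k n"
  shows "vars (e_ver r n \<sigma> J) \<subseteq> insert Hbar (Z ` {1..n})"
  unfolding e_ver_def
proof (rule vars_prod)
  fix x assume "x \<in> {(i, j) \<in> ver_weights r n J. repelling \<sigma> i j}"
  then obtain i j where ij: "x = (i, j)" "(i, j) \<in> ver_weights r n J"
    by auto
  have "ver_weights r n J \<subseteq> {1..n} \<times> {1..n}"
    using assms by (cases r) (auto simp: ksubsets_def)
  with ij have x: "x = (i, j)" "i \<in> {1..n}" "j \<in> {1..n}"
    by blast+
  have "vars (Var (Z i) - Var (Z j) + Var Hbar) \<subseteq> {Z i, Z j, Hbar}"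
    using vars_add[of "Var (Z i) - Var (Z j)" "Var Hbar"] vars_diff[of "Var (Z i)" "Var (Z j)"] by auto
  with x show "vars (case x of (i, j) \<Rightarrow> Var (Z i) - Var (Z j) + Var Hbar) \<subseteq> insert Hbar (Z ` {1..n})"
    by auto
qed

end

theorem theorem7p3:
  fixes k n :: nat and \<sigma> :: "nat \<Rightarrow> nat" and r :: flavour and I :: "nat set"
  assumes "k \<le> n" and "\<sigma> permutes {1..n}" and "I \<in> ksubsets k n"
  shows "W_class r k n \<sigma> I \<in> carrier (HT_Gr k n)
    \<and> homogeneous_class (env_degree r k n) (W_class r k n \<sigma> I)
    \<and> restrict_class n (W_class r k n \<sigma> I) I = e_ver r n \<sigma> I * e_hor n \<sigma> I
    \<and> (\<forall>J\<in>ksubsets k n. J \<noteq> I \<longrightarrow>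
          Var Hbar divides\<^bsub>HT_pt n\<^esub> restrict_class n (W_class r k n \<sigma> I) J)
    \<and> (\<forall>J\<in>ksubsets k n.
          e_ver r n \<sigma> J divides\<^bsub>HT_pt n\<^esub> restrict_class n (W_class r k n \<sigma> I) J)"
proof -
  interpret grassmannian k n
    by (rule grassmannian.intro) (rule assms)
  interpret W: super_weight k n \<sigma> r I
    by (rule super_weight.intro) (rule assms)+
  obtain \<kappa> where \<kappa>: "\<kappa> \<in> carrier (HT_Gr k n)" "homogeneous_class (env_degree r k n) \<kappa>"
    and \<kappa>_F: "\<And>J. J \<in> ksubsets k n \<Longrightarrow> restrict_class n \<kappa> J = W.F J"
    using class_exists[OF W.vars_F W.homogeneous_F W.gkm_F] by blast
  \<comment> \<open>The description is resolved by existence of a class with restrictions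
    \<open>W.F\<close> and injectivity of localization.\<close>
  have "W_class r k n \<sigma> I = \<kappa>"
    unfolding W_class_def
  proof (rule the_equality)
    show "\<kappa> \<in> carrier (HT_Gr k n) \<and>
        (\<forall>J\<in>ksubsets k n. Fract (restrict_class n \<kappa> J) 1 = W_restr r k n \<sigma> I J)"
      using \<kappa>(1) by (simp add: \<kappa>_F W.W_restr_eq)
  next
    fix \<kappa>' assume \<kappa>': "\<kappa>' \<in> carrier (HT_Gr k n) \<and>
        (\<forall>J\<in>ksubsets k n. Fract (restrict_class n \<kappa>' J) 1 = W_restr r k n \<sigma> I J)"
    show "\<kappa>' = \<kappa>"
    proof (rule class_eqI)
      fix J assume J: "J \<in> ksubsets k n"
      then have "Fract (restrict_class n \<kappa>' J) 1 = Fract (W.F J) 1"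
        using \<kappa>' W.W_restr_eq by simp
      then show "restrict_class n \<kappa>' J = restrict_class n \<kappa> J"
        using J by (simp add: \<kappa>_F eq_fract)
    qed (use \<kappa> \<kappa>' in auto)
  qed
  \<comment> \<open>Divisibility holds among all polynomials by construction of
    \<open>divisor\<close>; it descends to \<open>HT_pt n\<close> because only admissible variables
    occur.\<close>
  moreover have "Var Hbar divides\<^bsub>HT_pt n\<^esub> W.F J" if "J \<in> ksubsets k n" "J \<noteq> I" for J
    unfolding HT_pt_def
  proof (rule divides_mpoly_ringI)
    show "Var Hbar dvd W.F J"
      using W.divisor_dvd_F[of J] that(2) by (auto simp: W.divisor_def intro: dvd_mult_right)
  qed (use W.vars_F[OF that(1)] in auto)
  moreover have "e_ver r n \<sigma> J divides\<^bsub>HT_pt n\<^esub> W.F J" if "J \<in> ksubsets k n" for J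
    unfolding HT_pt_def
  proof (rule divides_mpoly_ringI)
    show "e_ver r n \<sigma> J dvd W.F J"
      using W.divisor_dvd_F[of J] unfolding W.divisor_def by (rule dvd_mult_left)
  qed (use W.vars_F[OF that] W.vars_e_ver[OF that] in auto)
  ultimately show ?thesis
    using \<kappa> \<kappa>_F assms(3) W.F_I by simp
qed

end
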